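(* Let $M,N$ be positive integers varying so that $M+N\to\infty$, and assume $\lim_{M+N\to\infty}M/N=0$. Given $u=|u|e^{i\theta}$ with $\theta\in(-\pi,\pi]$, set $$z_j=\big(\sqrt N\,u\big)^M\Big(1+\frac{v_j}{u\sqrt{MN}}\Big)^M,\qquad j=1,\ldots,n.$$ Then the $n$-point correlation functions $R^{(n)}_{M,N}$ of the eigenvalues of $\Pi_M=X_M\cdots X_1$ (a product of i.i.d. $N\times N$ complex Ginibre matrices) satisfy $$\lim_{M+N\to\infty}\Big(\frac{M}{N|u|^2}\Big)^n|z_1\cdots z_n|^2R^{(n)}_{M,N}(z_1,\ldots,z_n)=\begin{cases}\det\big[\mathrm K^{(\mathrm{bulk})}_{\mathrm{Gin}}(v_i,v_j)\big]_{i,j=1}^n,& |u|\in(0,1),\\[1ex] \det\big[\mathrm K^{(\mathrm{edge})}_{\mathrm{Gin}}(v_i,v_j)\big]_{i,j=1}^n,& |u|=1,\end{cases}$$ uniformly for $v_1,\ldots,v_n$ in a compact subset of $\mathbb C$.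
   Context: $n\ge1$ is a fixed integer. Model: $X_1,\ldots,X_M$ are i.i.d. complex Ginibre matrices of size $N\times N$, i.e. each has i.i.d. standard complex Gaussian entries, and $\Pi_M=X_M\cdots X_1$. The eigenvalues of $\Pi_M$ form a determinantal point process in $\mathbb C$ (with respect to Lebesgue measure), with correlation functions $$R^{(n)}_{M,N}(z_1,\ldots,z_n)=\det[K_{M,N}(z_i,z_j)]_{i,j=1}^n,\qquad K_{M,N}(z_1,z_2)=\frac1\pi\sqrt{w(z_1)w(z_2)}\sum_{j=0}^{N-1}\frac{(z_1\overline{z}_2)^j}{\Gamma(j+1)^M},$$ where, for some $c>0$, $$w(z)=\int_{-c-i\infty}^{-c+i\infty}\frac{ds}{2\pi i}\,(\Gamma(-s))^M|z|^{2s}.$$ Ginibre kernels, with $\theta=\arg u$ and $\mathrm{erfc}(x)=\frac{2}{\sqrt\pi}\int_x^\infty e^{-t^2}dt$ (extended to an entire function): $$\mathrm K^{(\mathrm{bulk})}_{\mathrm{Gin}}(v_1,v_2)=\frac1\pi e^{-\frac12(|v_1|^2+|v_2|^2-2v_1\overline v_2)},$$ $$\mathrm K^{(\mathrm{edge})}_{\mathrm{Gin}}(v_1,v_2)=\frac{1}{2\pi}e^{-\frac12(|v_1|^2+|v_2|^2-2v_1\overline v_2)}\,\mathrm{erfc}\Big(\tfrac{1}{\sqrt2}\big(e^{-i\theta}v_1+e^{i\theta}\overline v_2\big)\Big).$$ *)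

theory Defs
  imports "HOL-Probability.Probability" "HOL-Complex_Analysis.Complex_Analysis"
    "Jordan_Normal_Form.Char_Poly"
begin

hide_const (open) Determinant.det
no_notation vec_index (infixl \<open>$\<close> 100)

section \<open>Products of Ginibre matrices and their eigenvalues\<close>

text \<open>
  The standard complex Gaussian is normalised by \<open>E |x|^2 = 1\<close>, i.e. it has density
  \<open>exp (- |x|^2) / pi\<close> on the plane. This is the normalisation for which the correlation
  kernel below has the stated form (for \<open>M = 1\<close> the weight is \<open>exp (- |z|^2)\<close>).
\<close>

definition iid_ginibre ::
    "'a measure \<Rightarrow> (nat \<Rightarrow> 'a \<Rightarrow> complex mat) \<Rightarrow> nat \<Rightarrow> nat \<Rightarrow> bool" where
  "iid_ginibre P X M N \<longleftrightarrow>
     prob_space P \<and>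
     (\<forall>m\<in>{1..M}. \<forall>\<omega>\<in>space P. X m \<omega> \<in> carrier_mat N N) \<and>
     prob_space.indep_vars P (\<lambda>_. borel) (\<lambda>(m, i, j) \<omega>. X m \<omega> $$ (i, j))
       ({1..M} \<times> {..<N} \<times> {..<N}) \<and>
     (\<forall>m\<in>{1..M}. \<forall>i<N. \<forall>j<N.
        distributed P lborel (\<lambda>\<omega>. X m \<omega> $$ (i, j)) (\<lambda>x. ennreal (exp (- (cmod x)\<^sup>2) / pi)))"

primrec mat_product :: "nat \<Rightarrow> (nat \<Rightarrow> complex mat) \<Rightarrow> nat \<Rightarrow> complex mat" where
  "mat_product N A 0 = 1\<^sub>m N"
| "mat_product N A (Suc m) = A (Suc m) * mat_product N A m"

definition eigenvalues :: "complex mat \<Rightarrow> complex multiset" where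
  "eigenvalues A = proots (char_poly A)"

text \<open>
  A random finite configuration of points (with multiplicity) is a map \<open>E\<close> into multisets.
  A density \<open>\<rho>\<close> is an \<open>n\<close>-point correlation function with respect to Lebesgue measure if it
  is the density of the \<open>n\<close>-th factorial moment measure. The sum runs over all \<open>n\<close>-tuples of
  points at pairwise distinct positions of an enumeration of the multiset (it does not depend
  on the enumeration); \<open>n\<close> is the number of elements of the index type.
\<close>

definition sum_distinct_tuples :: "(complex ^ 'n \<Rightarrow> ennreal) \<Rightarrow> complex multiset \<Rightarrow> ennreal" where
  "sum_distinct_tuples f E =
     (let xs = (SOME xs. mset xs = E) in
      \<Sum>\<sigma> | inj \<sigma> \<and> range \<sigma> \<subseteq> {..<length xs}. f (\<chi> i. xs ! \<sigma> i))"

definition correlation_function ::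
    "'a measure \<Rightarrow> ('a \<Rightarrow> complex multiset) \<Rightarrow> (complex ^ 'n \<Rightarrow> real) \<Rightarrow> bool" where
  "correlation_function P E \<rho> \<longleftrightarrow>
     \<rho> \<in> borel_measurable borel \<and> (\<forall>z. 0 \<le> \<rho> z) \<and>
     (\<forall>f \<in> borel_measurable borel.
        (\<integral>\<^sup>+\<omega>. sum_distinct_tuples f (E \<omega>) \<partial>P) = (\<integral>\<^sup>+z. f z * ennreal (\<rho> z) \<partial>lborel))"

section \<open>The correlation kernel\<close>

text \<open>
  The contour \<open>Re s = - c\<close> is parametrised by \<open>s = - c + i t\<close>, so that
  \<open>ds / (2 pi i) = dt / (2 pi)\<close>.
  At the origin the integral diverges and HOL's value is meaningless; a correlation function is
  only determined up to null sets, so \<open>z = 0\<close> plays no role.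
\<close>

definition weight :: "real \<Rightarrow> nat \<Rightarrow> complex \<Rightarrow> complex" where
  "weight c M z = 1 / (2 * of_real pi) *
     (\<integral>t. (let s = Complex (- c) t
            in Gamma (- s) ^ M * of_real (cmod z) powr (2 * s)) \<partial>lborel)"

definition product_kernel :: "real \<Rightarrow> nat \<Rightarrow> nat \<Rightarrow> complex \<Rightarrow> complex \<Rightarrow> complex" where
  "product_kernel c M N z\<^sub>1 z\<^sub>2 = 1 / of_real pi * csqrt (weight c M z\<^sub>1 * weight c M z\<^sub>2) *
     (\<Sum>j<N. (z\<^sub>1 * cnj z\<^sub>2) ^ j / Gamma (of_nat (j + 1)) ^ M)"

section \<open>Ginibre kernels\<close>

definition real_erfc :: "real \<Rightarrow> real" where
  "real_erfc x = 2 / sqrt pi * (LBINT t:{x..}. exp (- t\<^sup>2))"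

definition erfc :: "complex \<Rightarrow> complex" where
  "erfc = (THE f. f holomorphic_on UNIV \<and> (\<forall>x::real. f (of_real x) = of_real (real_erfc x)))"

lemma real_erfc_has_derivative:
  "(real_erfc has_real_derivative (- (2 / sqrt pi) * exp (- x\<^sup>2))) (at x)"
proof -
  define g where "g = (\<lambda>t::real. exp (- t\<^sup>2))"
  have int: "integrable lborel g"
  proof -
    have "integrable lborel (\<lambda>x. normal_density 0 (1 / sqrt 2) x)"
      by (rule integrable_normal_density) simp
    then have "integrable lborel (\<lambda>x. sqrt pi * normal_density 0 (1 / sqrt 2) x)"
      by simp
    moreover have "(\<lambda>x. sqrt pi * normal_density 0 (1 / sqrt 2) x) = g"
      by (simp add: g_def normal_density_def fun_eq_iff power_divide real_sqrt_mult)
    ultimately show ?thesis by simp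
  qed
  have si: "set_integrable lborel A g" if "A \<in> sets borel" for A
    unfolding set_integrable_def using int that by (intro integrable_mult_indicator) auto
  define a where "a = x - 1"
  define I where "I = (LBINT t:{a..}. g t)"
  have eq: "(LBINT t:{y..}. g t) = I - integral {a..y} g" if "a \<le> y" for y
  proof -
    have "(LBINT t:{a..<y} \<union> {y..}. g t) = (LBINT t:{a..<y}. g t) + (LBINT t:{y..}. g t)"
      by (rule set_integral_Un) (auto intro: si)
    moreover have "{a..<y} \<union> {y..} = {a..}" using that by auto
    moreover have "(LBINT t:{a..<y}. g t) = (LBINT t:{a..y}. g t)"
    proof (rule set_integral_cong_set)
      show "set_borel_measurable lborel {a..<y} g" "set_borel_measurable lborel {a..y} g"
        using si[of "{a..<y}"] si[of "{a..y}"]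
        by (auto simp: set_borel_measurable_def set_integrable_def)
      show "AE t in lborel. (t \<in> {a..y}) = (t \<in> {a..<y})"
        using AE_lborel_singleton[of y] that by (auto elim!: eventually_mono)
    qed
    moreover have "(LBINT t:{a..y}. g t) = integral {a..y} g"
      using si[of "{a..y}"] by (intro set_borel_integral_eq_integral(2)) auto
    ultimately show ?thesis by (simp add: I_def)
  qed
  have "((\<lambda>u. integral {a..u} g) has_real_derivative g x) (at x within {a..x+1})"
    by (rule integral_has_real_derivative) (auto simp: a_def g_def intro!: continuous_intros)
  then have "((\<lambda>u. integral {a..u} g) has_real_derivative g x) (at x)"
    by (simp add: a_def at_within_Icc_at)
  then have "((\<lambda>u. 2 / sqrt pi * (I - integral {a..u} g)) has_real_derivative
      2 / sqrt pi * (0 - g x)) (at x)"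
    by (intro DERIV_cmult DERIV_diff DERIV_const)
  then have "(real_erfc has_real_derivative 2 / sqrt pi * (0 - g x)) (at x)"
  proof (rule has_field_derivative_transform_within_open[where S="{a<..}"])
    fix y assume "y \<in> {a<..}"
    then show "2 / sqrt pi * (I - integral {a..y} g) = real_erfc y"
      using eq[of y] by (simp add: real_erfc_def g_def)
  qed (auto simp: a_def)
  then show ?thesis by (simp add: g_def)
qed

text \<open>The defining property of the entire extension is satisfiable, and by one function only.\<close>

lemma erfc_ex1:
  "\<exists>!f. f holomorphic_on UNIV \<and> (\<forall>x::real. f (of_real x) = of_real (real_erfc x))"
proof (rule ex_ex1I)
  have "(\<lambda>z::complex. exp (- z\<^sup>2)) holomorphic_on UNIV"
    by (intro holomorphic_intros)
  then obtain F :: "complex \<Rightarrow> complex"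
    where "\<And>z. z \<in> UNIV \<Longrightarrow> (F has_field_derivative exp (- z\<^sup>2)) (at z within UNIV)"
    using holomorphic_convex_primitive'[OF convex_UNIV open_UNIV] by blast
  then have F: "(F has_field_derivative exp (- z\<^sup>2)) (at z)" for z
    by simp
  define f where "f = (\<lambda>z. of_real (real_erfc 0) - 2 / of_real (sqrt pi) * (F z - F 0))"
  have f: "(f has_field_derivative - (2 / of_real (sqrt pi)) * exp (- z\<^sup>2)) (at z)" for z
    unfolding f_def by (auto intro!: derivative_eq_intros F)
  have "f holomorphic_on UNIV"
    using f holomorphic_on_open by blast
  moreover have "f (of_real x) = of_real (real_erfc x)" for x
  proof -
    define h where "h = (\<lambda>x::real. f (of_real x) - of_real (real_erfc x))"
    have "(h has_vector_derivative 0) (at x within UNIV)" for x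
    proof -
      have "((\<lambda>x. f (of_real x)) has_vector_derivative
          - (2 / of_real (sqrt pi)) * exp (- (of_real x)\<^sup>2)) (at x)"
        using has_vector_derivative_real_field[OF f] .
      moreover have "((\<lambda>x. of_real (real_erfc x) :: complex) has_vector_derivative
          of_real (- (2 / sqrt pi) * exp (- x\<^sup>2))) (at x)"
        using real_erfc_has_derivative[of x] has_vector_derivative_of_real
          has_real_derivative_iff_has_vector_derivative by blast
      ultimately have "(h has_vector_derivative
          (- (2 / of_real (sqrt pi)) * exp (- (of_real x)\<^sup>2)
            - of_real (- (2 / sqrt pi) * exp (- x\<^sup>2)))) (at x)"
        unfolding h_def by (rule has_vector_derivative_diff)
      then show ?thesis by (simp flip: exp_of_real)
    qed
    then have "h x = h 0"
      by (intro has_derivative_zero_unique[of UNIV h]) (auto simp: has_vector_derivative_def)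
    then show ?thesis by (simp add: h_def f_def)
  qed
  ultimately show "\<exists>f. f holomorphic_on UNIV \<and> (\<forall>x::real. f (of_real x) = of_real (real_erfc x))"
    by blast
next
  fix f g :: "complex \<Rightarrow> complex"
  assume f: "f holomorphic_on UNIV \<and> (\<forall>x::real. f (of_real x) = of_real (real_erfc x))"
    and g: "g holomorphic_on UNIV \<and> (\<forall>x::real. g (of_real x) = of_real (real_erfc x))"
  have "(\<lambda>n. complex_of_real (inverse (real (Suc n)))) \<longlonglongrightarrow> of_real 0"
    by (intro tendsto_of_real LIMSEQ_inverse_real_of_nat)
  moreover have "complex_of_real (inverse (real (Suc n))) \<in> \<real> - {0}" for n
    by (simp del: of_nat_Suc)
  ultimately have lim: "0 islimpt (\<real> :: complex set)"
    unfolding islimpt_sequential of_real_0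
    by (intro exI[of _ "\<lambda>n. complex_of_real (inverse (real (Suc n)))"] conjI allI)
  have hol: "(\<lambda>z. f z - g z) holomorphic_on UNIV"
    using f g by (intro holomorphic_on_diff) auto
  have zero: "f z - g z = 0" if "z \<in> \<real>" for z
  proof -
    from that obtain x where "z = of_real x" by (rule Reals_cases)
    with f g show ?thesis by simp
  qed
  have "f z - g z = 0" for z
    by (rule analytic_continuation[OF hol open_UNIV connected_UNIV subset_UNIV UNIV_I lim zero UNIV_I])
  then show "f = g" by auto
qed

definition gin_bulk :: "complex \<Rightarrow> complex \<Rightarrow> complex" where
  "gin_bulk v\<^sub>1 v\<^sub>2 = 1 / of_real pi *
     exp (- (1 / 2) * (of_real ((cmod v\<^sub>1)\<^sup>2) + of_real ((cmod v\<^sub>2)\<^sup>2) - 2 * v\<^sub>1 * cnj v\<^sub>2))"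

definition gin_edge :: "real \<Rightarrow> complex \<Rightarrow> complex \<Rightarrow> complex" where
  "gin_edge \<theta> v\<^sub>1 v\<^sub>2 = 1 / (2 * of_real pi) *
     exp (- (1 / 2) * (of_real ((cmod v\<^sub>1)\<^sup>2) + of_real ((cmod v\<^sub>2)\<^sup>2) - 2 * v\<^sub>1 * cnj v\<^sub>2)) *
     erfc (1 / of_real (sqrt 2) * (exp (- \<i> * of_real \<theta>) * v\<^sub>1 + exp (\<i> * of_real \<theta>) * cnj v\<^sub>2))"

definition scaled_points :: "nat \<Rightarrow> nat \<Rightarrow> complex \<Rightarrow> complex ^ 'n \<Rightarrow> complex ^ 'n" where
  "scaled_points M N u v = (\<chi> i. (of_real (sqrt (real N)) * u) ^ M *
     (1 + v $ i / (u * of_real (sqrt (real M * real N)))) ^ M)"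

end

theory Submission
  imports Defs "HOL-Real_Asymp.Real_Asymp"
begin

text \<open>
  Put \<open>A = N |u|\<^sup>2\<close>, \<open>a = v / (u sqrt (M N))\<close> and \<open>p = exp (- i \<theta>) v\<close>, so that
  \<open>sqrt (A M) a = p\<close>. Everything rests on the expansion
  \<open>ln Gamma (A + s) = ln Gamma A + s ln A + s\<^sup>2 / (2 A) + small\<close>, whose error stays negligible after
  multiplication by \<open>M\<close> on the scale \<open>s \<approx> sqrt (A / M)\<close> precisely because \<open>M / A\<close> tends to \<open>0\<close>.
  Moving the contour of the weight to \<open>Re s = - A\<close> (purely imaginary increments) turns the weight
  into the Fourier transform of a Gaussian; in the sum over \<open>j\<close> (real increments) the summands become a
  Riemann sum for \<open>\<integral> exp (- x\<^sup>2 / 2 + (p\<^sub>1 + cnj p\<^sub>2) x) dx\<close>, over the whole line if \<open>|u| < 1\<close> and over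
  the negative half-line if \<open>|u| = 1\<close>, which produces \<open>erfc\<close>. Expanding both around the same point \<open>A\<close>
  makes all factors \<open>Gamma A\<close> and \<open>A powr A\<close> cancel exactly, so Stirling's formula is not needed.
  What remains beside the Ginibre kernel is a unimodular factor \<open>g (v\<^sub>i) cnj (g (v\<^sub>j))\<close>, invisible to
  the determinant.
\<close>

section \<open>Second-order expansion of the logarithm of Gamma\<close>

text \<open>The quadratic expansion is proved only for increments up to half the base point, while
  the integral and the sum reach beyond that region. Each therefore needs its own global majorant,
  uniform in \<open>M\<close>, which may stay bounded or grow: a product bound for Gamma on vertical
  lines, and convexity of ln Gamma on the real line. At \<open>|s| = sqrt (A / M)\<close> the three
  error terms, multiplied by \<open>M\<close>, have sizes \<open>sqrt (M / A)\<close>,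
  \<open>1 / A\<close> and \<open>1 / sqrt (A * M)\<close>; the first comes from replacing
  \<open>Digamma A\<close> by \<open>ln A\<close> and vanishes only because \<open>M / A\<close>
  does. The phase \<open>M * A * Im (Ln (1 + a))\<close> need not converge, so an exact identity for
  the rescaled kernel isolates it before any limit is taken. Uniformity in the points is reduced by
  compactness to convergence along arbitrary convergent sequences of points, which is why the limit
  lemmas have moving arguments.\<close>

lemma sums_Polygamma_of_real:
  fixes x :: real
  assumes "x > 0" "n > 0"
  shows "(\<lambda>k. 1 / (x + real k) ^ Suc n) sums ((-1) ^ Suc n * Polygamma n x / fact n)"
  using Polygamma_LIMSEQ[of x n] assms by (simp add: field_simps)

lemma inverse_add_of_nat_tendsto_0:
  "(\<lambda>k. inverse ((x::real) + real k)) \<longlonglongrightarrow> 0"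
  by real_asymp

text \<open>Termwise comparison with a telescoping series: \<open>1 / y ^ 2\<close> is at least
  \<open>1 / y - 1 / (y + 1)\<close>.\<close>

lemma Polygamma_1_ge:
  assumes "x > (0::real)"
  shows "1 / x \<le> Polygamma 1 x"
proof -
  have tel: "(\<lambda>k. inverse (x + real k) - inverse (x + real (Suc k))) sums (inverse (x + real 0) - 0)"
    by (intro telescope_sums' inverse_add_of_nat_tendsto_0)
  have pol: "(\<lambda>k. 1 / (x + real k) ^ 2) sums Polygamma 1 x"
    using sums_Polygamma_of_real[of x 1] assms by (simp add: numeral_2_eq_2)
  have le: "inverse (x + real k) - inverse (x + real (Suc k)) \<le> 1 / (x + real k) ^ 2" for k
  proof -
    define y where "y = x + real k"
    have "y > 0" using assms by (simp add: y_def)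
    then have "inverse y - inverse (y + 1) \<le> 1 / y ^ 2"
      by (simp add: divide_simps power2_eq_square)
    then show ?thesis by (simp add: y_def algebra_simps)
  qed
  show ?thesis using sums_le[OF le tel pol] by (simp add: inverse_eq_divide)
qed

text \<open>Telescoping again, now with the shift by one half that turns
  \<open>y * (y + 1) \<le> (y + 1 / 2) ^ 2\<close> into an upper bound. With the lower bound this
  gives \<open>1 / x\<close> up to an error of order \<open>1 / x ^ 2\<close>.\<close>

lemma Polygamma_1_le:
  assumes "x > (1 / 2 :: real)"
  shows "Polygamma 1 x \<le> 1 / (x - 1 / 2)"
proof -
  have tel: "(\<lambda>k. inverse (x - 1 / 2 + real k) - inverse (x - 1 / 2 + real (Suc k))) sums
      (inverse (x - 1 / 2 + real 0) - 0)"
    by (intro telescope_sums' inverse_add_of_nat_tendsto_0)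
  have pol: "(\<lambda>k. 1 / (x + real k) ^ 2) sums Polygamma 1 x"
    using sums_Polygamma_of_real[of x 1] assms by (simp add: numeral_2_eq_2)
  have le: "1 / (x + real k) ^ 2 \<le> inverse (x - 1 / 2 + real k) - inverse (x - 1 / 2 + real (Suc k))" for k
  proof -
    define y where "y = x + real k - 1 / 2"
    have "y > 0" using assms by (simp add: y_def)
    then have "1 / (y + 1 / 2) ^ 2 \<le> inverse y - inverse (y + 1)"
      by (simp add: divide_simps power2_eq_square) (simp add: algebra_simps)
    then show ?thesis by (simp add: y_def algebra_simps)
  qed
  show ?thesis using sums_le[OF le pol tel] by (simp add: inverse_eq_divide)
qed

text \<open>The series of \<open>1 / |z + k| ^ 3\<close> is compared with integrals: by convexity,
  \<open>1 / y ^ 3\<close> is at most the integral of \<open>1 / t ^ 3\<close> over the unit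
  interval centred at \<open>y\<close>. These integrals telescope, and \<open>g\<close> is the
  corresponding primitive.\<close>

lemma norm_Polygamma_2_le:
  assumes "Re z \<ge> 1"
  shows "norm (Polygamma 2 z) \<le> 4 / (Re z)\<^sup>2"
proof -
  define x where "x = Re z"
  have x: "x \<ge> 1" using assms by (simp add: x_def)
  define g where "g = (\<lambda>k. inverse ((x - 1 / 2 + real k) ^ 2) / 2)"
  have g: "(\<lambda>k. g k - g (Suc k)) sums (g 0 - 0)"
    unfolding g_def by (intro telescope_sums') real_asymp
  have le: "norm (inverse ((z + of_nat k) ^ 3)) \<le> g k - g (Suc k)" for k
  proof -
    define y where "y = x + real k"
    have y: "y \<ge> 1" using x by (simp add: y_def)
    have "y \<le> norm (z + of_nat k)"
      using complex_Re_le_cmod[of "z + of_nat k"] by (simp add: y_def x_def)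
    then have "norm (inverse ((z + of_nat k) ^ 3)) \<le> inverse (y ^ 3)"
      using y by (auto simp: norm_inverse norm_power intro!: le_imp_inverse_le power_mono)
    also have "\<dots> \<le> inverse ((y - 1 / 2) ^ 2) / 2 - inverse ((y + 1 / 2) ^ 2) / 2"
    proof -
      have p: "(y - 1/2) > 0" "y + 1/2 > 0" "y > 0" using y by auto
      have "inverse ((y - 1 / 2) ^ 2) / 2 - inverse ((y + 1 / 2) ^ 2) / 2
         = y / ((y - 1/2)^2 * (y + 1/2)^2)"
        using p by (simp add: divide_simps) (simp add: power2_eq_square algebra_simps)
      moreover have "1 / y ^ 3 \<le> y / ((y - 1/2)^2 * (y + 1/2)^2)"
      proof -
        have "(y - 1/2)^2 * (y + 1/2)^2 = (y^2 - 1/4)^2"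
          by (simp add: power2_eq_square algebra_simps)
        also have "\<dots> \<le> (y^2)^2"
        proof (intro power_mono)
          have "1 \<le> y\<^sup>2" using y by (intro one_le_power) auto
          then show "0 \<le> y\<^sup>2 - 1 / 4" by linarith
        qed auto
        also have "\<dots> = y * y^3" by (simp add: eval_nat_numeral)
        finally show ?thesis using p by (simp add: divide_simps mult_ac)
      qed
      ultimately show ?thesis by (simp add: inverse_eq_divide)
    qed
    also have "\<dots> = g k - g (Suc k)"
      by (simp add: g_def y_def algebra_simps)
    finally show ?thesis .
  qed
  have z: "z \<noteq> 0" using assms by auto
  have "(\<lambda>k. inverse ((z + of_nat k) ^ Suc 2)) sums ((-1) ^ Suc 2 * Polygamma 2 z / fact 2)"
    using z by (intro Polygamma_LIMSEQ) auto
  then have s: "(\<lambda>k. inverse ((z + of_nat k) ^ 3)) sums (- Polygamma 2 z / 2)"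
    by (simp add: eval_nat_numeral)
  have sn: "summable (\<lambda>k. norm (inverse ((z + of_nat k) ^ 3)))"
    using le by (intro summable_comparison_test'[OF sums_summable[OF g]]) auto
  have "norm (- Polygamma 2 z / 2) \<le> (\<Sum>k. norm (inverse ((z + of_nat k) ^ 3)))"
    using s summable_norm[OF sn] by (simp add: sums_iff)
  also have "\<dots> \<le> (\<Sum>k. g k - g (Suc k))"
    using g by (intro suminf_le le sn) (auto simp: sums_iff)
  also have "\<dots> = g 0" using g by (simp add: sums_iff)
  finally have "norm (Polygamma 2 z) \<le> inverse ((x - 1/2)^2)"
    by (simp add: g_def norm_divide)
  \<comment> \<open>Since \<open>x \<ge> 1\<close>, \<open>x - 1 / 2 \<ge> x / 2\<close>; this is
    the source of the constant 4.\<close>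
  also have "\<dots> \<le> inverse ((x / 2)^2)"
    using x by (intro le_imp_inverse_le power_mono) auto
  finally show ?thesis by (simp add: x_def field_simps)
qed

text \<open>By the functional equation \<open>ln_Gamma\<close> increases by exactly
  \<open>ln x\<close> over the interval from \<open>x\<close> to \<open>x + 1\<close>, so
  \<open>ln x\<close> is a value of \<open>Digamma\<close> in between. Monotonicity and
  \<open>Digamma (x + 1) = Digamma x + 1 / x\<close> give both bounds.\<close>

lemma Digamma_approx_ln:
  assumes "x > (0::real)"
  shows "Digamma x \<le> ln x" "ln x \<le> Digamma x + 1 / x"
proof -
  have "\<exists>y>x. y < x + 1 \<and> ln_Gamma (x + 1) - ln_Gamma x = (x + 1 - x) * Digamma y"
    using assms by (intro MVT2) (auto intro!: derivative_eq_intros)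
  then obtain y where y: "x < y" "y < x + 1" "ln_Gamma (x + 1) - ln_Gamma x = Digamma y"
    by auto
  have "ln_Gamma (x + 1) - ln_Gamma x = ln x"
  proof -
    have "x \<notin> \<int>\<^sub>\<le>\<^sub>0" using assms by (auto elim!: nonpos_Ints_cases)
    then have "Gamma (x + 1) = x * Gamma x" by (rule Gamma_plus1)
    then show ?thesis
      using assms ln_mult_pos[of x "Gamma x"] Gamma_real_pos[of x]
      by (simp add: ln_Gamma_real_pos del: ln_mult)
  qed
  then have "ln x = Digamma y" using y by simp
  moreover have "Digamma x \<le> Digamma y" "Digamma y \<le> Digamma (x + 1)"
    using y assms by (auto intro!: Digamma_real_mono)
  moreover have "Digamma (x + 1) = Digamma x + 1 / x"
    using assms by (intro Digamma_plus1) auto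
  ultimately show "Digamma x \<le> ln x" "ln x \<le> Digamma x + 1 / x" by auto
qed

text \<open>A logarithm of \<open>Gamma (c + s) / (Gamma c * c powr s)\<close>. Subtracting
  \<open>s * ln c\<close> instead of the exact linear term \<open>s * Digamma c\<close> keeps the
  normalisation elementary, at the price of an error \<open>|s| / c\<close>.\<close>

definition ln_Gamma_shift :: "real \<Rightarrow> complex \<Rightarrow> complex" where
  "ln_Gamma_shift c s = ln_Gamma (of_real c + s) - ln_Gamma (of_real c) - s * of_real (ln c)"

text \<open>Taylor expansion at \<open>c\<close> in the half-plane \<open>Re z \<ge> c / 2\<close>,
  where the third derivative is at most \<open>16 / c ^ 2\<close>; this gives the cubic error. The
  linear and the quadratic error pay for replacing \<open>Digamma c\<close> by \<open>ln c\<close>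
  and \<open>Polygamma 1 c\<close> by \<open>1 / c\<close>.\<close>

lemma ln_Gamma_shift_approx:
  assumes c: "c \<ge> 2" and s: "norm s \<le> c / 2"
  shows "norm (ln_Gamma_shift c s - s\<^sup>2 / (2 * of_real c)) \<le>
    norm s / c + norm s ^ 2 / c ^ 2 + 8 * norm s ^ 3 / c ^ 2"
proof -
  \<comment> \<open>The successive derivatives of \<open>ln_Gamma\<close>; the index drops by one
    because \<open>Digamma\<close> is \<open>Polygamma 0\<close>.\<close>
  define f where "f = (\<lambda>i. if i = 0 then ln_Gamma else Polygamma (i - 1) :: complex \<Rightarrow> complex)"
  define S where "S = {z. Re z \<ge> c / 2}"
  have S: "z \<notin> \<real>\<^sub>\<le>\<^sub>0" "z \<notin> \<int>\<^sub>\<le>\<^sub>0" if "z \<in> S" for z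
  proof -
    show "z \<notin> \<real>\<^sub>\<le>\<^sub>0"
      using that c by (auto simp: S_def complex_nonpos_Reals_iff)
    then show "z \<notin> \<int>\<^sub>\<le>\<^sub>0" using nonpos_Ints_subset_nonpos_Reals by blast
  qed
  have "cmod (f 0 (of_real c + s) - (\<Sum>i\<le>2. f i (of_real c) * (of_real c + s - of_real c) ^ i / fact i))
      \<le> 16 / c ^ 2 * norm (of_real c + s - of_real c) ^ Suc 2 / fact 2"
  proof (rule complex_Taylor[where S = S])
    show "convex S" unfolding S_def by (rule convex_halfspace_Re_ge)
    show "of_real c \<in> S" using c by (simp add: S_def)
    show "of_real c + s \<in> S"
      using s abs_Re_le_cmod[of s] by (auto simp: S_def)
    show "(f i has_field_derivative f (Suc i) x) (at x within S)" if "x \<in> S" for i x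
    proof (cases i)
      case 0
      with S[OF that] show ?thesis
        by (simp add: f_def has_field_derivative_at_within[OF has_field_derivative_ln_Gamma_complex])
    next
      case (Suc j)
      with S[OF that] show ?thesis
        by (simp add: f_def has_field_derivative_Polygamma)
    qed
    show "norm (f (Suc 2) x) \<le> 16 / c ^ 2" if x: "x \<in> S" for x
    proof -
      have "norm (f (Suc 2) x) \<le> 4 / (Re x) ^ 2"
        using norm_Polygamma_2_le[of x] x c by (simp add: f_def S_def numeral_2_eq_2)
      also have "\<dots> \<le> 4 / (c / 2) ^ 2"
        using x c by (intro divide_left_mono power_mono mult_pos_pos) (auto simp: S_def)
      finally show ?thesis by (simp add: field_simps)
    qed
  qed
  also have "f 0 (of_real c + s) - (\<Sum>i\<le>2. f i (of_real c) * (of_real c + s - of_real c) ^ i / fact i)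
     = ln_Gamma (of_real c + s) - ln_Gamma (of_real c) - of_real (Digamma c) * s - of_real (Polygamma 1 c) * s^2 / 2"
    using c by (simp add: f_def numeral_2_eq_2 flip: Polygamma_of_real)
  finally have T: "norm (ln_Gamma (of_real c + s) - ln_Gamma (of_real c) - of_real (Digamma c) * s
      - of_real (Polygamma 1 c) * s^2 / 2) \<le> 8 * norm s ^ 3 / c ^ 2" (is "norm ?T \<le> _")
    by (simp add: eval_nat_numeral)
  have "ln_Gamma_shift c s - s\<^sup>2 / (2 * of_real c) = ?T + of_real (Digamma c - ln c) * s
      + of_real (Polygamma 1 c - 1 / c) * s^2 / 2"
    by (simp add: ln_Gamma_shift_def algebra_simps diff_divide_distrib)
  also have "norm \<dots> \<le> norm ?T + norm (of_real (Digamma c - ln c) * s)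
      + norm (of_real (Polygamma 1 c - 1 / c) * s^2 / 2)"
    by (intro order_trans[OF norm_triangle_ineq] add_mono order_refl)
  also have "norm (of_real (Digamma c - ln c) * s) \<le> 1 / c * norm s"
    unfolding norm_mult norm_of_real using Digamma_approx_ln[of c] c
    by (intro mult_right_mono) auto
  also have "norm (of_real (Polygamma 1 c - 1 / c) * s^2 / 2) \<le> (2 / c^2) * norm s ^ 2 / 2"
  proof -
    have "1 / (c - 1 / 2) - 1 / c \<le> 2 / c^2"
      using c by (simp add: divide_simps power2_eq_square)
    then have "\<bar>Polygamma 1 c - 1 / c\<bar> \<le> 2 / c^2"
      using Polygamma_1_ge[of c] Polygamma_1_le[of c] c by simp
    then have "\<bar>Polygamma 1 c - 1 / c\<bar> * norm s ^ 2 / 2 \<le> (2 / c^2) * norm s ^ 2 / 2"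
      by (intro divide_right_mono mult_right_mono) auto
    then show ?thesis
      by (simp only: norm_mult norm_of_real norm_divide norm_power norm_numeral)
  qed
  finally show ?thesis using T by simp
qed

lemma ln_Gamma_shift_tendsto:
  fixes M :: "nat \<Rightarrow> nat" and c :: "nat \<Rightarrow> real"
  assumes M: "\<And>k. M k > 0" and c: "filterlim c at_top sequentially"
    and Mc: "(\<lambda>k. M k / c k) \<longlonglongrightarrow> 0"
    and s: "(\<lambda>k. s k * of_real (sqrt (M k / c k))) \<longlonglongrightarrow> q"
  shows "(\<lambda>k. of_nat (M k) * ln_Gamma_shift (c k) (s k)) \<longlonglongrightarrow> q\<^sup>2 / 2"
proof -
  define e where "e = (\<lambda>k. sqrt (M k / c k))"
  define r where "r = (\<lambda>k. norm (s k * of_real (e k)))"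
  have e: "e \<longlonglongrightarrow> 0" unfolding e_def using tendsto_real_sqrt[OF Mc] by simp
  have r: "r \<longlonglongrightarrow> norm q" unfolding r_def e_def by (intro tendsto_norm s)
  have c2: "eventually (\<lambda>k. c k \<ge> 2) sequentially"
    using c by (simp add: filterlim_at_top)
  \<comment> \<open>With \<open>|s| = r / e\<close> the three error terms times \<open>M\<close> are
    \<open>r * e\<close>, \<open>r ^ 2 / c\<close> and \<open>8 * r ^ 3 / (c * e)\<close>. In the
    last one \<open>c * e = sqrt (c * M)\<close> is bounded below by \<open>sqrt c\<close>.\<close>
  have ev: "eventually (\<lambda>k. norm (of_nat (M k) * ln_Gamma_shift (c k) (s k) - (s k * of_real (e k))\<^sup>2 / 2)
      \<le> r k * e k + r k ^ 2 / c k + 8 * (r k ^ 3 * inverse (sqrt (c k)))) sequentially"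
  proof -
    \<comment> \<open>This secures \<open>norm s \<le> c / 2\<close>: as \<open>M \<ge> 1\<close>,
      \<open>|s|\<close> is at most \<open>r * sqrt c\<close>.\<close>
    have "(\<lambda>k. r k * (1 / sqrt (c k))) \<longlonglongrightarrow> norm q * 0"
      by (intro tendsto_mult r real_tendsto_divide_at_top[OF tendsto_const] filterlim_compose[OF sqrt_at_top c])
    then have "eventually (\<lambda>k. r k * (1 / sqrt (c k)) < 1 / 2) sequentially"
      by (intro order_tendstoD) auto
    with c2 show ?thesis
    proof eventually_elim
      case (elim k)
      have c0: "c k > 0" using elim by simp
      have m1: "real (M k) \<ge> 1" using M[of k] by simp
      have ek: "e k > 0" "e k ^ 2 = M k / c k" using M[of k] c0 by (auto simp: e_def)
      have rs: "norm (s k) = r k / e k" using ek by (simp add: r_def norm_mult)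
      have r0: "r k \<ge> 0" by (simp add: r_def)
      have ie: "1 / e k \<le> sqrt (c k)"
        using m1 c0 by (simp add: e_def real_sqrt_divide field_simps)
      have "norm (s k) \<le> r k * sqrt (c k)"
        using mult_left_mono[OF ie r0] by (simp add: rs)
      also have "\<dots> \<le> c k / 2"
      proof -
        have "r k * (1 / sqrt (c k)) * c k \<le> 1 / 2 * c k"
          using elim c0 by (intro mult_right_mono) auto
        moreover have "1 / sqrt (c k) * c k = sqrt (c k)"
          using c0 by (simp add: real_div_sqrt)
        ultimately show ?thesis by (simp only: mult.assoc)
      qed
      finally have "norm (ln_Gamma_shift (c k) (s k) - (s k)\<^sup>2 / (2 * of_real (c k))) \<le>
          norm (s k) / c k + norm (s k) ^ 2 / c k ^ 2 + 8 * norm (s k) ^ 3 / c k ^ 2"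
        using elim by (intro ln_Gamma_shift_approx) auto
      then have "M k * norm (ln_Gamma_shift (c k) (s k) - (s k)\<^sup>2 / (2 * of_real (c k))) \<le>
          M k * (norm (s k) / c k + norm (s k) ^ 2 / c k ^ 2 + 8 * norm (s k) ^ 3 / c k ^ 2)"
        by (intro mult_left_mono) auto
      also have "M k * norm (ln_Gamma_shift (c k) (s k) - (s k)\<^sup>2 / (2 * of_real (c k)))
         = norm (of_nat (M k) * ln_Gamma_shift (c k) (s k) - (s k * of_real (e k))\<^sup>2 / 2)"
      proof -
        have "(s k * of_real (e k))\<^sup>2 / 2 = of_nat (M k) * ((s k)\<^sup>2 / (2 * of_real (c k)))"
          using ek(2) by (simp add: power_mult_distrib flip: of_real_power) (simp add: mult.commute)
        then show ?thesis
          by (simp only: norm_mult norm_of_nat flip: right_diff_distrib)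
      qed
      also have "M k * (norm (s k) / c k + norm (s k) ^ 2 / c k ^ 2 + 8 * norm (s k) ^ 3 / c k ^ 2)
          = r k * e k + r k ^ 2 / c k + 8 * (r k ^ 3 * (1 / (c k * e k)))"
      proof -
        have M': "real (M k) = e k ^ 2 * c k" using ek c0 by simp
        show ?thesis unfolding M' rs using ek(1) c0
          by (simp add: field_simps) (simp add: algebra_simps eval_nat_numeral)
      qed
      also have "1 / (c k * e k) \<le> inverse (sqrt (c k))"
      proof -
        have "1 / (c k * e k) \<le> sqrt (c k) / c k"
          using ie c0 by (simp add: field_simps)
        also have "\<dots> = inverse (sqrt (c k))" using c0 by (intro sqrt_divide_self_eq) auto
        finally show ?thesis .
      qed
      finally show ?case using r0 by (simp add: mult_left_mono)
    qed
  qed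
  have "(\<lambda>k. r k * e k + r k ^ 2 * inverse (c k) + 8 * (r k ^ 3 * inverse (sqrt (c k)))) \<longlonglongrightarrow>
      norm q * 0 + norm q ^ 2 * 0 + 8 * (norm q ^ 3 * 0)"
    by (intro tendsto_intros r e tendsto_inverse_0_at_top c filterlim_compose[OF sqrt_at_top c])
  then have "(\<lambda>k. of_nat (M k) * ln_Gamma_shift (c k) (s k) - (s k * of_real (e k))\<^sup>2 / 2) \<longlonglongrightarrow> 0"
    by (intro Lim_null_comparison[OF ev]) (simp add: divide_inverse)
  moreover have "(\<lambda>k. (s k * of_real (e k))\<^sup>2 / 2) \<longlonglongrightarrow> q\<^sup>2 / 2"
    using s by (intro tendsto_intros) (auto simp: e_def)
  ultimately show ?thesis
    by (rule Lim_transform[rotated, OF _ ])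
qed

lemma exp_ln_Gamma_shift:
  assumes "c > 0" "Re s > - c"
  shows "exp (ln_Gamma_shift c s) = Gamma (of_real c + s) / (Gamma (of_real c) * of_real c powr s)"
proof -
  have *: "exp (ln_Gamma z) = Gamma z" if "Re z > 0" for z :: complex
  proof -
    have "z \<notin> \<int>\<^sub>\<le>\<^sub>0" using that by (auto elim!: nonpos_Ints_cases')
    then show ?thesis by (simp add: Gamma_complex_altdef)
  qed
  have "of_real c powr s = exp (s * of_real (ln c))"
    using assms by (simp add: powr_def Ln_of_real)
  then show ?thesis
    using assms by (simp add: ln_Gamma_shift_def exp_diff *)
qed

section \<open>Gaussian integrals and the complementary error function\<close>

text \<open>The majorants for the weight and for the sum are available only once \<open>A\<close> is
  large, so domination is asked for all but finitely many indices.\<close>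

lemma integral_dominated_convergence_eventually:
  fixes s :: "nat \<Rightarrow> 'a \<Rightarrow> 'b::{banach, second_countable_topology}"
  assumes f: "f \<in> borel_measurable M" and s: "\<And>i. s i \<in> borel_measurable M" and w: "integrable M w"
    and lim: "AE x in M. (\<lambda>i. s i x) \<longlonglongrightarrow> f x"
    and bound: "eventually (\<lambda>i. \<forall>x. norm (s i x) \<le> w x) sequentially"
  shows "(\<lambda>i. integral\<^sup>L M (s i)) \<longlonglongrightarrow> integral\<^sup>L M f"
proof -
  obtain K where K: "\<And>i. i \<ge> K \<Longrightarrow> \<forall>x. norm (s i x) \<le> w x"
    using bound by (auto simp: eventually_sequentially)
  have "(\<lambda>i. integral\<^sup>L M (s (i + K))) \<longlonglongrightarrow> integral\<^sup>L M f"
  proof (rule integral_dominated_convergence[OF f s w])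
    show "AE x in M. (\<lambda>i. s (i + K) x) \<longlonglongrightarrow> f x"
      using lim by eventually_elim (rule LIMSEQ_ignore_initial_segment)
    show "AE x in M. norm (s (i + K) x) \<le> w x" for i
      using K[of "i + K"] by simp
  qed
  then show ?thesis by (rule LIMSEQ_offset)
qed

lemma integrable_inverse_1_plus_square_scaled:
  assumes "a > 0"
  shows "integrable lborel (\<lambda>x::real. 1 / (1 + a * x\<^sup>2))"
proof -
  have "integrable lborel (\<lambda>x::real. inverse (1 + x\<^sup>2))"
    using integrable_inverse_1_plus_square by (simp add: set_integrable_def)
  then have "integrable lborel (\<lambda>x::real. inverse (1 + (0 + sqrt a * x)\<^sup>2))"
    using assms by (subst lborel_integrable_real_affine_iff) auto
  then show ?thesis using assms by (simp add: power_mult_distrib inverse_eq_divide)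
qed

text \<open>Completing the square, the modulus is a constant multiple of the normal density centred
  at \<open>Re b\<close>.\<close>

lemma integrable_gaussian_linear:
  "integrable lborel (\<lambda>x::real. exp (- (of_real x)\<^sup>2 / 2 + b * of_real x :: complex))"
proof (rule Bochner_Integration.integrable_bound)
  show "integrable lborel (\<lambda>x. sqrt (2 * pi) * exp ((Re b)\<^sup>2 / 2) * normal_density (Re b) 1 x)"
    by simp
  have "norm (exp (- (of_real x)\<^sup>2 / 2 + b * of_real x :: complex))
      = norm (sqrt (2 * pi) * exp ((Re b)\<^sup>2 / 2) * normal_density (Re b) 1 x)" for x
  proof -
    have "- (x - Re b)\<^sup>2 / 2 = - x\<^sup>2 / 2 + Re b * x - (Re b)\<^sup>2 / 2"
      by (simp add: power2_eq_square field_simps)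
    then have "sqrt (2 * pi) * exp ((Re b)\<^sup>2 / 2) * normal_density (Re b) 1 x
        = exp (- x\<^sup>2 / 2 + Re b * x)"
      by (simp add: normal_density_def exp_diff)
    moreover have "Re ((of_real x)\<^sup>2 :: complex) = x\<^sup>2"
      by (simp flip: of_real_power)
    ultimately show ?thesis by (simp)
  qed
  then show "AE x in lborel. norm (exp (- (of_real x)\<^sup>2 / 2 + b * of_real x :: complex))
      \<le> norm (sqrt (2 * pi) * exp ((Re b)\<^sup>2 / 2) * normal_density (Re b) 1 x)"
    by simp
qed measurable

text \<open>The imaginary part of \<open>b\<close> is handled by the characteristic function of the
  standard normal law, the real part by a real translation of the variable, so no contour has to be
  moved.\<close>

lemma integral_gaussian_linear:
  "(\<integral>x. exp (- (of_real x)\<^sup>2 / 2 + b * of_real x :: complex) \<partial>lborel) =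
    of_real (sqrt (2 * pi)) * exp (b\<^sup>2 / 2)"
proof -
  define a y where "a = Re b" and "y = Im b"
  have b: "b = of_real a + \<i> * of_real y" by (simp add: a_def y_def complex_eq_iff)
  have *: "(\<integral>x. exp (- (of_real x)\<^sup>2 / 2 + \<i> * of_real y * of_real x :: complex) \<partial>lborel)
      = of_real (sqrt (2 * pi)) * exp (- (of_real y)\<^sup>2 / 2)"
  proof -
    have "complex_of_real (exp (- y\<^sup>2 / 2)) = char std_normal_distribution y"
      by (simp add: char_std_normal_distribution)
    also have "\<dots> = (\<integral>x. std_normal_density x *\<^sub>R iexp (y * x) \<partial>lborel)"
      unfolding char_def by (subst integral_density) auto
    also have "\<dots> = (\<integral>x. of_real (1 / sqrt (2 * pi)) * exp (- (of_real x)\<^sup>2 / 2 + \<i> * of_real y * of_real x :: complex) \<partial>lborel)"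
    proof (rule Bochner_Integration.integral_cong)
      fix x :: real
      have "exp (- (of_real x)\<^sup>2 / 2 + \<i> * of_real y * of_real x :: complex)
         = of_real (exp (- x\<^sup>2 / 2)) * iexp (y * x)"
        by (simp only: exp_add) (simp add: mult.assoc flip: exp_of_real)
      then show "std_normal_density x *\<^sub>R iexp (y * x) = of_real (1 / sqrt (2 * pi)) * exp (- (of_real x)\<^sup>2 / 2 + \<i> * of_real y * of_real x :: complex)"
        by (simp add: std_normal_density_def scaleR_conv_of_real)
    qed simp
    also have "\<dots> = of_real (1 / sqrt (2 * pi)) * (\<integral>x. exp (- (of_real x)\<^sup>2 / 2 + \<i> * of_real y * of_real x :: complex) \<partial>lborel)"
      by simp
    finally show ?thesis by (simp add: field_simps flip: exp_of_real)
  qed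
  have "(\<integral>x. exp (- (of_real x)\<^sup>2 / 2 + b * of_real x :: complex) \<partial>lborel)
    = (\<integral>x. exp (- (of_real (a + 1 * x))\<^sup>2 / 2 + b * of_real (a + 1 * x) :: complex) \<partial>lborel)"
    by (subst lborel_integral_real_affine[of 1 _ a]) auto
  also have "\<dots> = (\<integral>x. exp ((of_real a)\<^sup>2 / 2 + \<i> * of_real y * of_real a) * exp (- (of_real x)\<^sup>2 / 2 + \<i> * of_real y * of_real x :: complex) \<partial>lborel)"
  proof (rule Bochner_Integration.integral_cong)
    fix x :: real
    have "- (of_real (a + 1 * x))\<^sup>2 / 2 + b * of_real (a + 1 * x) =
        ((of_real a)\<^sup>2 / 2 + \<i> * of_real y * of_real a) + (- (of_real x)\<^sup>2 / 2 + \<i> * of_real y * of_real x)"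
      unfolding b by (simp add: power2_eq_square field_simps)
    then show "exp (- (of_real (a + 1 * x))\<^sup>2 / 2 + b * of_real (a + 1 * x) :: complex) =
        exp ((of_real a)\<^sup>2 / 2 + \<i> * of_real y * of_real a) * exp (- (of_real x)\<^sup>2 / 2 + \<i> * of_real y * of_real x)"
      by (simp only: exp_add)
  qed simp
  also have "\<dots> = exp ((of_real a)\<^sup>2 / 2 + \<i> * of_real y * of_real a) * (of_real (sqrt (2 * pi)) * exp (- (of_real y)\<^sup>2 / 2))"
    by (simp only: integral_mult_right_zero *)
  also have "\<dots> = of_real (sqrt (2 * pi)) * exp ((of_real a)\<^sup>2 / 2 + \<i> * of_real y * of_real a + - (of_real y)\<^sup>2 / 2)"
    by (simp only: exp_add mult_ac)
  also have "(of_real a)\<^sup>2 / 2 + \<i> * of_real y * of_real a + - (of_real y)\<^sup>2 / 2 = b\<^sup>2 / 2"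
    unfolding b by (simp add: power2_eq_square field_simps)
  finally show ?thesis .
qed

section \<open>The entire complementary error function and the Gaussian integral over a
  half-line\<close>

lemma erfc_holomorphic: "erfc holomorphic_on UNIV"
  and erfc_of_real: "erfc (of_real x) = of_real (real_erfc x)"
  using theI'[OF erfc_ex1] by (simp_all add: erfc_def)

text \<open>On the real axis the derivative is that of \<open>real_erfc\<close>; the identity
  theorem for entire functions extends the formula to the plane.\<close>

lemma erfc_has_field_derivative:
  "(erfc has_field_derivative - (2 / of_real (sqrt pi)) * exp (- z\<^sup>2)) (at z)"
proof -
  define g where "g = (\<lambda>z. deriv erfc z + 2 / of_real (sqrt pi) * exp (- z\<^sup>2))"
  have d: "(erfc has_field_derivative deriv erfc z) (at z)" for z
    using erfc_holomorphic by (auto intro: holomorphic_derivI)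
  have hol: "g holomorphic_on UNIV"
    unfolding g_def by (intro holomorphic_intros erfc_holomorphic) auto
  have zero: "g z = 0" if "z \<in> \<real>" for z
  proof -
    from that obtain x where x: "z = of_real x" by (rule Reals_cases)
    have "((\<lambda>x. erfc (of_real x)) has_vector_derivative deriv erfc (of_real x)) (at x)"
      by (intro has_vector_derivative_real_field d)
    moreover have "((\<lambda>x. erfc (of_real x)) has_vector_derivative
          of_real (- (2 / sqrt pi) * exp (- x\<^sup>2))) (at x)"
      unfolding erfc_of_real using real_erfc_has_derivative[of x] has_vector_derivative_of_real
          has_real_derivative_iff_has_vector_derivative by blast
    ultimately have "deriv erfc (of_real x) = of_real (- (2 / sqrt pi) * exp (- x\<^sup>2))"
      by (rule vector_derivative_unique_at)
    then show ?thesis by (simp add: g_def x flip: exp_of_real)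
  qed
  have "(\<lambda>n. complex_of_real (inverse (real (Suc n)))) \<longlonglongrightarrow> of_real 0"
    by (intro tendsto_of_real LIMSEQ_inverse_real_of_nat)
  moreover have "complex_of_real (inverse (real (Suc n))) \<in> \<real> - {0}" for n
    by (simp del: of_nat_Suc)
  ultimately have lim: "0 islimpt (\<real> :: complex set)"
    unfolding islimpt_sequential of_real_0
    by (intro exI[of _ "\<lambda>n. complex_of_real (inverse (real (Suc n)))"] conjI allI)
  have "g z = 0"
    by (rule analytic_continuation[OF hol open_UNIV connected_UNIV subset_UNIV UNIV_I lim zero UNIV_I])
  then have "deriv erfc z = - (2 / of_real (sqrt pi)) * exp (- z\<^sup>2)"
    by (simp add: g_def add_eq_0_iff2)
  with d[of z] show ?thesis by simp
qed

lemma real_erfc_tendsto_0: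
  assumes X: "filterlim X at_top sequentially"
  shows "(\<lambda>n. real_erfc (X n)) \<longlonglongrightarrow> 0"
proof -
  have int: "integrable lborel (\<lambda>t::real. exp (- t\<^sup>2))"
  proof -
    have "integrable lborel (\<lambda>x. sqrt pi * normal_density 0 (1 / sqrt 2) x)"
      by simp
    moreover have "(\<lambda>x. sqrt pi * normal_density 0 (1 / sqrt 2) x) = (\<lambda>t::real. exp (- t\<^sup>2))"
      by (simp add: normal_density_def fun_eq_iff power_divide real_sqrt_mult)
    ultimately show ?thesis by simp
  qed
  have "(\<lambda>n. \<integral>t. indicator {X n..} t *\<^sub>R exp (- t\<^sup>2) \<partial>lborel) \<longlonglongrightarrow> (\<integral>(t::real). 0 \<partial>lborel)"
  proof (rule integral_dominated_convergence[OF _ _ int])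
    show "AE t in lborel. (\<lambda>n. indicator {X n..} t *\<^sub>R exp (- t\<^sup>2)) \<longlonglongrightarrow> (0::real)"
    proof (rule AE_I2)
      fix t :: real
      have "eventually (\<lambda>n. X n > t) sequentially"
        using X by (simp add: filterlim_at_top_dense)
      then show "(\<lambda>n. indicator {X n..} t *\<^sub>R exp (- t\<^sup>2)) \<longlonglongrightarrow> (0::real)"
        by (intro tendsto_eventually) (auto elim!: eventually_mono)
    qed
  qed (auto simp: indicator_def)
  then have "(\<lambda>n. 2 / sqrt pi * (LBINT t:{X n..}. exp (- t\<^sup>2))) \<longlonglongrightarrow> 2 / sqrt pi * 0"
    unfolding set_lebesgue_integral_def by (intro tendsto_intros) simp
  then show ?thesis by (simp add: real_erfc_def)
qed

text \<open>Each point is compared with its real projection \<open>x n\<close>. On the vertical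
  segment between them \<open>|exp (- w\<^sup>2)|\<close> is at most
  \<open>exp (y\<^sup>2 - (x n)\<^sup>2)\<close>, which tends to 0 as the segment, of bounded
  length, moves to the right.\<close>

lemma erfc_translate_tendsto_0:
  "(\<lambda>n. erfc ((b + of_nat n) / of_real (sqrt 2))) \<longlonglongrightarrow> 0"
proof -
  define x where "x = (\<lambda>n. (Re b + real n) / sqrt 2)"
  define y where "y = \<bar>Im b\<bar>"
  have x: "filterlim x at_top sequentially"
    unfolding x_def by real_asymp
  have "(\<lambda>n. erfc (of_real (x n))) \<longlonglongrightarrow> 0"
    unfolding erfc_of_real using tendsto_of_real[OF real_erfc_tendsto_0[OF x], where ?'a = complex] by simp
  moreover have "(\<lambda>n. erfc ((b + of_nat n) / of_real (sqrt 2)) - erfc (of_real (x n))) \<longlonglongrightarrow> 0"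
  proof (rule Lim_null_comparison)
    show "eventually (\<lambda>n. norm (erfc ((b + of_nat n) / of_real (sqrt 2)) - erfc (of_real (x n)))
        \<le> 2 / sqrt pi * exp (y\<^sup>2 - (x n)\<^sup>2) * y) sequentially"
    proof (intro always_eventually allI)
      fix n
      define z where "z = (b + of_nat n) / of_real (sqrt 2)"
      have zx: "z = of_real (x n) + \<i> * of_real (Im b / sqrt 2)"
        by (simp add: z_def x_def complex_eq_iff Re_divide_of_real Im_divide_of_real)
      have y': "\<bar>Im b / sqrt 2\<bar> \<le> y"
        by (simp add: y_def divide_le_eq mult_le_cancel_left1)
      have "norm (erfc z - erfc (of_real (x n))) \<le>
          2 / sqrt pi * exp (y\<^sup>2 - (x n)\<^sup>2) * norm (z - of_real (x n))"
      proof (rule field_differentiable_bound[where S = "closed_segment (of_real (x n)) z"])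
        fix w assume "w \<in> closed_segment (of_real (x n)) z"
        then obtain t where t: "0 \<le> t" "t \<le> 1" and w: "w = (1 - t) *\<^sub>R of_real (x n) + t *\<^sub>R z"
          by (auto simp: closed_segment_def)
        have "Re w = x n" "\<bar>Im w\<bar> = t * \<bar>Im b / sqrt 2\<bar>"
          using t by (auto simp: w zx algebra_simps abs_mult)
        moreover have "t * \<bar>Im b / sqrt 2\<bar> \<le> 1 * y"
          using t y' by (intro mult_mono) auto
        ultimately have "Re w = x n" "(Im w)\<^sup>2 \<le> y\<^sup>2"
          by (auto simp: abs_le_square_iff[symmetric] y_def)
        then have "Re (- w\<^sup>2) \<le> y\<^sup>2 - (x n)\<^sup>2" by (simp add: Re_power2)
        then show "norm (- (2 / of_real (sqrt pi)) * exp (- w\<^sup>2)) \<le> 2 / sqrt pi * exp (y\<^sup>2 - (x n)\<^sup>2)"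
          by (simp add: norm_mult norm_divide) (intro divide_right_mono, auto)
        show "(erfc has_field_derivative - (2 / of_real (sqrt pi)) * exp (- w\<^sup>2))
            (at w within closed_segment (of_real (x n)) z)"
          by (rule has_field_derivative_at_within[OF erfc_has_field_derivative])
      qed auto
      also have "\<dots> \<le> 2 / sqrt pi * exp (y\<^sup>2 - (x n)\<^sup>2) * y"
      proof (rule mult_left_mono)
        show "norm (z - of_real (x n)) \<le> y"
          using y' by (simp add: zx norm_mult norm_divide)
      qed simp
      finally show "norm (erfc ((b + of_nat n) / of_real (sqrt 2)) - erfc (of_real (x n)))
        \<le> 2 / sqrt pi * exp (y\<^sup>2 - (x n)\<^sup>2) * y" by (simp add: z_def)
    qed
    show "(\<lambda>n. 2 / sqrt pi * exp (y\<^sup>2 - (x n)\<^sup>2) * y) \<longlonglongrightarrow> 0"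
      unfolding x_def by real_asymp
  qed
  ultimately show ?thesis
    using tendsto_add by fastforce
qed

text \<open>Completing the square gives
  \<open>exp (b\<^sup>2 / 2) * exp (- (b - x)\<^sup>2 / 2)\<close>, so a multiple of
  \<open>erfc ((b - x) / sqrt 2)\<close> is a primitive. It vanishes as \<open>x\<close> goes to
  minus infinity, even for complex \<open>b\<close>.\<close>

lemma integral_gaussian_linear_halfline:
  "(\<integral>x. indicator {..<0} x *\<^sub>R exp (- (of_real x)\<^sup>2 / 2 + b * of_real x :: complex) \<partial>lborel) =
    of_real (sqrt (2 * pi) / 2) * exp (b\<^sup>2 / 2) * erfc (b / of_real (sqrt 2))"
proof -
  define h where "h = (\<lambda>x::real. exp (- (of_real x)\<^sup>2 / 2 + b * of_real x :: complex))"
  define F where "F = (\<lambda>x::real. of_real (sqrt (2 * pi) / 2) * exp (b\<^sup>2 / 2) * erfc ((b - of_real x) / of_real (sqrt 2)))"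
  have F: "(F has_vector_derivative h x) (at x within A)" for x A
  proof -
    have "((\<lambda>z. of_real (sqrt (2 * pi) / 2) * exp (b\<^sup>2 / 2) * erfc ((b - z) / of_real (sqrt 2)))
      has_field_derivative of_real (sqrt (2 * pi) / 2) * exp (b\<^sup>2 / 2) *
        (- (2 / of_real (sqrt pi)) * exp (- ((b - of_real x) / of_real (sqrt 2))\<^sup>2) * (- 1 / of_real (sqrt 2)))) (at (of_real x))"
    proof (rule DERIV_cmult, rule DERIV_chain2[OF erfc_has_field_derivative])
      show "((\<lambda>z. (b - z) / of_real (sqrt 2)) has_field_derivative - 1 / of_real (sqrt 2)) (at (of_real x))"
        by (intro DERIV_cdivide) (auto intro!: derivative_eq_intros)
    qed
    also have "of_real (sqrt (2 * pi) / 2) * exp (b\<^sup>2 / 2) *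
        (- (2 / of_real (sqrt pi)) * exp (- ((b - of_real x) / of_real (sqrt 2))\<^sup>2) * (- 1 / of_real (sqrt 2)))
      = exp (b\<^sup>2 / 2) * exp (- ((b - of_real x) / of_real (sqrt 2))\<^sup>2)"
      by (simp add: real_sqrt_mult)
    also have "\<dots> = h x"
    proof -
      have "((b - of_real x) / of_real (sqrt 2))\<^sup>2 = (b - of_real x)\<^sup>2 / 2"
        by (simp add: power_divide flip: of_real_power)
      then have "b\<^sup>2 / 2 + - ((b - of_real x) / of_real (sqrt 2))\<^sup>2 = - (of_real x)\<^sup>2 / 2 + b * of_real x"
        by (simp only:) (simp add: power2_eq_square field_simps)
      then show ?thesis
        unfolding h_def exp_add[symmetric] by (simp only:)
    qed
    finally show ?thesis
      unfolding F_def by (rule has_vector_derivative_at_within[OF has_vector_derivative_real_field])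
  qed
  have int: "integrable lborel h" unfolding h_def by (rule integrable_gaussian_linear)
  have cont: "continuous_on A h" for A unfolding h_def by (intro continuous_intros) auto
  have "(\<lambda>n. \<integral>x. indicator {- real n..0} x *\<^sub>R h x \<partial>lborel) \<longlonglongrightarrow> (\<integral>x. indicator {..<0} x *\<^sub>R h x \<partial>lborel)"
  proof (rule integral_dominated_convergence[OF _ _ integrable_norm[OF int]])
    show "(\<lambda>x. indicator {..<0} x *\<^sub>R h x) \<in> borel_measurable lborel"
      using int by (intro borel_measurable_scaleR) auto
    show "(\<lambda>x. indicator {- real n..0} x *\<^sub>R h x) \<in> borel_measurable lborel" for n
      using int by (intro borel_measurable_scaleR) auto
    show "AE x in lborel. (\<lambda>n. indicator {- real n..0} x *\<^sub>R h x) \<longlonglongrightarrow> indicator {..<0} x *\<^sub>R h x"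
      using AE_lborel_singleton[of 0]
    proof eventually_elim
      fix x :: real assume "x \<noteq> 0"
      have "eventually (\<lambda>n. real n > - x) sequentially"
        using filterlim_real_sequentially by (simp add: filterlim_at_top_dense)
      then have "eventually (\<lambda>n. indicator {- real n..0} x *\<^sub>R h x = indicator {..<0} x *\<^sub>R h x) sequentially"
        by eventually_elim (use \<open>x \<noteq> 0\<close> in \<open>auto simp: indicator_def\<close>)
      then show "(\<lambda>n. indicator {- real n..0} x *\<^sub>R h x) \<longlonglongrightarrow> indicator {..<0} x *\<^sub>R h x"
        by (rule tendsto_eventually)
    qed
  qed (auto simp: indicator_def)
  moreover have "(\<integral>x. indicator {- real n..0} x *\<^sub>R h x \<partial>lborel) = F 0 - F (- real n)" for n
    by (intro integral_FTC_Icc F cont) auto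
  moreover have "(\<lambda>n. F 0 - F (- real n)) \<longlonglongrightarrow> F 0 - of_real (sqrt (2 * pi) / 2) * exp (b\<^sup>2 / 2) * 0"
  proof -
    have "F (- real n) = of_real (sqrt (2 * pi) / 2) * exp (b\<^sup>2 / 2) * erfc ((b + of_nat n) / of_real (sqrt 2))" for n
      by (simp add: F_def)
    then show ?thesis
      by (simp only:) (intro tendsto_intros erfc_translate_tendsto_0)
  qed
  ultimately have "(\<integral>x. indicator {..<0} x *\<^sub>R h x \<partial>lborel) =
      F 0 - of_real (sqrt (2 * pi) / 2) * exp (b\<^sup>2 / 2) * 0"
    by (simp only:) (rule LIMSEQ_unique)
  then show ?thesis by (simp add: h_def F_def)
qed

section \<open>Asymptotics of the weight\<close>

text \<open>In the Gauss product, passing from the real point to the vertical line multiplies the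
  modulus by one factor \<open>(x + k) / |x + i t + k|\<close> for each \<open>k\<close>. All these
  factors are at most 1, so keeping any \<open>n\<close> of them gives an upper bound. The number
  \<open>n\<close> is left free: 0, 2 and about \<open>x\<close> factors are used below.\<close>

lemma norm_Gamma_le:
  assumes "x > 0"
  shows "norm (Gamma (Complex x t)) \<le> Gamma x * (\<Prod>k<n. (x + real k) / norm (Complex x t + of_nat k))"
proof (rule LIMSEQ_le)
  define z where "z = Complex x t"
  define q where "q = (\<lambda>k. (x + real k) / norm (z + of_nat k))"
  have pos: "x + real k > 0" for k using assms by (simp add: add_pos_nonneg)
  have le: "x + real k \<le> norm (z + of_nat k)" for k
    using complex_Re_le_cmod[of "z + of_nat k"] by (simp add: z_def)
  have npos: "norm (z + of_nat k) > 0" for k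
    using le[of k] pos[of k] by linarith
  have q: "0 \<le> q k" "q k \<le> 1" for k
    using pos[of k] le[of k] npos[of k] by (auto simp: q_def divide_le_eq)
  show "(\<lambda>m. norm (Gamma_series (Complex x t) m)) \<longlonglongrightarrow> norm (Gamma (Complex x t))"
    by (intro tendsto_intros)
  show "(\<lambda>m. Gamma_series x m * (\<Prod>k<n. (x + real k) / norm (Complex x t + of_nat k)))
      \<longlonglongrightarrow> Gamma x * (\<Prod>k<n. (x + real k) / norm (Complex x t + of_nat k))"
    by (intro tendsto_intros)
  show "\<exists>K. \<forall>m\<ge>K. norm (Gamma_series (Complex x t) m) \<le>
      Gamma_series x m * (\<Prod>k<n. (x + real k) / norm (Complex x t + of_nat k))"
  proof (intro exI allI impI)
    fix m :: nat assume m: "n \<le> m"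
    have "norm (pochhammer z (Suc m)) = (\<Prod>k<Suc m. norm (z + of_nat k))"
      unfolding pochhammer_prod atLeast0LessThan by (rule prod_norm[symmetric])
    moreover have "pochhammer x (Suc m) = (\<Prod>k<Suc m. x + real k)"
      unfolding pochhammer_prod atLeast0LessThan ..
    moreover have "norm (exp (z * of_real (ln (real m)))) = exp (x * ln (real m))"
      by (simp add: z_def)
    ultimately have A: "norm (Gamma_series z m) = Gamma_series x m * (\<Prod>k<Suc m. q k)"
      using pos npos
      by (simp add: Gamma_series_def norm_divide norm_mult q_def prod_dividef prod_pos
          less_imp_neq[THEN not_sym] del: prod.lessThan_Suc)
    have B: "(\<Prod>k<Suc m. q k) \<le> (\<Prod>k<n. q k)"
    proof -
      have "(\<Prod>k<Suc m. q k) = (\<Prod>k<n. q k) * (\<Prod>k=n..<Suc m. q k)"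
      proof -
        have eq: "{..<Suc m} = {..<n} \<union> {n..<Suc m}" using m by auto
        show ?thesis unfolding eq by (rule prod.union_disjoint) auto
      qed
      also have "\<dots> \<le> (\<Prod>k<n. q k) * 1"
      proof (rule mult_left_mono)
        show "(\<Prod>k=n..<Suc m. q k) \<le> 1" by (rule prod_le_1) (use q in blast)
        show "0 \<le> (\<Prod>k<n. q k)" by (rule prod_nonneg) (use q in blast)
      qed
      finally show ?thesis by simp
    qed
    have "0 \<le> Gamma_series x m"
      using assms unfolding Gamma_series_def by (intro divide_nonneg_nonneg mult_nonneg_nonneg pochhammer_nonneg) auto
    with B have "norm (Gamma_series z m) \<le> Gamma_series x m * (\<Prod>k<n. q k)"
      unfolding A by (rule mult_left_mono)
    then show "norm (Gamma_series (Complex x t) m) \<le>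
      Gamma_series x m * (\<Prod>k<n. (x + real k) / norm (Complex x t + of_nat k))"
      by (simp only: z_def q_def)
  qed
qed

text \<open>Two factors of the product already give decay of order \<open>1 / t\<^sup>2\<close>,
  hence integrability along a vertical line.\<close>

lemma norm_Gamma_le_quadratic:
  assumes "x > 0"
  shows "norm (Gamma (Complex x t)) \<le> Gamma x * (x * (x + 1) / (x\<^sup>2 + t\<^sup>2))"
proof -
  have p: "0 < x\<^sup>2 + t\<^sup>2" using assms by (simp add: add_pos_nonneg)
  have "norm (Gamma (Complex x t)) \<le> Gamma x * (\<Prod>k<2. (x + real k) / norm (Complex x t + of_nat k))"
    by (rule norm_Gamma_le) fact
  also have "(\<Prod>k<2. (x + real k) / norm (Complex x t + of_nat k)) =
      x * (x + 1) / (sqrt (x\<^sup>2 + t\<^sup>2) * sqrt ((x + 1)\<^sup>2 + t\<^sup>2))"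
    by (simp add: numeral_2_eq_2 cmod_def)
  also have "\<dots> \<le> x * (x + 1) / (sqrt (x\<^sup>2 + t\<^sup>2) * sqrt (x\<^sup>2 + t\<^sup>2))"
    using assms p by (intro divide_left_mono mult_left_mono mult_pos_pos)
      (auto simp: add_pos_nonneg intro!: power_mono)
  also have "sqrt (x\<^sup>2 + t\<^sup>2) * sqrt (x\<^sup>2 + t\<^sup>2) = x\<^sup>2 + t\<^sup>2" using p by simp
  finally show ?thesis using assms by (simp add: mult_left_mono Gamma_real_nonneg)
qed

lemma norm_Gamma_le_Gamma:
  assumes "x > 0"
  shows "norm (Gamma (Complex x t)) \<le> Gamma x"
  using norm_Gamma_le[OF assms, of t 0] by simp

text \<open>The majorant has to be free of both \<open>x\<close> and \<open>M\<close>. Among the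
  first \<open>n\<close> factors, \<open>n\<close> being \<open>x\<close> rounded up,
  \<open>x + k < 2 * x\<close>, so each is at most \<open>1 / sqrt (1 + y)\<close>. The
  \<open>M\<close>-th power then has exponent \<open>m = n * M\<close>, with
  \<open>m * y \<ge> \<tau>\<^sup>2 / 4\<close>, and a Bernoulli-type bound finishes.\<close>

lemma norm_Gamma_ratio_power_le:
  assumes x: "x > 0" and M: "x * real M \<ge> 2"
  shows "norm (Gamma (Complex x (\<tau> * sqrt (x / M)))) ^ M \<le> Gamma x ^ M * (1 / (1 + 1 / 8 * \<tau>\<^sup>2))"
proof -
  define t where "t = \<tau> * sqrt (x / M)"
  define n where "n = nat \<lceil>x\<rceil>"
  define y where "y = t\<^sup>2 / (4 * x\<^sup>2)"
  have M0: "real M > 0" using M x by (cases M) auto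
  have n: "real n \<ge> x" unfolding n_def by linarith
  have lt: "real k < x" if "k < n" for k using that unfolding n_def by linarith
  have y0: "y \<ge> 0" by (simp add: y_def)
  have fac: "(x + real k) / norm (Complex x t + of_nat k) \<le> 1 / sqrt (1 + y)" if "k < n" for k
  proof -
    have p: "x + real k > 0" using x by simp
    have "norm (Complex x t + of_nat k) = sqrt ((x + real k)\<^sup>2 + t\<^sup>2)"
      by (simp add: cmod_def)
    moreover have "(x + real k) * sqrt (1 + y) \<le> sqrt ((x + real k)\<^sup>2 + t\<^sup>2)"
    proof (rule real_le_rsqrt)
      have "(x + real k)\<^sup>2 * y \<le> (2 * x)\<^sup>2 * y"
        using lt[OF that] x y0 by (intro mult_right_mono power_mono) auto
      also have "\<dots> = t\<^sup>2" using x by (simp add: y_def power2_eq_square)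
      finally show "((x + real k) * sqrt (1 + y))\<^sup>2 \<le> (x + real k)\<^sup>2 + t\<^sup>2"
        using y0 unfolding power_mult_distrib by (simp add: ring_distribs)
    qed
    moreover have "sqrt (1 + y) > 0" "sqrt ((x + real k)\<^sup>2 + t\<^sup>2) > 0"
      using y0 p by (auto simp: add_pos_nonneg)
    ultimately show ?thesis by (simp add: divide_simps mult.commute)
  qed
  have "norm (Gamma (Complex x t)) \<le> Gamma x * (\<Prod>k<n. (x + real k) / norm (Complex x t + of_nat k))"
    by (rule norm_Gamma_le) fact
  also have "\<dots> \<le> Gamma x * (\<Prod>k<n. 1 / sqrt (1 + y))"
    using x fac by (intro mult_left_mono prod_mono) (auto simp: Gamma_real_nonneg)
  finally have "norm (Gamma (Complex x t)) ^ M \<le> (Gamma x * (1 / sqrt (1 + y)) ^ n) ^ M"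
    by (intro power_mono) auto
  also have "\<dots> = Gamma x ^ M * (1 / sqrt (1 + y) ^ (n * M))"
    by (simp add: power_mult_distrib power_one_over power_mult power_divide)
  also have "\<dots> \<le> Gamma x ^ M * (1 / (1 + 1 / 8 * \<tau>\<^sup>2))"
  proof -
    define m where "m = real (n * M)"
    have mM: "m \<ge> x * M" unfolding m_def using n M0 by simp
    then have m2: "m \<ge> 2" using M by linarith
    have "x * M * y \<le> m * y" using mM y0 by (intro mult_right_mono)
    also have "x * M * y = \<tau>\<^sup>2 / 4"
    proof -
      have "t\<^sup>2 = \<tau>\<^sup>2 * (x / M)"
        using x M0 by (simp add: t_def power_mult_distrib)
      then show ?thesis using x M0 by (simp add: y_def power2_eq_square)
    qed
    finally have my: "\<tau>\<^sup>2 / 4 \<le> m * y" .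
    \<comment> \<open>The target \<open>1 + m * y / 2 \<le> (1 + y) powr (m / 2)\<close> is proved
      in squared form, since \<open>m\<close> may be odd. The second-order Bernoulli inequality
      suffices because \<open>m\<^sup>2 / 4 \<le> m * (m - 1) / 2\<close> when
      \<open>m \<ge> 2\<close>.\<close>
    have "(1 + m * y / 2)\<^sup>2 \<le> 1 + m * y + m * (m - 1) / 2 * y\<^sup>2"
    proof -
      have "m * m / 4 \<le> m * (m - 1) / 2"
        using mult_left_mono[of 2 m m] m2 by (simp add: field_simps)
      then have "m * m / 4 * y\<^sup>2 \<le> m * (m - 1) / 2 * y\<^sup>2"
        by (intro mult_right_mono) auto
      then show ?thesis by (simp add: power2_eq_square field_simps)
    qed
    also have "\<dots> \<le> (1 + y) ^ (n * M)"
    proof -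
      have "1 + real k * y + real k * (real k - 1) / 2 * y\<^sup>2 \<le> (1 + y) ^ k" for k
      proof (induction k)
        case (Suc k)
        have "1 + real (Suc k) * y + real (Suc k) * (real (Suc k) - 1) / 2 * y\<^sup>2 \<le>
            (1 + y) * (1 + real k * y + real k * (real k - 1) / 2 * y\<^sup>2)"
        proof -
          have "real k * (real k - 1) \<ge> 0" by (cases k) auto
          then have "0 \<le> real k * (real k - 1) / 2 * y ^ 3" using y0 by simp
          moreover have "(1 + y) * (1 + real k * y + real k * (real k - 1) / 2 * y\<^sup>2) =
            1 + real (Suc k) * y + real (Suc k) * (real (Suc k) - 1) / 2 * y\<^sup>2 + real k * (real k - 1) / 2 * y ^ 3"
            by (simp add: field_simps power2_eq_square power3_eq_cube)
          ultimately show ?thesis by linarith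
        qed
        also have "\<dots> \<le> (1 + y) * (1 + y) ^ k"
          using Suc y0 by (intro mult_left_mono) auto
        finally show ?case by simp
      qed simp
      then show ?thesis by (simp only: m_def)
    qed
    finally have "(1 + m * y / 2)\<^sup>2 \<le> (sqrt (1 + y) ^ (n * M))\<^sup>2"
      using y0 by (simp add: power_mult_distrib flip: power_mult) (simp add: power_mult mult.commute[of _ 2])
    then have "1 + m * y / 2 \<le> sqrt (1 + y) ^ (n * M)"
      by (rule power2_le_imp_le) (use y0 in auto)
    then have "1 + 1 / 8 * \<tau>\<^sup>2 \<le> sqrt (1 + y) ^ (n * M)" using my by simp
    then have "1 / sqrt (1 + y) ^ (n * M) \<le> 1 / (1 + 1 / 8 * \<tau>\<^sup>2)"
      using y0 by (intro divide_left_mono mult_pos_pos) (auto simp: add_pos_nonneg)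
    then show ?thesis using x by (intro mult_left_mono) (auto simp: Gamma_real_nonneg)
  qed
  finally show ?thesis by (simp add: t_def)
qed

text \<open>Here \<open>L\<close> stands for \<open>ln |z|\<close>.\<close>

definition weight_integrand :: "nat \<Rightarrow> real \<Rightarrow> complex \<Rightarrow> complex" where
  "weight_integrand M L s = Gamma (- s) ^ M * exp (2 * s * of_real L)"

section \<open>Decay of the weight integrand and displacement of its contour\<close>

lemma weight_eq:
  assumes "z \<noteq> 0"
  shows "weight c M z = 1 / (2 * of_real pi) *
    (\<integral>t. weight_integrand M (ln (cmod z)) (Complex (- c) t) \<partial>lborel)"
  using assms by (simp add: weight_def weight_integrand_def Let_def powr_def Ln_of_real)

lemma weight_integrand_holomorphic: "weight_integrand M L holomorphic_on {s. Re s < 0}"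
  unfolding weight_integrand_def
  by (intro holomorphic_intros) (auto elim!: nonpos_Ints_cases' simp: complex_eq_iff)

text \<open>One of the \<open>M\<close> Gamma factors provides the decay in \<open>t\<close>; the
  other \<open>M - 1\<close> are bounded by their value on the real axis.\<close>

lemma norm_weight_integrand_le:
  assumes x: "x > 0" and M: "M > 0"
  shows "norm (weight_integrand M L (Complex (- x) t)) \<le>
    Gamma x ^ M * (x * (x + 1)) * exp (- (2 * x * L)) / (x\<^sup>2 + t\<^sup>2)"
proof -
  obtain m where m: "M = Suc m" using M by (cases M) auto
  have e: "- Complex (- x) t = Complex x (- t)" by (simp add: complex_eq_iff)
  have "norm (weight_integrand M L (Complex (- x) t)) =
      norm (Gamma (Complex x (- t))) ^ m * norm (Gamma (Complex x (- t))) * exp (- (2 * x * L))"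
    by (simp add: weight_integrand_def norm_mult norm_power e m mult.commute)
  also have "\<dots> \<le> Gamma x ^ m * (Gamma x * (x * (x + 1) / (x\<^sup>2 + t\<^sup>2))) * exp (- (2 * x * L))"
    using norm_Gamma_le_quadratic[OF x, of "- t"] norm_Gamma_le_Gamma[OF x, of "- t"] x
    by (intro mult_right_mono mult_mono power_mono) (auto simp: Gamma_real_nonneg)
  finally show ?thesis by (simp add: m field_simps)
qed

lemma continuous_weight_integrand:
  assumes x: "x > 0"
  shows "continuous_on A (\<lambda>t. weight_integrand M L (Complex (- x) t))"
proof -
  have "continuous_on UNIV (\<lambda>t. weight_integrand M L (Complex (- x) t))"
    using x by (intro continuous_on_compose2[OF holomorphic_on_imp_continuous_on[OF weight_integrand_holomorphic]]
        continuous_intros) auto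
  then show ?thesis by (rule continuous_on_subset) simp
qed

lemma integrable_weight_integrand:
  assumes x: "x > 0" and M: "M > 0"
  shows "integrable lborel (\<lambda>t. weight_integrand M L (Complex (- x) t))"
proof (rule Bochner_Integration.integrable_bound)
  show "integrable lborel (\<lambda>t. Gamma x ^ M * (x * (x + 1)) * exp (- (2 * x * L)) / x\<^sup>2 * (1 / (1 + 1 / x\<^sup>2 * t\<^sup>2)))"
    using x by (intro integrable_mult_right integrable_inverse_1_plus_square_scaled) auto
  show "(\<lambda>t. weight_integrand M L (Complex (- x) t)) \<in> borel_measurable lborel"
    using continuous_weight_integrand[OF x, of UNIV M L] by (simp add: borel_measurable_continuous_onI)
  show "AE t in lborel. norm (weight_integrand M L (Complex (- x) t)) \<le>
      norm (Gamma x ^ M * (x * (x + 1)) * exp (- (2 * x * L)) / x\<^sup>2 * (1 / (1 + 1 / x\<^sup>2 * t\<^sup>2)))"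
  proof (rule AE_I2)
    fix t
    have "Gamma x ^ M * (x * (x + 1)) * exp (- (2 * x * L)) / (x\<^sup>2 + t\<^sup>2) =
      Gamma x ^ M * (x * (x + 1)) * exp (- (2 * x * L)) / x\<^sup>2 * (1 / (1 + 1 / x\<^sup>2 * t\<^sup>2))"
    proof -
      have "x\<^sup>2 + t\<^sup>2 = x\<^sup>2 * (1 + 1 / x\<^sup>2 * t\<^sup>2)"
        using x by (simp add: distrib_left)
      then show ?thesis by simp
    qed
    with norm_weight_integrand_le[OF x M, of L t]
    have "norm (weight_integrand M L (Complex (- x) t)) \<le>
      Gamma x ^ M * (x * (x + 1)) * exp (- (2 * x * L)) / x\<^sup>2 * (1 / (1 + 1 / x\<^sup>2 * t\<^sup>2))"
      by (simp only:)
    then show "norm (weight_integrand M L (Complex (- x) t)) \<le>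
      norm (Gamma x ^ M * (x * (x + 1)) * exp (- (2 * x * L)) / x\<^sup>2 * (1 / (1 + 1 / x\<^sup>2 * t\<^sup>2)))"
      by (rule order_trans) (simp only: real_norm_def abs_ge_self)
  qed
qed

lemma weight_integrand_symmetric_limit:
  assumes x: "x > 0" and M: "M > 0"
  shows "(\<lambda>n. \<integral>t. indicator {- real n..real n} t *\<^sub>R weight_integrand M L (Complex (- x) t) \<partial>lborel)
    \<longlonglongrightarrow> (\<integral>t. weight_integrand M L (Complex (- x) t) \<partial>lborel)"
proof (rule integral_dominated_convergence[OF _ _ integrable_norm[OF integrable_weight_integrand[OF assms]]])
  note [measurable] = borel_measurable_integrable[OF integrable_weight_integrand[OF assms]]
  show "(\<lambda>t. weight_integrand M L (Complex (- x) t)) \<in> borel_measurable lborel" by measurable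
  show "(\<lambda>t. indicator {- real n..real n} t *\<^sub>R weight_integrand M L (Complex (- x) t)) \<in> borel_measurable lborel" for n
    by measurable
  show "AE t in lborel. (\<lambda>n. indicator {- real n..real n} t *\<^sub>R weight_integrand M L (Complex (- x) t))
      \<longlonglongrightarrow> weight_integrand M L (Complex (- x) t)"
  proof (rule AE_I2)
    fix t :: real
    have "eventually (\<lambda>n. real n > \<bar>t\<bar>) sequentially"
      using filterlim_real_sequentially by (simp add: filterlim_at_top_dense)
    then show "(\<lambda>n. indicator {- real n..real n} t *\<^sub>R weight_integrand M L (Complex (- x) t))
      \<longlonglongrightarrow> weight_integrand M L (Complex (- x) t)"
      by (intro tendsto_eventually, eventually_elim) (auto simp: indicator_def)
  qed
qed (auto simp: indicator_def)

text \<open>Cauchy's theorem in the form of a primitive \<open>F\<close> on the half-plane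
  \<open>Re s < 0\<close>: truncated vertical integrals are differences of values of
  \<open>F\<close>. Two vertical lines thus differ only by the increments of \<open>F\<close> along
  the horizontal edges at heights \<open>n\<close> and \<open>-n\<close>, which are of order
  \<open>1 / n\<^sup>2\<close>.\<close>

lemma integral_weight_integrand_shift:
  assumes x: "0 < x" "x \<le> x'" and M: "M > 0"
  shows "(\<integral>t. weight_integrand M L (Complex (- x) t) \<partial>lborel) =
    (\<integral>t. weight_integrand M L (Complex (- x') t) \<partial>lborel)"
proof -
  define f where "f = weight_integrand M L"
  have op: "open {s. Re s < 0}" "convex {s. Re s < 0}"
    by (auto simp: open_halfspace_Re_lt convex_halfspace_Re_lt)
  obtain F where F: "\<And>s. s \<in> {s. Re s < 0} \<Longrightarrow> (F has_field_derivative f s) (at s within {s. Re s < 0})"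
    using holomorphic_convex_primitive'[OF op(2,1) weight_integrand_holomorphic] unfolding f_def by metis
  then have F: "(F has_field_derivative f s) (at s)" if "Re s < 0" for s
    using that op(1) at_within_open[of s "{s. Re s < 0}"] by (metis mem_Collect_eq)
  have ftc: "(\<integral>t. indicator {- real n..real n} t *\<^sub>R f (Complex (- y) t) \<partial>lborel) =
      - \<i> * F (Complex (- y) (real n)) - - \<i> * F (Complex (- y) (- real n))" if y: "y > 0" for y n
  proof (rule integral_FTC_Icc)
    show "continuous_on {- real n..real n} (\<lambda>t. f (Complex (- y) t))"
      unfolding f_def by (rule continuous_weight_integrand[OF y])
    fix t
    have "((\<lambda>z. F (of_real (- y) + \<i> * z)) has_field_derivative f (of_real (- y) + \<i> * of_real t) * \<i>) (at (of_real t))"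
      by (rule DERIV_chain2[OF F]) (use y in \<open>auto intro!: derivative_eq_intros\<close>)
    from has_vector_derivative_real_field[OF DERIV_cmult[OF this, of "- \<i>"]]
    have "((\<lambda>t. - \<i> * F (Complex (- y) t)) has_vector_derivative
        - \<i> * (f (Complex (- y) t) * \<i>)) (at t)"
      by (simp only: Complex_eq)
    then have "((\<lambda>t. - \<i> * F (Complex (- y) t)) has_vector_derivative f (Complex (- y) t)) (at t)"
      by (simp add: mult.left_commute[of \<i>])
    then show "((\<lambda>t. - \<i> * F (Complex (- y) t)) has_vector_derivative f (Complex (- y) t)) (at t within {- real n..real n})"
      by (rule has_vector_derivative_at_within)
  qed simp
  \<comment> \<open>The part of the bound on the integrand that does not involve \<open>t\<close>;
    by compactness it is bounded for abscissae between \<open>x\<close> and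
    \<open>x'\<close>.\<close>
  define g where "g = (\<lambda>y. Gamma y ^ M * (y * (y + 1)) * exp (- (2 * y * L)))"
  have "continuous_on {x..x'} g"
    unfolding g_def using x(1) by (intro continuous_intros continuous_on_Gamma) (auto elim!: nonpos_Ints_cases)
  then have "bounded (g ` {x..x'})"
    by (intro compact_imp_bounded compact_continuous_image) auto
  then obtain D where "\<forall>y\<in>g ` {x..x'}. norm y \<le> D"
    unfolding bounded_iff by blast
  then have D: "\<bar>g y\<bar> \<le> D" if "y \<in> {x..x'}" for y using that by auto
  have D0: "D \<ge> 0" using D[of x] x by force
  \<comment> \<open>Taking \<open>T n\<close> to be \<open>n\<close> or \<open>- n\<close> covers
    the upper and the lower edge at once.\<close>
  have hor: "(\<lambda>n. F (Complex (- x') (T n)) - F (Complex (- x) (T n))) \<longlonglongrightarrow> 0"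
    if T: "\<And>n. \<bar>T n\<bar> = real n" for T :: "nat \<Rightarrow> real"
  proof (rule Lim_null_comparison)
    show "eventually (\<lambda>n. norm (F (Complex (- x') (T n)) - F (Complex (- x) (T n))) \<le> D / (real n)\<^sup>2 * (x' - x)) sequentially"
      using eventually_gt_at_top[of 0]
    proof eventually_elim
      case (elim n)
      have "norm (F (Complex (- x') (T n)) - F (Complex (- x) (T n))) \<le>
          D / (real n)\<^sup>2 * norm (Complex (- x') (T n) - Complex (- x) (T n))"
      proof (rule field_differentiable_bound[where S = "closed_segment (Complex (- x) (T n)) (Complex (- x') (T n))"])
        fix s assume "s \<in> closed_segment (Complex (- x) (T n)) (Complex (- x') (T n))"
        then obtain r where r: "0 \<le> r" "r \<le> 1" "s = (1 - r) *\<^sub>R Complex (- x) (T n) + r *\<^sub>R Complex (- x') (T n)"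
          by (auto simp: closed_segment_def)
        define y where "y = (1 - r) * x + r * x'"
        have s: "s = Complex (- y) (T n)" unfolding r(3) y_def by (simp add: complex_eq_iff algebra_simps)
        have y: "y \<in> {x..x'}"
        proof -
          have "0 \<le> r * (x' - x)" "r * (x' - x) \<le> 1 * (x' - x)"
            using r x by (intro mult_nonneg_nonneg mult_right_mono; simp)+
          then show ?thesis by (simp add: y_def algebra_simps)
        qed
        show "(F has_field_derivative f s) (at s within closed_segment (Complex (- x) (T n)) (Complex (- x') (T n)))"
          using y x by (intro has_field_derivative_at_within[OF F]) (auto simp: s)
        have "norm (f s) \<le> g y / (y\<^sup>2 + (T n)\<^sup>2)"
          using norm_weight_integrand_le[of y M L "T n"] y x M by (simp add: s f_def g_def)
        also have "\<dots> \<le> D / (T n)\<^sup>2"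
        proof (rule frac_le)
          show "g y \<le> D" using D[OF y] by simp
          show "(T n)\<^sup>2 > 0" using T[of n] elim by auto
        qed (use D0 in auto)
        also have "(T n)\<^sup>2 = (real n)\<^sup>2" using T[of n] by (metis power2_abs)
        finally show "norm (f s) \<le> D / (real n)\<^sup>2" .
      qed auto
      also have "Complex (- x') (T n) - Complex (- x) (T n) = of_real (- (x' - x))"
        by (simp add: complex_eq_iff)
      finally show ?case using x by (simp only: norm_of_real) simp
    qed
    show "(\<lambda>n. D / (real n)\<^sup>2 * (x' - x)) \<longlonglongrightarrow> 0" by real_asymp
  qed
  have "(\<lambda>n. - \<i> * (F (Complex (- x') (real n)) - F (Complex (- x) (real n)))
      + \<i> * (F (Complex (- x') (- real n)) - F (Complex (- x) (- real n)))) \<longlonglongrightarrow> - \<i> * 0 + \<i> * 0"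
    by (intro tendsto_intros hor) auto
  then have "(\<lambda>n. (\<integral>t. indicator {- real n..real n} t *\<^sub>R f (Complex (- x') t) \<partial>lborel)
      - (\<integral>t. indicator {- real n..real n} t *\<^sub>R f (Complex (- x) t) \<partial>lborel)) \<longlonglongrightarrow> 0"
    using x by (simp add: ftc algebra_simps)
  moreover have "(\<lambda>n. (\<integral>t. indicator {- real n..real n} t *\<^sub>R f (Complex (- x') t) \<partial>lborel)
      - (\<integral>t. indicator {- real n..real n} t *\<^sub>R f (Complex (- x) t) \<partial>lborel))
      \<longlonglongrightarrow> (\<integral>t. f (Complex (- x') t) \<partial>lborel) - (\<integral>t. f (Complex (- x) t) \<partial>lborel)"
    unfolding f_def using x M by (intro tendsto_diff weight_integrand_symmetric_limit) auto
  ultimately have "0 = (\<integral>t. f (Complex (- x') t) \<partial>lborel) - (\<integral>t. f (Complex (- x) t) \<partial>lborel)"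
    by (rule LIMSEQ_unique)
  then show ?thesis by (simp add: f_def)
qed

lemma weight_contour_independent:
  assumes "c > 0" "c' > 0" "M > 0" "z \<noteq> 0"
  shows "weight c M z = weight c' M z"
proof (cases "c \<le> c'")
  case True
  then show ?thesis
    using assms by (simp add: weight_eq integral_weight_integrand_shift[OF assms(1) True assms(3)])
next
  case False
  then have "c' \<le> c" by simp
  then show ?thesis
    using assms by (simp add: weight_eq integral_weight_integrand_shift[OF assms(2) _ assms(3)])
qed

text \<open>The abscissa \<open>- A\<close> is the one for which the linear terms cancel:
  \<open>Gamma (A + r) ^ M\<close> contributes \<open>M * r * ln A\<close>, and the power of
  \<open>|z|\<close> contributes \<open>- 2 * r * ln |z|\<close>, whose main part is the opposite.
  The deviation \<open>lam\<close> of \<open>ln |z| / M\<close> from \<open>ln A / 2\<close>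
  survives as the frequency \<open>2 * \<mu>\<close> of a Gaussian Fourier integral. The denominator
  is the size of the integrand at the real point \<open>- A\<close> times the width
  \<open>sqrt (A / M)\<close> divided by \<open>sqrt (2 * pi)\<close>.\<close>

lemma weight_asymptotics:
  fixes M :: "nat \<Rightarrow> nat" and A lam :: "nat \<Rightarrow> real" and z :: "nat \<Rightarrow> complex"
  assumes c: "c > 0" and M: "\<And>k. M k > 0" and A: "\<And>k. A k > 0" "filterlim A at_top sequentially"
    and MA: "(\<lambda>k. M k / A k) \<longlonglongrightarrow> 0"
    and z: "eventually (\<lambda>k. z k \<noteq> 0 \<and> ln (cmod (z k)) = M k / 2 * ln (A k) + M k * lam k) sequentially"
    and lam: "(\<lambda>k. sqrt (A k * M k) * lam k) \<longlonglongrightarrow> \<mu>"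
  shows "(\<lambda>k. weight c (M k) (z k) / of_real (Gamma (A k) ^ M k *
      exp (- (M k * A k * (ln (A k) + 2 * lam k))) * sqrt (A k / (2 * pi * M k))))
    \<longlonglongrightarrow> of_real (exp (- (2 * \<mu>\<^sup>2)))"
proof -
  \<comment> \<open>The width of the Gaussian: \<open>M * s\<^sup>2 / (2 * A)\<close> is of order
    one when \<open>|s|\<close> is of order \<open>e\<close>.\<close>
  define e where "e = (\<lambda>k. sqrt (A k / M k))"
  define L where "L = (\<lambda>k. M k / 2 * ln (A k) + M k * lam k)"
  define g where "g = (\<lambda>k. Gamma (A k) ^ M k * exp (- (2 * A k * L k)))"
  define s where "s = (\<lambda>k t. weight_integrand (M k) (L k) (Complex (- A k) (t * e k)) / of_real (g k))"
  define f where "f = (\<lambda>t::real. exp (- (of_real t)\<^sup>2 / 2 + 2 * \<i> * of_real \<mu> * of_real t :: complex))"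
  have M': "real (M k) > 0" for k using M[of k] by simp
  have e0: "e k > 0" for k using A(1)[of k] M'[of k] by (simp add: e_def)
  have g0: "g k > 0" for k using A(1)[of k] by (simp add: g_def Gamma_real_pos)
  have eM: "e k * M k = sqrt (A k * M k)" "e k * sqrt (M k / A k) = 1" for k
  proof -
    have "e k * M k = sqrt (A k) / sqrt (M k) * (sqrt (M k) * sqrt (M k))"
      by (simp add: e_def real_sqrt_divide)
    then show "e k * M k = sqrt (A k * M k)"
      using M'[of k] by (simp add: real_sqrt_mult del: real_sqrt_mult_self)
    show "e k * sqrt (M k / A k) = 1"
      using A(1)[of k] M'[of k] by (simp add: e_def real_sqrt_divide)
  qed
  have s_eq: "s k t = exp (of_nat (M k) * ln_Gamma_shift (A k) (- \<i> * of_real (t * e k))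
      + 2 * \<i> * of_real t * of_real (sqrt (A k * M k) * lam k))" for k t
  proof -
    define r where "r = - \<i> * of_real (t * e k)"
    have "exp (ln_Gamma_shift (A k) r) = Gamma (of_real (A k) + r) / (Gamma (of_real (A k)) * of_real (A k) powr r)"
      using A(1)[of k] by (intro exp_ln_Gamma_shift) (auto simp: r_def)
    moreover have "of_real (A k) powr r = exp (r * of_real (ln (A k)))"
      using A(1)[of k] by (simp add: powr_def Ln_of_real)
    moreover have "Gamma (complex_of_real (A k)) = of_real (Gamma (A k))"
      by (simp add: Gamma_complex_of_real)
    moreover have "Gamma (A k) > 0" using A(1)[of k] by (simp add: Gamma_real_pos)
    ultimately have G: "Gamma (of_real (A k) + r) =
        exp (ln_Gamma_shift (A k) r + r * of_real (ln (A k))) * of_real (Gamma (A k))"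
      by (simp add: exp_add)
    have c: "Complex (- A k) (t * e k) = - (of_real (A k) + r)"
      by (simp add: r_def complex_eq_iff)
    have "weight_integrand (M k) (L k) (Complex (- A k) (t * e k)) =
        exp (of_nat (M k) * (ln_Gamma_shift (A k) r + r * of_real (ln (A k)))) * of_real (Gamma (A k)) ^ M k *
        exp (2 * (- (of_real (A k) + r)) * of_real (L k))"
      unfolding weight_integrand_def c minus_minus G by (simp only: power_mult_distrib exp_of_nat_mult)
    also have "2 * (- (of_real (A k) + r)) * of_real (L k) = of_real (- (2 * A k * L k)) + - 2 * r * of_real (L k)"
      by (simp add: algebra_simps)
    also have "exp (of_nat (M k) * (ln_Gamma_shift (A k) r + r * of_real (ln (A k)))) * of_real (Gamma (A k)) ^ M k *
        exp (of_real (- (2 * A k * L k)) + - 2 * r * of_real (L k)) =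
        of_real (g k) * exp (of_nat (M k) * (ln_Gamma_shift (A k) r + r * of_real (ln (A k))) + - 2 * r * of_real (L k))"
      by (simp only: exp_add exp_of_real g_def of_real_mult of_real_power mult_ac)
    also have "of_nat (M k) * (ln_Gamma_shift (A k) r + r * of_real (ln (A k))) + - 2 * r * of_real (L k) =
        of_nat (M k) * ln_Gamma_shift (A k) r - 2 * of_nat (M k) * r * of_real (lam k)"
      by (simp add: L_def algebra_simps)
    also have "\<dots> = of_nat (M k) * ln_Gamma_shift (A k) r + 2 * \<i> * of_real t * of_real (sqrt (A k * M k) * lam k)"
      unfolding eM(1)[symmetric] by (simp add: r_def)
    finally show ?thesis using g0[of k] by (simp add: s_def r_def)
  qed
  have "(\<lambda>k. \<integral>t. s k t \<partial>lborel) \<longlonglongrightarrow> (\<integral>t. f t \<partial>lborel)"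
  proof (rule integral_dominated_convergence_eventually)
    show "f \<in> borel_measurable lborel" unfolding f_def by measurable
    show "s k \<in> borel_measurable lborel" for k
    proof -
      have [measurable]: "(\<lambda>t. weight_integrand (M k) (L k) (Complex (- A k) t)) \<in> borel_measurable borel"
        using continuous_weight_integrand[OF A(1), of UNIV] by (intro borel_measurable_continuous_onI)
      show ?thesis unfolding s_def by measurable
    qed
    show "integrable lborel (\<lambda>t::real. 1 / (1 + 1 / 8 * t\<^sup>2))"
      by (rule integrable_inverse_1_plus_square_scaled) simp
    show "AE t in lborel. (\<lambda>k. s k t) \<longlonglongrightarrow> f t"
    proof (rule AE_I2)
      fix t :: real
      have "(\<lambda>k. of_nat (M k) * ln_Gamma_shift (A k) (- \<i> * of_real (t * e k))) \<longlonglongrightarrow> (- \<i> * of_real t)\<^sup>2 / 2"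
      proof (rule ln_Gamma_shift_tendsto[OF M A(2) MA])
        have "(- \<i> * of_real (t * e k)) * of_real (sqrt (M k / A k)) = - \<i> * of_real t" for k
        proof -
          have "(- \<i> * of_real (t * e k)) * of_real (sqrt (M k / A k)) = - \<i> * of_real (t * (e k * sqrt (M k / A k)))"
            by (simp only: of_real_mult mult.assoc)
          then show ?thesis by (simp only: eM mult_1_right)
        qed
        then show "(\<lambda>k. (- \<i> * of_real (t * e k)) * of_real (sqrt (M k / A k))) \<longlonglongrightarrow> - \<i> * of_real t"
          by (simp only:) (rule tendsto_const)
      qed
      then have "(\<lambda>k. s k t) \<longlonglongrightarrow> exp ((- \<i> * of_real t)\<^sup>2 / 2 + 2 * \<i> * of_real t * of_real \<mu>)"
        unfolding s_eq by (intro tendsto_exp tendsto_add tendsto_mult tendsto_of_real lam tendsto_const)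
      then show "(\<lambda>k. s k t) \<longlonglongrightarrow> f t"
        by (simp add: f_def power_mult_distrib mult_ac)
    qed
    show "eventually (\<lambda>k. \<forall>t. norm (s k t) \<le> 1 / (1 + 1 / 8 * t\<^sup>2)) sequentially"
      using A(2)[unfolded filterlim_at_top, rule_format, of 2]
    proof eventually_elim
      case (elim k)
      show ?case
      proof
        fix t :: real
        have "2 * 1 \<le> A k * M k" using elim M[of k] by (intro mult_mono) auto
        then have "norm (Gamma (Complex (A k) (- t * sqrt (A k / M k)))) ^ M k \<le>
            Gamma (A k) ^ M k * (1 / (1 + 1 / 8 * (- t)\<^sup>2))"
          by (intro norm_Gamma_ratio_power_le A) simp
        moreover have "norm (s k t) = norm (Gamma (Complex (A k) (- t * sqrt (A k / M k)))) ^ M k / Gamma (A k) ^ M k"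
        proof -
          have "- Complex (- A k) (t * e k) = Complex (A k) (- t * sqrt (A k / M k))"
            by (simp add: complex_eq_iff e_def)
          then have "norm (s k t) = norm (Gamma (Complex (A k) (- t * sqrt (A k / M k)))) ^ M k *
              exp (- (2 * A k * L k)) / g k"
            using g0[of k] unfolding s_def weight_integrand_def by (simp add: norm_mult norm_divide norm_power)
          then show ?thesis by (simp add: g_def)
        qed
        moreover have "Gamma (A k) ^ M k > 0" using A(1)[of k] by (simp add: Gamma_real_pos)
        ultimately show "norm (s k t) \<le> 1 / (1 + 1 / 8 * t\<^sup>2)"
          by (simp add: divide_le_eq mult.commute)
      qed
    qed
  qed
  also have "(\<integral>t. f t \<partial>lborel) = of_real (sqrt (2 * pi)) * exp ((2 * \<i> * of_real \<mu>)\<^sup>2 / 2)"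
    unfolding f_def by (rule integral_gaussian_linear)
  also have "(2 * \<i> * of_real \<mu>)\<^sup>2 / 2 = complex_of_real (- (2 * \<mu>\<^sup>2))"
    by (simp add: power_mult_distrib)
  finally have lim: "(\<lambda>k. (\<integral>t. s k t \<partial>lborel) / of_real (sqrt (2 * pi))) \<longlonglongrightarrow> of_real (exp (- (2 * \<mu>\<^sup>2)))"
    by (rule tendsto_divide[THEN tendsto_eq_rhs, OF _ tendsto_const]) (simp_all flip: exp_of_real)
  have "eventually (\<lambda>k. (\<integral>t. s k t \<partial>lborel) / of_real (sqrt (2 * pi)) =
      weight c (M k) (z k) / of_real (Gamma (A k) ^ M k *
      exp (- (M k * A k * (ln (A k) + 2 * lam k))) * sqrt (A k / (2 * pi * M k)))) sequentially"
    using z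
  proof eventually_elim
    case (elim k)
    have "weight c (M k) (z k) = weight (A k) (M k) (z k)"
      using elim by (intro weight_contour_independent c A M) auto
    also have "\<dots> = 1 / (2 * of_real pi) * (\<integral>t. weight_integrand (M k) (L k) (Complex (- A k) t) \<partial>lborel)"
      using elim by (simp add: weight_eq L_def)
    also have "(\<integral>t. weight_integrand (M k) (L k) (Complex (- A k) t) \<partial>lborel)
        = of_real (e k) * (\<integral>t. weight_integrand (M k) (L k) (Complex (- A k) (t * e k)) \<partial>lborel)"
      using e0[of k] by (subst lborel_integral_real_affine[of "e k" _ 0]) (auto simp: scaleR_conv_of_real mult.commute)
    also have "(\<integral>t. weight_integrand (M k) (L k) (Complex (- A k) (t * e k)) \<partial>lborel) = of_real (g k) * (\<integral>t. s k t \<partial>lborel)"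
      using g0[of k] by (simp add: s_def)
    finally have w: "weight c (M k) (z k) = 1 / (2 * of_real pi) * (of_real (e k) * (of_real (g k) * (\<integral>t. s k t \<partial>lborel)))" .
    have "Gamma (A k) ^ M k * exp (- (M k * A k * (ln (A k) + 2 * lam k))) * sqrt (A k / (2 * pi * M k)) =
        g k * (e k / sqrt (2 * pi))"
    proof -
      have "2 * A k * L k = M k * A k * (ln (A k) + 2 * lam k)" by (simp add: L_def algebra_simps)
      then show ?thesis
        unfolding g_def e_def by (simp only:) (simp add: real_sqrt_divide real_sqrt_mult mult_ac)
    qed
    then have "weight c (M k) (z k) / of_real (Gamma (A k) ^ M k *
      exp (- (M k * A k * (ln (A k) + 2 * lam k))) * sqrt (A k / (2 * pi * M k))) =
      1 / (2 * of_real pi) * (of_real (e k) * (of_real (g k) * (\<integral>t. s k t \<partial>lborel))) / of_real (g k * (e k / sqrt (2 * pi)))"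
      by (simp only: w)
    also have "\<dots> = (\<integral>t. s k t \<partial>lborel) * (of_real (sqrt (2 * pi)) / (2 * of_real pi))"
      using g0[of k] e0[of k] by simp
    also have "of_real (sqrt (2 * pi)) / (2 * complex_of_real pi) = 1 / of_real (sqrt (2 * pi))"
    proof -
      have "sqrt (2 * pi) / (2 * pi) = 1 / sqrt (2 * pi)"
        using real_div_sqrt[of "2 * pi"] by (simp add: field_simps)
      then have "complex_of_real (sqrt (2 * pi) / (2 * pi)) = of_real (1 / sqrt (2 * pi))" by (simp only:)
      then show ?thesis by simp
    qed
    finally show ?case by simp
  qed
  with lim show ?thesis by (rule Lim_transform_eventually)
qed

section \<open>Asymptotics of the truncated power series\<close>

text \<open>A bound on the whole real range, obtained from convexity: in the second-order Taylor
  formula the second derivative \<open>Polygamma 1 t\<close> is at least \<open>1 / t\<close>, hence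
  at least \<open>1 / (c + \<bar>s\<bar>)\<close>. For \<open>s\<close> large compared with
  \<open>c\<close> the growth is only linear in \<open>s\<close>, which is still enough for
  domination.\<close>

lemma Re_ln_Gamma_shift_ge:
  assumes c: "c > 0" and s: "c + s > 0"
  shows "s\<^sup>2 / (2 * (c + \<bar>s\<bar>)) - \<bar>s\<bar> / c \<le> Re (ln_Gamma_shift c (of_real s))"
proof (cases "s = 0")
  case False
  define f where "f = (\<lambda>i::nat. if i = 0 then ln_Gamma else Polygamma (i - 1) :: real \<Rightarrow> real)"
  have "\<exists>t. (if c + s < c then c + s < t \<and> t < c else c < t \<and> t < c + s) \<and>
      ln_Gamma (c + s) = (\<Sum>m<(2::nat). f m c / fact m * (c + s - c) ^ m) + f 2 t / fact 2 * (c + s - c) ^ 2"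
  proof (rule Taylor[where a = "min c (c + s)" and b = "max c (c + s)"])
    show "\<forall>(m::nat) t. m < 2 \<and> min c (c + s) \<le> t \<and> t \<le> max c (c + s) \<longrightarrow> (f m has_real_derivative f (Suc m) t) (at t)"
    proof (intro allI impI)
      fix m :: nat and t :: real
      assume *: "m < 2 \<and> min c (c + s) \<le> t \<and> t \<le> max c (c + s)"
      then have t: "t > 0" using c s by auto
      then have t': "t \<notin> \<int>\<^sub>\<le>\<^sub>0" by (auto elim!: nonpos_Ints_cases)
      show "(f m has_real_derivative f (Suc m) t) (at t)"
      proof (cases m)
        case 0
        then show ?thesis using t by (simp add: f_def has_field_derivative_ln_Gamma_real)
      next
        case (Suc j)
        then show ?thesis using t' by (simp add: f_def has_field_derivative_Polygamma)
      qed
    qed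
  qed (use False in \<open>auto simp: f_def\<close>)
  then obtain t where t: "if s < 0 then c + s < t \<and> t < c else c < t \<and> t < c + s"
    and eq: "ln_Gamma (c + s) = ln_Gamma c + Digamma c * s + Polygamma 1 t / 2 * s\<^sup>2"
    by (auto simp: f_def numeral_2_eq_2)
  have t0: "0 < t" "t \<le> c + \<bar>s\<bar>" using t c s by (auto split: if_splits)
  have "1 / (2 * (c + \<bar>s\<bar>)) * s\<^sup>2 \<le> Polygamma 1 t / 2 * s\<^sup>2"
  proof (rule mult_right_mono)
    have "1 / (c + \<bar>s\<bar>) \<le> 1 / t" using t0 by (intro divide_left_mono) auto
    also have "\<dots> \<le> Polygamma 1 t" using t0 by (intro Polygamma_1_ge)
    finally have "1 / (c + \<bar>s\<bar>) / 2 \<le> Polygamma 1 t / 2" by (rule divide_right_mono) simp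
    also have "1 / (c + \<bar>s\<bar>) / 2 = 1 / (2 * (c + \<bar>s\<bar>))"
      by (simp only: divide_divide_eq_left mult.commute)
    finally show "1 / (2 * (c + \<bar>s\<bar>)) \<le> Polygamma 1 t / 2" .
  qed simp
  moreover have "\<bar>(Digamma c - ln c) * s\<bar> \<le> 1 / c * \<bar>s\<bar>"
    unfolding abs_mult using Digamma_approx_ln[OF c] c by (intro mult_right_mono) auto
  moreover have "ln_Gamma_shift c (of_real s) = of_real (ln_Gamma (c + s) - ln_Gamma c - s * ln c)"
    using c s ln_Gamma_complex_of_real[of "c + s"] by (simp add: ln_Gamma_shift_def ln_Gamma_complex_of_real)
  then have R: "Re (ln_Gamma_shift c (of_real s)) = Polygamma 1 t / 2 * s\<^sup>2 + (Digamma c - ln c) * s"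
    by (simp only: Re_complex_of_real) (simp add: eq algebra_simps)
  moreover have "s\<^sup>2 / (2 * (c + \<bar>s\<bar>)) = 1 / (2 * (c + \<bar>s\<bar>)) * s\<^sup>2" "\<bar>s\<bar> / c = 1 / c * \<bar>s\<bar>"
    by simp_all
  ultimately show ?thesis by linarith
qed (simp add: ln_Gamma_shift_def)

text \<open>Writing the finite sum as an integral lets the convergence of Riemann sums be treated by
  dominated convergence.\<close>

lemma has_bochner_integral_step_function:
  fixes f :: "nat \<Rightarrow> 'a :: {banach, second_countable_topology}"
  shows "has_bochner_integral lborel (\<lambda>x::real. indicator {0..<real n} x *\<^sub>R f (nat \<lfloor>x\<rfloor>)) (\<Sum>j<n. f j)"
proof (induction n)
  case (Suc n)
  have "has_bochner_integral lborel (\<lambda>x::real. indicator {real n..<real (Suc n)} x *\<^sub>R f n) (measure lborel {real n..<real (Suc n)} *\<^sub>R f n)"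
    by (intro has_bochner_integral_scaleR_left has_bochner_integral_real_indicator) auto
  from has_bochner_integral_add[OF Suc this]
  have "has_bochner_integral lborel (\<lambda>x::real. indicator {0..<real n} x *\<^sub>R f (nat \<lfloor>x\<rfloor>) + indicator {real n..<real (Suc n)} x *\<^sub>R f n) (\<Sum>j<Suc n. f j)"
    by simp
  also have "(\<lambda>x::real. indicator {0..<real n} x *\<^sub>R f (nat \<lfloor>x\<rfloor>) + indicator {real n..<real (Suc n)} x *\<^sub>R f n)
      = (\<lambda>x. indicator {0..<real (Suc n)} x *\<^sub>R f (nat \<lfloor>x\<rfloor>))"
  proof
    fix x :: real
    have "nat \<lfloor>x\<rfloor> = n" if "real n \<le> x" "x < real (Suc n)"
    proof -
      have "\<lfloor>x\<rfloor> = int n" using that by (intro floor_unique) auto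
      then show ?thesis by simp
    qed
    then show "indicator {0..<real n} x *\<^sub>R f (nat \<lfloor>x\<rfloor>) + indicator {real n..<real (Suc n)} x *\<^sub>R f n
      = indicator {0..<real (Suc n)} x *\<^sub>R f (nat \<lfloor>x\<rfloor>)"
      by (cases "x < 0"; cases "x < real n"; cases "x < real (Suc n)") (simp_all add: indicator_def)
  qed
  finally show ?case .
qed (simp add: has_bochner_integral_zero)

text \<open>
  Integrable domination of the rescaled summands: the Gaussian decay is only used through the tangent
  \<open>y\<^sup>2 / (1 + y / K) \<ge> K y - K\<^sup>2\<close>, with a slope \<open>K\<close> that beats the exponential tilt \<open>B\<close>.
\<close>

lemma norm_summand_le:
  fixes A B K s x :: real and M :: nat and l :: complex
  assumes A: "A > 0" and M: "M > 0" and d: "sqrt (M / A) \<le> 1" and B: "norm (of_real (sqrt (A * M)) * l) \<le> B"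
    and K: "K = 2 * (B + 2)" "sqrt (A * M) \<ge> K"
    and s: "A + s > 0" "\<bar>s * sqrt (M / A) - x\<bar> \<le> 1" "\<bar>(s - 1) * sqrt (M / A) - x\<bar> \<le> 1"
  shows "norm (exp (of_nat M * (l * of_real (s - 1) - ln_Gamma_shift A (of_real s)))) \<le> exp (2 * B + 1 + K\<^sup>2 / 2 - \<bar>x\<bar>)"
proof -
  define d where "d = sqrt (M / A)"
  define q where "q = sqrt (A * M)"
  define y where "y = \<bar>s\<bar> * d"
  have M0: "real M > 0" using M by simp
  have d0: "d > 0" "q > 0" using A M0 by (auto simp: d_def q_def)
  have qd: "q * d = M" "q / A = d" "q * q = A * M" "d * d = M / A"
    using A M0 by (auto simp: q_def d_def real_sqrt_mult real_sqrt_divide real_div_sqrt field_simps)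
  have B0: "B \<ge> 0" using B norm_ge_zero order_trans by blast
  have K0: "K > 0" using K B0 by simp
  have y0: "y \<ge> 0" using d0 by (simp add: y_def)
  have "Re (of_nat M * (l * of_real (s - 1))) \<le> norm (of_nat M * (l * of_real (s - 1)))"
    by (rule complex_Re_le_cmod)
  also have "\<dots> = norm (of_real q * l) * (\<bar>s - 1\<bar> * d)"
    using d0 by (simp add: norm_mult del: of_real_diff flip: qd(1))
  also have "\<dots> \<le> B * (\<bar>x\<bar> + 1)"
  proof (rule mult_mono)
    have "\<bar>s - 1\<bar> * d = \<bar>(s - 1) * d\<bar>" using d0 by (simp add: abs_mult)
    also have "\<dots> \<le> \<bar>x\<bar> + 1" using s(3) by (simp add: d_def)
    finally show "\<bar>s - 1\<bar> * d \<le> \<bar>x\<bar> + 1" .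
  qed (use B B0 d0 in \<open>auto simp: q_def\<close>)
  finally have 1: "Re (of_nat M * (l * of_real (s - 1))) \<le> B * (\<bar>x\<bar> + 1)" .
  have "M * (s\<^sup>2 / (2 * (A + \<bar>s\<bar>)) - \<bar>s\<bar> / A) \<le> M * Re (ln_Gamma_shift A (of_real s))"
    using A s M0 by (intro mult_left_mono Re_ln_Gamma_shift_ge) auto
  moreover have "M * (\<bar>s\<bar> / A) \<le> y"
  proof -
    have "M * (\<bar>s\<bar> / A) = (M / A) * \<bar>s\<bar>" by simp
    also have "\<dots> = y * d" by (simp add: y_def flip: qd(4))
    also have "\<dots> \<le> y * 1" using assms(3) y0 by (intro mult_left_mono) (auto simp: d_def)
    finally show ?thesis by simp
  qed
  moreover have "(K * y - K\<^sup>2) / 2 \<le> M * (s\<^sup>2 / (2 * (A + \<bar>s\<bar>)))"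
  proof -
    \<comment> \<open>This is the tangent bound in multiplicative form. It applies to
      \<open>1 + \<bar>s\<bar> / A = 1 + y / q\<close> because \<open>q \<ge> K\<close>.\<close>
    have "(K * y - K\<^sup>2) * (1 + y / K) = y\<^sup>2 - K\<^sup>2"
      using K0 by (simp add: field_simps power2_eq_square)
    then have "(K * y - K\<^sup>2) * (1 + y / K) \<le> y\<^sup>2" by simp
    moreover have "1 + y / K > 0" using y0 K0 by (simp add: add_pos_nonneg)
    ultimately have "K * y - K\<^sup>2 \<le> y\<^sup>2 / (1 + y / K)" by (simp add: le_divide_eq)
    also have "\<dots> \<le> y\<^sup>2 / (1 + y / q)"
      using y0 K0 K(2) d0 by (intro divide_left_mono add_left_mono mult_pos_pos) (auto simp: q_def[symmetric] add_pos_nonneg)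
    also have "y\<^sup>2 = M / A * s\<^sup>2" by (simp add: y_def power_mult_distrib power2_eq_square[of d] qd)
    also have "y / q = \<bar>s\<bar> / A"
      using qd(2) d0 A by (simp add: y_def field_simps)
    also have "M / A * s\<^sup>2 / (1 + \<bar>s\<bar> / A) = M * (s\<^sup>2 / (A + \<bar>s\<bar>))"
      using A by (simp add: field_simps)
    finally have "(K * y - K\<^sup>2) / 2 \<le> M * (s\<^sup>2 / (A + \<bar>s\<bar>)) / 2"
      by (rule divide_right_mono) simp
    also have "\<dots> = M * (s\<^sup>2 / (2 * (A + \<bar>s\<bar>)))"
      by (simp only: times_divide_eq_right divide_divide_eq_left mult.commute)
    finally show ?thesis .
  qed
  ultimately have 2: "(K * y - K\<^sup>2) / 2 - y \<le> M * Re (ln_Gamma_shift A (of_real s))"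
    unfolding right_diff_distrib by linarith
  \<comment> \<open>\<open>K = 2 * (B + 2)\<close> makes the slope \<open>K / 2 - 1\<close> equal to
    \<open>B + 1\<close>: one unit more than the tilt, which leaves the factor
    \<open>exp (- \<bar>x\<bar>)\<close>.\<close>
  have "(B + 1) * (\<bar>x\<bar> - 1) \<le> (B + 1) * y"
  proof (rule mult_left_mono)
    have "y = \<bar>s * d\<bar>" using d0 by (simp add: y_def abs_mult)
    then show "\<bar>x\<bar> - 1 \<le> y" using s(2) by (simp add: d_def)
  qed (use B0 in auto)
  also have "(B + 1) * y = (K * y) / 2 - y" by (simp add: K algebra_simps)
  finally have "(B + 1) * (\<bar>x\<bar> - 1) - K\<^sup>2 / 2 \<le> M * Re (ln_Gamma_shift A (of_real s))"
    using 2 by (simp add: diff_divide_distrib)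
  with 1 have "Re (of_nat M * (l * of_real (s - 1) - ln_Gamma_shift A (of_real s))) \<le> 2 * B + 1 + K\<^sup>2 / 2 - \<bar>x\<bar>"
    by (simp add: right_diff_distrib algebra_simps)
  then show ?thesis by simp
qed

text \<open>With \<open>j\<close> the integer part of \<open>A + e * x\<close>, the sum times the
  mesh \<open>d = 1 / e\<close> is an integral over \<open>x\<close>. Both increments,
  \<open>j - A\<close> from the power and \<open>j + 1 - A\<close> from
  \<open>Gamma (j + 1)\<close>, become \<open>x\<close> after multiplication by \<open>d\<close>.
  The set \<open>E\<close> records what the cutoff \<open>j < N\<close> leaves in the limit.\<close>

lemma sum_asymptotics:
  fixes M N :: "nat \<Rightarrow> nat" and A :: "nat \<Rightarrow> real" and l :: "nat \<Rightarrow> complex"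
  assumes M: "\<And>k. M k > 0" and A: "\<And>k. A k > 0" "filterlim A at_top sequentially"
    and MA: "(\<lambda>k. M k / A k) \<longlonglongrightarrow> 0"
    and l: "(\<lambda>k. of_real (sqrt (A k * M k)) * l k) \<longlonglongrightarrow> b"
    and E: "E \<in> sets borel" "\<And>x. x \<noteq> 0 \<Longrightarrow>
      eventually (\<lambda>k. A k + sqrt (A k / M k) * x < N k \<longleftrightarrow> x \<in> E) sequentially"
  shows "(\<lambda>k. of_real (sqrt (M k / A k)) *
      (\<Sum>j<N k. exp (of_nat (M k) * (l k * of_real (real j - A k) - ln_Gamma_shift (A k) (of_real (real j + 1 - A k))))))
    \<longlonglongrightarrow> (\<integral>x. indicator E x *\<^sub>R exp (- (of_real x)\<^sup>2 / 2 + b * of_real x) \<partial>lborel)"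
proof -
  define T where "T = (\<lambda>k j. exp (of_nat (M k) * (l k * of_real (real j - A k) - ln_Gamma_shift (A k) (of_real (real j + 1 - A k)))))"
  define e where "e = (\<lambda>k. sqrt (A k / M k))"
  define d where "d = (\<lambda>k. sqrt (M k / A k))"
  define j where "j = (\<lambda>k x. nat \<lfloor>A k + e k * x\<rfloor>)"
  define h where "h = (\<lambda>k x. indicator {0..<real (N k)} (A k + e k * x) *\<^sub>R T k (j k x))"
  define f where "f = (\<lambda>x::real. indicator E x *\<^sub>R exp (- (of_real x)\<^sup>2 / 2 + b * of_real x))"
  have M': "real (M k) > 0" for k using M[of k] by simp
  have e0: "e k > 0" "d k > 0" "e k * d k = 1" for k
    using A(1)[of k] M'[of k] by (simp_all add: e_def d_def real_sqrt_divide)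
  have Md: "M k = sqrt (A k * M k) * d k" for k
    using A(1)[of k] M'[of k] by (simp add: d_def real_sqrt_divide real_sqrt_mult)
  have d_lim: "d \<longlonglongrightarrow> 0" unfolding d_def using tendsto_real_sqrt[OF MA] by simp
  have j_bounds: "\<bar>(real (j k x) - A k) * d k - x\<bar> \<le> d k" "\<bar>(real (j k x) + 1 - A k) * d k - x\<bar> \<le> d k"
    if "0 \<le> A k + e k * x" for k x
  proof -
    have "real (j k x) \<le> A k + e k * x" "A k + e k * x < real (j k x) + 1"
      using that unfolding j_def by linarith+
    then have "(real (j k x) - A k) * d k \<le> (e k * x) * d k" "(e k * x) * d k \<le> (real (j k x) + 1 - A k) * d k"
      using e0(2)[of k] by (intro mult_right_mono; simp)+
    moreover have "(e k * x) * d k = x" using e0(3)[of k] by (simp add: mult_ac)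
    ultimately show "\<bar>(real (j k x) - A k) * d k - x\<bar> \<le> d k" "\<bar>(real (j k x) + 1 - A k) * d k - x\<bar> \<le> d k"
      by (auto simp: algebra_simps abs_le_iff)
  qed
  have sum_eq: "of_real (d k) * (\<Sum>j<N k. T k j) = (\<integral>x. h k x \<partial>lborel)" for k
  proof -
    have "(\<Sum>j<N k. T k j) = (\<integral>x. indicator {0..<real (N k)} x *\<^sub>R T k (nat \<lfloor>x\<rfloor>) \<partial>lborel)"
      using has_bochner_integral_step_function[of "N k" "T k"] by (simp add: has_bochner_integral_iff)
    also have "\<dots> = \<bar>e k\<bar> *\<^sub>R (\<integral>x. h k x \<partial>lborel)"
      unfolding h_def j_def using e0[of k] by (intro lborel_integral_real_affine) auto
    finally have "of_real (d k) * (\<Sum>j<N k. T k j) = of_real (e k * d k) * (\<integral>x. h k x \<partial>lborel)"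
      using e0(1)[of k] by (simp add: scaleR_conv_of_real)
    then show ?thesis by (simp add: e0)
  qed
  \<comment> \<open>Strictly above the limit, so that it eventually bounds the rescaled
    tilt.\<close>
  define B where "B = norm b + 1"
  define K where "K = 2 * (B + 2)"
  define C where "C = exp (2 * B + 1 + K\<^sup>2 / 2)"
  have "(\<lambda>k. \<integral>x. h k x \<partial>lborel) \<longlonglongrightarrow> (\<integral>x. f x \<partial>lborel)"
  proof (rule integral_dominated_convergence_eventually)
    show "f \<in> borel_measurable lborel" unfolding f_def using E(1) by measurable
    show "h k \<in> borel_measurable lborel" for k unfolding h_def j_def by measurable
    show "integrable lborel (\<lambda>x::real. C * (2 * (1 / (1 + 1 * x\<^sup>2))))"
      by (intro integrable_mult_right integrable_inverse_1_plus_square_scaled) simp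
    show "AE x in lborel. (\<lambda>k. h k x) \<longlonglongrightarrow> f x"
      using AE_lborel_singleton[of "0::real"]
    proof eventually_elim
      fix x :: real assume x: "x \<noteq> 0"
      \<comment> \<open>The lower end \<open>j \<ge> 0\<close> disappears in the limit: for fixed
        \<open>x\<close>, \<open>e * \<bar>x\<bar>\<close> is at most
        \<open>sqrt A * \<bar>x\<bar>\<close>, which is eventually below \<open>A\<close>.\<close>
      have nonneg: "eventually (\<lambda>k. 0 \<le> A k + e k * x) sequentially"
      proof -
        have "(\<lambda>k. \<bar>x\<bar> * (1 / sqrt (A k))) \<longlonglongrightarrow> \<bar>x\<bar> * 0"
          by (intro tendsto_mult tendsto_const real_tendsto_divide_at_top[OF tendsto_const] filterlim_compose[OF sqrt_at_top A(2)])
        then have "eventually (\<lambda>k. \<bar>x\<bar> * (1 / sqrt (A k)) < 1) sequentially"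
          by (intro order_tendstoD) auto
        then show ?thesis
        proof eventually_elim
          case (elim k)
          have "\<bar>x\<bar> < sqrt (A k)" using elim A(1)[of k] by (simp add: divide_less_eq)
          moreover have "e k \<le> sqrt (A k)"
            using M[of k] A(1)[of k] by (auto simp: e_def divide_le_eq intro: mult_left_mono[of 1 "real (M k)", simplified])
          ultimately have "e k * \<bar>x\<bar> \<le> sqrt (A k) * sqrt (A k)"
            using e0(1)[of k] A(1)[of k] by (intro mult_mono) auto
          moreover have "- (e k * \<bar>x\<bar>) \<le> e k * x" using e0(1)[of k] by (simp add: abs_if)
          ultimately show ?case using A(1)[of k] by simp
        qed
      qed
      have j1: "(\<lambda>k. (real (j k x) - A k) * d k - x) \<longlonglongrightarrow> 0"
        by (rule Lim_null_comparison[OF _ d_lim]) (use nonneg in \<open>eventually_elim, simp add: j_bounds\<close>)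
      have j2: "(\<lambda>k. (real (j k x) + 1 - A k) * d k - x) \<longlonglongrightarrow> 0"
        by (rule Lim_null_comparison[OF _ d_lim]) (use nonneg in \<open>eventually_elim, simp add: j_bounds\<close>)
      have "(\<lambda>k. of_nat (M k) * ln_Gamma_shift (A k) (of_real (real (j k x) + 1 - A k))) \<longlonglongrightarrow> (of_real x)\<^sup>2 / 2"
      proof (rule ln_Gamma_shift_tendsto[OF M A(2) MA])
        have "(\<lambda>k. complex_of_real ((real (j k x) + 1 - A k) * d k)) \<longlonglongrightarrow> of_real x"
          using tendsto_add[OF j2 tendsto_const[of x]] by (intro tendsto_of_real) simp
        then show "(\<lambda>k. complex_of_real (real (j k x) + 1 - A k) * of_real (sqrt (M k / A k))) \<longlonglongrightarrow> of_real x"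
          by (simp only: of_real_mult d_def)
      qed
      moreover have "(\<lambda>k. of_real (sqrt (A k * M k)) * l k * of_real ((real (j k x) - A k) * d k)) \<longlonglongrightarrow> b * of_real x"
        using tendsto_add[OF j1 tendsto_const[of x]] by (intro tendsto_mult l tendsto_of_real) simp
      ultimately have "(\<lambda>k. exp (of_real (sqrt (A k * M k)) * l k * of_real ((real (j k x) - A k) * d k) -
          of_nat (M k) * ln_Gamma_shift (A k) (of_real (real (j k x) + 1 - A k)))) \<longlonglongrightarrow> exp (b * of_real x - (of_real x)\<^sup>2 / 2)"
        by (rule tendsto_exp[OF tendsto_diff, rotated])
      moreover have "exp (of_real (sqrt (A k * M k)) * l k * of_real ((real (j k x) - A k) * d k) -
          of_nat (M k) * ln_Gamma_shift (A k) (of_real (real (j k x) + 1 - A k))) = T k (j k x)" for k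
      proof -
        have "of_nat (M k) = complex_of_real (sqrt (A k * M k) * d k)"
          using Md[of k] by (metis of_real_of_nat_eq)
        then have "of_real (sqrt (A k * M k)) * l k * of_real ((real (j k x) - A k) * d k) =
            of_nat (M k) * (l k * of_real (real (j k x) - A k))"
          by (simp only: of_real_mult mult_ac)
        then show ?thesis by (simp only: T_def right_diff_distrib)
      qed
      ultimately have T: "(\<lambda>k. T k (j k x)) \<longlonglongrightarrow> exp (- (of_real x)\<^sup>2 / 2 + b * of_real x)"
        by (simp add: add.commute)
      have "eventually (\<lambda>k. indicator E x *\<^sub>R T k (j k x) = h k x) sequentially"
        using nonneg E(2)[OF x] by eventually_elim (auto simp: h_def e_def indicator_def)
      moreover have "(\<lambda>k. indicator E x *\<^sub>R T k (j k x)) \<longlonglongrightarrow> f x"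
        unfolding f_def by (intro tendsto_intros T)
      ultimately show "(\<lambda>k. h k x) \<longlonglongrightarrow> f x" by (rule Lim_transform_eventually[rotated])
    qed
    show "eventually (\<lambda>k. \<forall>x. norm (h k x) \<le> C * (2 * (1 / (1 + 1 * x\<^sup>2)))) sequentially"
    proof -
      have "(\<lambda>k. norm (of_real (sqrt (A k * M k)) * l k)) \<longlonglongrightarrow> norm b"
        by (intro tendsto_norm l)
      then have "eventually (\<lambda>k. norm (of_real (sqrt (A k * M k)) * l k) < B) sequentially"
        by (rule order_tendstoD) (simp add: B_def)
      moreover have "eventually (\<lambda>k. d k < 1) sequentially"
        using d_lim by (rule order_tendstoD) simp
      moreover have "eventually (\<lambda>k. sqrt (A k) \<ge> K) sequentially"
        using filterlim_compose[OF sqrt_at_top A(2)] by (simp add: filterlim_at_top)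
      ultimately show ?thesis
      proof eventually_elim
        case (elim k)
        show ?case
        proof
          fix x :: real
          have C0: "C > 0" by (simp add: C_def)
          have p: "1 + x\<^sup>2 > 0" by (simp add: add_pos_nonneg)
          show "norm (h k x) \<le> C * (2 * (1 / (1 + 1 * x\<^sup>2)))"
          proof (cases "0 \<le> A k + e k * x")
            case False
            then have "h k x = 0" by (simp add: h_def)
            then show ?thesis using C0 p by simp
          next
            case True
            have "norm (h k x) \<le> norm (T k (j k x))" by (simp add: h_def indicator_def)
            also have "\<dots> = norm (exp (of_nat (M k) * (l k * of_real ((real (j k x) + 1 - A k) - 1) -
                ln_Gamma_shift (A k) (of_real (real (j k x) + 1 - A k)))))"
              by (simp add: T_def)
            also have "\<dots> \<le> exp (2 * B + 1 + K\<^sup>2 / 2 - \<bar>x\<bar>)"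
            proof (rule norm_summand_le[OF A(1) M])
              have "sqrt (A k) \<le> sqrt (A k * M k)"
                using M[of k] A(1)[of k] by simp
              then show "sqrt (A k * M k) \<ge> K" using elim by linarith
              show "\<bar>(real (j k x) + 1 - A k) * sqrt (M k / A k) - x\<bar> \<le> 1"
                using j_bounds(2)[OF True] elim unfolding d_def by linarith
              show "\<bar>((real (j k x) + 1 - A k) - 1) * sqrt (M k / A k) - x\<bar> \<le> 1"
              proof -
                have "(real (j k x) + 1 - A k) - 1 = real (j k x) - A k" by simp
                then show ?thesis
                  using j_bounds(1)[OF True] elim unfolding d_def by (simp only:)
              qed
            qed (use elim in \<open>auto simp: d_def K_def\<close>)
            also have "\<dots> = C / exp \<bar>x\<bar>" by (simp add: C_def exp_diff)
            \<comment> \<open>The quadratic Taylor bound for \<open>exp \<bar>x\<bar>\<close>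
              reduces the majorant to one whose integrability is known.\<close>
            also have "\<dots> \<le> C / ((1 + x\<^sup>2) / 2)"
            proof (rule divide_left_mono)
              show "(1 + x\<^sup>2) / 2 \<le> exp \<bar>x\<bar>"
                using exp_lower_Taylor_quadratic[of "\<bar>x\<bar>"] by simp
            qed (use C0 p in auto)
            finally show ?thesis by simp
          qed
        qed
      qed
    qed
  qed
  then show ?thesis by (simp only: f_def T_def d_def flip: sum_eq)
qed

section \<open>Asymptotics of the kernel\<close>

text \<open>\<open>Ln (1 + a) - a\<close> is of order \<open>\<bar>a\<bar>\<^sup>2\<close>, and
  \<open>r * a\<close> stays bounded while \<open>a\<close> tends to 0.\<close>

lemma Ln_1_plus_tendsto:
  fixes a :: "nat \<Rightarrow> complex" and r :: "nat \<Rightarrow> real"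
  assumes a: "a \<longlonglongrightarrow> 0" and r: "(\<lambda>k. of_real (r k) * a k) \<longlonglongrightarrow> p"
  shows "(\<lambda>k. of_real (r k) * Ln (1 + a k)) \<longlonglongrightarrow> p"
proof -
  have na: "(\<lambda>k. norm (a k)) \<longlonglongrightarrow> 0" using a by (rule tendsto_norm_zero)
  then have "eventually (\<lambda>k. norm (a k) < 1) sequentially"
    by (rule order_tendstoD) simp
  then have ev: "eventually (\<lambda>k. norm (of_real (r k) * Ln (1 + a k) - of_real (r k) * a k) \<le>
      norm (of_real (r k) * a k) * (norm (a k) / (1 - norm (a k)))) sequentially"
  proof eventually_elim
    case (elim k)
    have "norm (of_real (r k) * Ln (1 + a k) - of_real (r k) * a k) = \<bar>r k\<bar> * norm (Ln (1 + a k) - a k)"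
      by (simp only: norm_mult norm_of_real flip: right_diff_distrib)
    also have "\<dots> \<le> \<bar>r k\<bar> * (norm (a k) ^ 2 / (1 - norm (a k)))"
      by (intro mult_left_mono Ln_approx_linear elim) auto
    finally show ?case by (simp add: norm_mult power2_eq_square)
  qed
  have "(\<lambda>k. norm (of_real (r k) * a k) * (norm (a k) / (1 - norm (a k)))) \<longlonglongrightarrow> norm p * (0 / (1 - 0))"
    by (intro tendsto_intros r na) auto
  then have "(\<lambda>k. of_real (r k) * Ln (1 + a k) - of_real (r k) * a k) \<longlonglongrightarrow> 0"
    by (intro Lim_null_comparison[OF ev]) simp
  from tendsto_add[OF this r] show ?thesis by simp
qed

text \<open>Scaling by a positive real preserves the half-plane of the principal branch; the
  positive normalisation of the weights can therefore leave the root.\<close>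

lemma csqrt_of_real_mult:
  assumes "r > 0"
  shows "csqrt (of_real r * z) = of_real (sqrt r) * csqrt z"
proof (rule csqrt_unique)
  show "(of_real (sqrt r) * csqrt z)\<^sup>2 = of_real r * z"
    using assms by (simp add: power_mult_distrib flip: of_real_power)
  show "0 < Re (of_real (sqrt r) * csqrt z) \<or> Re (of_real (sqrt r) * csqrt z) = 0 \<and> 0 \<le> Im (of_real (sqrt r) * csqrt z)"
    using assms csqrt_principal[of z] by auto
qed

definition kernel_summand :: "nat \<Rightarrow> real \<Rightarrow> complex \<Rightarrow> nat \<Rightarrow> complex" where
  "kernel_summand M A l j = exp (of_nat M * (l * of_real (real j - A) - ln_Gamma_shift A (of_real (real j + 1 - A))))"

definition weight_scale :: "nat \<Rightarrow> real \<Rightarrow> real \<Rightarrow> real" where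
  "weight_scale M A lam = Gamma A ^ M * exp (- (M * A * (ln A + 2 * lam))) * sqrt (A / (2 * pi * M))"

text \<open>Substitute \<open>Gamma (j + 1) = Gamma A * A powr s * exp (ln_Gamma_shift A s)\<close>
  with \<open>s = j + 1 - A\<close>. The powers of \<open>A\<close> that depend on \<open>j\<close>
  cancel and leave \<open>A powr (M * (A - 1))\<close> in front.\<close>

lemma kernel_sum_eq:
  assumes A: "A > 0"
  shows "(\<Sum>j<N. exp (of_nat M * (of_real (ln A) + l)) ^ j / Gamma (of_nat (j + 1)) ^ M) =
    exp (of_real (M * (A - 1) * ln A) + of_real (M * A) * l) / of_real (Gamma A) ^ M * (\<Sum>j<N. kernel_summand M A l j)"
proof -
  have G0: "Gamma A > 0" using A by (simp add: Gamma_real_pos)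
  have "exp (of_nat M * (of_real (ln A) + l)) ^ j / Gamma (of_nat (j + 1)) ^ M =
    exp (of_real (M * (A - 1) * ln A) + of_real (M * A) * l) / of_real (Gamma A) ^ M * kernel_summand M A l j" for j
  proof -
    define s where "s = complex_of_real (real j + 1 - A)"
    have As: "of_real A + s = of_nat (j + 1)" by (simp add: s_def)
    have "exp (ln_Gamma_shift A s) = Gamma (of_real A + s) / (Gamma (of_real A) * of_real A powr s)"
      using A by (intro exp_ln_Gamma_shift) (auto simp: s_def)
    moreover have "of_real A powr s = exp (s * of_real (ln A))"
      using A by (simp add: powr_def Ln_of_real)
    moreover have "Gamma (complex_of_real A) = of_real (Gamma A)"
      by (simp add: Gamma_complex_of_real)
    ultimately have G: "Gamma (of_nat (j + 1)) = exp (ln_Gamma_shift A s + s * of_real (ln A)) * of_real (Gamma A)"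
      using G0 unfolding As by (simp add: exp_add)
    have "exp (of_nat M * (of_real (ln A) + l)) ^ j / Gamma (of_nat (j + 1)) ^ M =
        exp (of_nat j * (of_nat M * (of_real (ln A) + l))) /
        (exp (of_nat M * (ln_Gamma_shift A s + s * of_real (ln A))) * of_real (Gamma A) ^ M)"
      unfolding G power_mult_distrib by (simp only: exp_of_nat_mult)
    also have "\<dots> = exp (of_nat j * (of_nat M * (of_real (ln A) + l)) - of_nat M * (ln_Gamma_shift A s + s * of_real (ln A))) / of_real (Gamma A) ^ M"
      by (simp add: exp_diff)
    also have "of_nat j * (of_nat M * (of_real (ln A) + l)) - of_nat M * (ln_Gamma_shift A s + s * of_real (ln A)) =
        (of_real (M * (A - 1) * ln A) + of_real (M * A) * l) + of_nat M * (l * of_real (real j - A) - ln_Gamma_shift A s)"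
      by (simp add: s_def algebra_simps)
    finally show ?thesis
      unfolding kernel_summand_def s_def by (simp only: exp_add times_divide_eq_left)
  qed
  then show ?thesis by (simp only: sum_distrib_left)
qed

text \<open>An exact identity. The exponents of \<open>A\<close> are \<open>M\<close> from
  \<open>|z\<^sub>1 z\<^sub>2|\<close>, \<open>- M * A\<close> from the weights and
  \<open>M * (A - 1)\<close> from the sum, with total 0. The weights also contribute
  \<open>- M * A * (Re L\<^sub>1 + Re L\<^sub>2)\<close> and the sum
  \<open>M * A * (L\<^sub>1 + cnj L\<^sub>2)\<close>, so of these only the imaginary parts remain,
  as a phase of the first point times a conjugate phase of the second.\<close>

lemma rescaled_kernel_eq:
  fixes r a\<^sub>1 a\<^sub>2 :: complex and M N :: nat and A c :: real
  assumes A: "A > 0" "(cmod r)\<^sup>2 = A" and M: "M > 0" and a: "1 + a\<^sub>1 \<noteq> 0" "1 + a\<^sub>2 \<noteq> 0"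
  defines "z\<^sub>1 \<equiv> r ^ M * (1 + a\<^sub>1) ^ M" and "z\<^sub>2 \<equiv> r ^ M * (1 + a\<^sub>2) ^ M"
  shows "of_real (M / A) * of_real (cmod z\<^sub>1 * cmod z\<^sub>2) * product_kernel c M N z\<^sub>1 z\<^sub>2 =
    1 / of_real pi * (1 / of_real (sqrt (2 * pi))) * exp (of_real (M * (Re (Ln (1 + a\<^sub>1)) + Re (Ln (1 + a\<^sub>2))))) *
    csqrt ((weight c M z\<^sub>1 / of_real (weight_scale M A (Re (Ln (1 + a\<^sub>1))))) *
           (weight c M z\<^sub>2 / of_real (weight_scale M A (Re (Ln (1 + a\<^sub>2)))))) *
    (of_real (sqrt (M / A)) * (\<Sum>j<N. kernel_summand M A (Ln (1 + a\<^sub>1) + cnj (Ln (1 + a\<^sub>2))) j)) *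
    (exp (\<i> * of_real (M * A * Im (Ln (1 + a\<^sub>1)))) * exp (- (\<i> * of_real (M * A * Im (Ln (1 + a\<^sub>2))))))"
proof -
  define L\<^sub>1 L\<^sub>2 where "L\<^sub>1 = Ln (1 + a\<^sub>1)" and "L\<^sub>2 = Ln (1 + a\<^sub>2)"
  define S\<^sub>1 S\<^sub>2 where "S\<^sub>1 = weight_scale M A (Re L\<^sub>1)" and "S\<^sub>2 = weight_scale M A (Re L\<^sub>2)"
  define \<omega> where "\<omega> = (weight c M z\<^sub>1 / of_real S\<^sub>1) * (weight c M z\<^sub>2 / of_real S\<^sub>2)"
  define Q where "Q = sqrt (A / (2 * pi * M))"
  have M': "real M > 0" using M by simp
  have e: "exp L\<^sub>1 = 1 + a\<^sub>1" "exp L\<^sub>2 = 1 + a\<^sub>2" using a by (simp_all add: L\<^sub>1_def L\<^sub>2_def)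
  have lnA: "exp (ln A) = A" using A by simp
  have cz: "cmod z\<^sub>1 * cmod z\<^sub>2 = exp (M * ln A + M * (Re L\<^sub>1 + Re L\<^sub>2))"
  proof -
    have "cmod z\<^sub>1 * cmod z\<^sub>2 = ((cmod r)\<^sup>2) ^ M * (cmod (1 + a\<^sub>1) * cmod (1 + a\<^sub>2)) ^ M"
      by (simp add: z\<^sub>1_def z\<^sub>2_def norm_mult norm_power power2_eq_square power_mult_distrib)
    also have "\<dots> = exp (ln A) ^ M * (exp (Re L\<^sub>1) * exp (Re L\<^sub>2)) ^ M"
      unfolding A(2) lnA e[symmetric] by simp
    also have "\<dots> = exp (M * ln A + M * (Re L\<^sub>1 + Re L\<^sub>2))"
      by (simp add: exp_add exp_of_nat_mult power_mult_distrib distrib_left)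
    finally show ?thesis .
  qed
  have zz: "z\<^sub>1 * cnj z\<^sub>2 = exp (of_nat M * (of_real (ln A) + (L\<^sub>1 + cnj L\<^sub>2)))"
  proof -
    have "z\<^sub>1 * cnj z\<^sub>2 = (r * cnj r) ^ M * ((1 + a\<^sub>1) * cnj (1 + a\<^sub>2)) ^ M"
      by (simp add: z\<^sub>1_def z\<^sub>2_def power_mult_distrib)
    also have "r * cnj r = of_real A" using complex_norm_square[of r] by (simp only: A(2))
    also have "of_real A = exp (complex_of_real (ln A))"
      using A by (simp add: exp_of_real)
    also have "(1 + a\<^sub>1) * cnj (1 + a\<^sub>2) = exp L\<^sub>1 * exp (cnj L\<^sub>2)"
      unfolding e[symmetric] by (simp add: exp_cnj)
    finally show ?thesis by (simp add: exp_add exp_of_nat_mult power_mult_distrib distrib_left)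
  qed
  have Q: "Q > 0" using A M' by (simp add: Q_def)
  have G0: "Gamma A > 0" using A by (simp add: Gamma_real_pos)
  have S0: "S\<^sub>1 > 0" "S\<^sub>2 > 0" using Q G0 by (simp_all add: S\<^sub>1_def S\<^sub>2_def weight_scale_def flip: Q_def)
  have "S\<^sub>1 * S\<^sub>2 = (Gamma A ^ M * exp (- (M * A * (ln A + Re L\<^sub>1 + Re L\<^sub>2))) * Q)\<^sup>2"
  proof -
    have "exp (- (M * A * (ln A + Re L\<^sub>1 + Re L\<^sub>2))) ^ 2 =
        exp (- (M * A * (ln A + 2 * Re L\<^sub>1))) * exp (- (M * A * (ln A + 2 * Re L\<^sub>2)))"
      unfolding exp_add[symmetric] exp_double[symmetric] by (simp add: algebra_simps)
    then show ?thesis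
      by (simp only: S\<^sub>1_def S\<^sub>2_def weight_scale_def Q_def[symmetric] power_mult_distrib) (simp add: power2_eq_square)
  qed
  then have sS: "sqrt (S\<^sub>1 * S\<^sub>2) = Gamma A ^ M * exp (- (M * A * (ln A + Re L\<^sub>1 + Re L\<^sub>2))) * Q"
    using Q G0 by simp
  have "csqrt (weight c M z\<^sub>1 * weight c M z\<^sub>2) = csqrt (of_real (S\<^sub>1 * S\<^sub>2) * \<omega>)"
    using S0 by (simp add: \<omega>_def)
  also have "\<dots> = of_real (sqrt (S\<^sub>1 * S\<^sub>2)) * csqrt \<omega>"
    using S0 by (intro csqrt_of_real_mult) simp
  finally have cs: "csqrt (weight c M z\<^sub>1 * weight c M z\<^sub>2) =
      of_real (Gamma A) ^ M * exp (of_real (- (M * A * (ln A + Re L\<^sub>1 + Re L\<^sub>2)))) * of_real Q * csqrt \<omega>"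
    by (simp only: sS of_real_mult of_real_power exp_of_real)
  define T where "T = (\<Sum>j<N. kernel_summand M A (L\<^sub>1 + cnj L\<^sub>2) j)"
  have "of_real (M / A) * of_real (cmod z\<^sub>1 * cmod z\<^sub>2) * product_kernel c M N z\<^sub>1 z\<^sub>2 =
     of_real (M / A) * exp (of_real (M * ln A + M * (Re L\<^sub>1 + Re L\<^sub>2))) * (1 / of_real pi *
      (of_real (Gamma A) ^ M * exp (of_real (- (M * A * (ln A + Re L\<^sub>1 + Re L\<^sub>2)))) * of_real Q * csqrt \<omega>) *
      (exp (of_real (M * (A - 1) * ln A) + of_real (M * A) * (L\<^sub>1 + cnj L\<^sub>2)) / of_real (Gamma A) ^ M * T))"
    unfolding product_kernel_def zz kernel_sum_eq[OF A(1)] cs cz T_def exp_of_real ..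
  also have "\<dots> = of_real (M / A * Q) * (1 / of_real pi) * csqrt \<omega> * T *
     (exp (of_real (M * ln A + M * (Re L\<^sub>1 + Re L\<^sub>2))) * exp (of_real (- (M * A * (ln A + Re L\<^sub>1 + Re L\<^sub>2)))) *
      exp (of_real (M * (A - 1) * ln A) + of_real (M * A) * (L\<^sub>1 + cnj L\<^sub>2)))"
    using G0 by simp
  also have "exp (of_real (M * ln A + M * (Re L\<^sub>1 + Re L\<^sub>2))) * exp (of_real (- (M * A * (ln A + Re L\<^sub>1 + Re L\<^sub>2)))) *
      exp (of_real (M * (A - 1) * ln A) + of_real (M * A) * (L\<^sub>1 + cnj L\<^sub>2)) =
      exp (of_real (M * (Re L\<^sub>1 + Re L\<^sub>2))) * (exp (\<i> * of_real (M * A * Im L\<^sub>1)) * exp (- (\<i> * of_real (M * A * Im L\<^sub>2))))"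
    unfolding exp_add[symmetric]
    by (rule arg_cong[where f = exp]) (simp add: complex_eq_iff algebra_simps)
  \<comment> \<open>The prefactor \<open>M / A\<close> loses one half power to the weights; the
    remaining \<open>sqrt (M / A)\<close> is the mesh of the Riemann sum.\<close>
  also have "M / A * Q = 1 / sqrt (2 * pi) * sqrt (M / A)"
  proof -
    have "M / A * Q = sqrt (M / A) * (sqrt (M / A) * Q)"
      using A M' by (simp flip: mult.assoc)
    also have "sqrt (M / A) * Q = 1 / sqrt (2 * pi)"
      using A M' by (simp add: Q_def real_sqrt_divide real_sqrt_mult)
    finally show ?thesis by simp
  qed
  finally show ?thesis
    unfolding T_def \<omega>_def S\<^sub>1_def S\<^sub>2_def L\<^sub>1_def L\<^sub>2_def by (simp only: of_real_mult of_real_divide of_real_1 mult_ac)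
qed

text \<open>
  The second phase compensates the oscillation of \<open>exp ((p\<^sub>1 + cnj p\<^sub>2)\<^sup>2 / 2 - (Re p\<^sub>1)\<^sup>2 - (Re p\<^sub>2)\<^sup>2)\<close>, so that
  the limit is the Ginibre kernel itself and not a conjugate of it.
\<close>

definition kernel_gauge :: "nat \<Rightarrow> nat \<Rightarrow> complex \<Rightarrow> real \<Rightarrow> complex \<Rightarrow> complex" where
  "kernel_gauge M N u \<theta> v =
    exp (\<i> * of_real (M * (N * (cmod u)\<^sup>2) * Im (Ln (1 + v / (u * of_real (sqrt (real M * real N))))))) *
    exp (\<i> * of_real (Re (exp (- \<i> * of_real \<theta>) * v) * Im (exp (- \<i> * of_real \<theta>) * v)))"

lemma cnj_kernel_gauge: "cnj (kernel_gauge M N u \<theta> v) * kernel_gauge M N u \<theta> v = 1"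
proof -
  have 1: "cnj (exp (\<i> * of_real x)) * exp (\<i> * of_real x) = 1" for x
    by (simp add: exp_cnj flip: exp_add)
  have "cnj (a * b) * (a * b) = (cnj a * a) * (cnj b * b)" for a b :: complex
    by (simp add: mult_ac)
  then show ?thesis
    unfolding kernel_gauge_def by (simp only: 1 mult_1_left)
qed

text \<open>Bulk and edge are treated together: \<open>E\<close> is the surviving range of the sum,
  and the number \<open>I\<close> is the ratio of the Gaussian integral over \<open>E\<close> to the
  one over the line. The rotation by \<open>\<theta>\<close> leaves moduli and
  \<open>w\<^sub>1 * cnj w\<^sub>2\<close> unchanged, so it can enter the limit only through
  \<open>I\<close>.\<close>

lemma rescaled_kernel_tendsto:
  fixes M N :: "nat \<Rightarrow> nat" and c \<theta> :: real and u w\<^sub>1 w\<^sub>2 :: complex and v\<^sub>1 v\<^sub>2 :: "nat \<Rightarrow> complex"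
  assumes M: "\<And>k. M k > 0" and N: "\<And>k. N k > 0" "filterlim (\<lambda>k. real (N k)) at_top sequentially"
    and MN: "(\<lambda>k. real (M k) / real (N k)) \<longlonglongrightarrow> 0"
    and c: "c > 0" and u: "u = of_real (cmod u) * exp (\<i> * of_real \<theta>)" "u \<noteq> 0"
    and v: "v\<^sub>1 \<longlonglongrightarrow> w\<^sub>1" "v\<^sub>2 \<longlonglongrightarrow> w\<^sub>2"
    and E: "E \<in> sets borel" "\<And>x. x \<noteq> 0 \<Longrightarrow> eventually (\<lambda>k. N k * (cmod u)\<^sup>2 + sqrt (N k * (cmod u)\<^sup>2 / M k) * x < N k \<longleftrightarrow> x \<in> E) sequentially"
  defines "z \<equiv> \<lambda>k v. (of_real (sqrt (real (N k))) * u) ^ M k * (1 + v / (u * of_real (sqrt (real (M k) * real (N k))))) ^ M k"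
    and "p\<^sub>1 \<equiv> exp (- \<i> * of_real \<theta>) * w\<^sub>1" and "p\<^sub>2 \<equiv> exp (- \<i> * of_real \<theta>) * w\<^sub>2"
  assumes I: "(\<integral>x. indicator E x *\<^sub>R exp (- (of_real x)\<^sup>2 / 2 + (p\<^sub>1 + cnj p\<^sub>2) * of_real x) \<partial>lborel) =
      of_real (sqrt (2 * pi)) * exp ((p\<^sub>1 + cnj p\<^sub>2)\<^sup>2 / 2) * I"
  shows "(\<lambda>k. of_real (M k / (N k * (cmod u)\<^sup>2)) * of_real (cmod (z k (v\<^sub>1 k)) * cmod (z k (v\<^sub>2 k))) *
      product_kernel c (M k) (N k) (z k (v\<^sub>1 k)) (z k (v\<^sub>2 k)) *
      (cnj (kernel_gauge (M k) (N k) u \<theta> (v\<^sub>1 k)) * kernel_gauge (M k) (N k) u \<theta> (v\<^sub>2 k)))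
    \<longlonglongrightarrow> gin_bulk w\<^sub>1 w\<^sub>2 * I"
proof -
  define A where "A = (\<lambda>k. N k * (cmod u)\<^sup>2)"
  define a where "a = (\<lambda>k v. v / (u * of_real (sqrt (real (M k) * real (N k)))))"
  define ph where "ph = (\<lambda>v. exp (- \<i> * of_real \<theta>) * v)"
  have u0: "cmod u > 0" using u(2) by simp
  have M': "real (M k) > 0" and N': "real (N k) > 0" for k using M[of k] N(1)[of k] by simp_all
  have A0: "A k > 0" for k using N' u0 by (simp add: A_def)
  have A_lim: "filterlim A at_top sequentially"
    unfolding A_def using u0 by (intro filterlim_at_top_mult_tendsto_pos[OF tendsto_const _ N(2)]) auto
  have MA: "(\<lambda>k. M k / A k) \<longlonglongrightarrow> 0"
    using tendsto_mult[OF MN tendsto_const[of "1 / (cmod u)\<^sup>2"]] by (simp add: A_def)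
  have ra: "of_real (sqrt (A k * M k)) * a k v = ph v" for k v
  proof -
    define q where "q = sqrt (real (M k) * real (N k))"
    have q0: "q \<noteq> 0" using M'[of k] N'[of k] by (simp add: q_def)
    have "exp (- \<i> * of_real \<theta>) * u = of_real (cmod u)"
      by (subst (1) u(1)) (simp add: exp_minus)
    then have "exp (- \<i> * of_real \<theta>) = of_real (cmod u) / u"
      using u(2) by (simp add: eq_divide_eq)
    moreover have "sqrt (A k * M k) = cmod u * q"
      by (simp add: A_def q_def real_sqrt_mult)
    ultimately show ?thesis
      using q0 by (simp add: a_def ph_def flip: q_def)
  qed
  have a_lim: "(\<lambda>k. a k (v k)) \<longlonglongrightarrow> 0" if v: "v \<longlonglongrightarrow> w" for v w
  proof -
    have "filterlim (\<lambda>k. sqrt (A k * M k)) at_top sequentially"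
    proof (rule filterlim_at_top_mono[OF filterlim_compose[OF sqrt_at_top A_lim]])
      show "eventually (\<lambda>k. sqrt (A k) \<le> sqrt (A k * M k)) sequentially"
        using M A0 by (intro always_eventually) (simp add: Suc_le_eq)
    qed
    then have "(\<lambda>k. inverse (sqrt (A k * M k))) \<longlonglongrightarrow> 0"
      by (rule tendsto_inverse_0_at_top)
    from tendsto_mult[OF tendsto_of_real[OF this, where ?'a = complex] tendsto_mult[OF tendsto_const[of "exp (- \<i> * of_real \<theta>)"] v]]
    have "(\<lambda>k. of_real (inverse (sqrt (A k * M k))) * ph (v k)) \<longlonglongrightarrow> 0" by (simp add: ph_def)
    moreover have "of_real (inverse (sqrt (A k * M k))) * ph (v k) = a k (v k)" for k
      using A0[of k] M'[of k] by (simp flip: ra[of k])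
    ultimately show ?thesis by simp
  qed
  have L_lim: "(\<lambda>k. of_real (sqrt (A k * M k)) * Ln (1 + a k (v k))) \<longlonglongrightarrow> ph w" if v: "v \<longlonglongrightarrow> w" for v w
  proof (rule Ln_1_plus_tendsto[OF a_lim[OF v]])
    show "(\<lambda>k. of_real (sqrt (A k * M k)) * a k (v k)) \<longlonglongrightarrow> ph w"
      unfolding ra ph_def by (intro tendsto_intros v)
  qed
  have Re_lim: "(\<lambda>k. sqrt (A k * M k) * Re (Ln (1 + a k (v k)))) \<longlonglongrightarrow> Re (ph w)" if v: "v \<longlonglongrightarrow> w" for v w
    using tendsto_Re[OF L_lim[OF v]] by simp
  have nz: "eventually (\<lambda>k. 1 + a k (v k) \<noteq> 0) sequentially" if v: "v \<longlonglongrightarrow> w" for v w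
  proof -
    have "eventually (\<lambda>k. norm (a k (v k)) < 1) sequentially"
      using tendsto_norm_zero[OF a_lim[OF v]] by (rule order_tendstoD) simp
    then show ?thesis
      by eventually_elim (metis add_eq_0_iff norm_minus_cancel norm_one less_irrefl)
  qed
  have r: "(cmod (of_real (sqrt (real (N k))) * u))\<^sup>2 = A k" for k
    using N'[of k] by (simp add: A_def norm_mult power_mult_distrib)
  have W_lim: "(\<lambda>k. weight c (M k) (z k (v k)) / of_real (weight_scale (M k) (A k) (Re (Ln (1 + a k (v k))))))
      \<longlonglongrightarrow> of_real (exp (- (2 * (Re (ph w))\<^sup>2)))" if v: "v \<longlonglongrightarrow> w" for v w
    unfolding weight_scale_def
  proof (rule weight_asymptotics[OF c M A0 A_lim MA _ Re_lim[OF v]])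
    show "eventually (\<lambda>k. z k (v k) \<noteq> 0 \<and> ln (cmod (z k (v k))) = M k / 2 * ln (A k) + M k * Re (Ln (1 + a k (v k)))) sequentially"
      using nz[OF v]
    proof eventually_elim
      case (elim k)
      define q where "q = cmod (of_real (sqrt (real (N k))) * u)"
      have q0: "q > 0" using N'[of k] u(2) by (simp add: q_def)
      have n0: "cmod (1 + a k (v k)) > 0" using elim by simp
      have "ln (A k) = 2 * ln q" using q0 by (simp add: q_def ln_realpow flip: r)
      moreover have "cmod (z k (v k)) = q ^ M k * cmod (1 + a k (v k)) ^ M k"
        by (simp add: z_def a_def q_def norm_mult norm_power)
      moreover have "ln (q ^ M k * cmod (1 + a k (v k)) ^ M k) = M k * ln q + M k * ln (cmod (1 + a k (v k)))"
        using q0 n0 by (simp add: ln_mult_pos ln_realpow)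
      moreover have "Re (Ln (1 + a k (v k))) = ln (cmod (1 + a k (v k)))" using elim by simp
      moreover have "z k (v k) \<noteq> 0" using elim u(2) N'[of k] by (simp add: z_def a_def)
      ultimately show ?case by simp
    qed
  qed
  define l where "l = (\<lambda>k. Ln (1 + a k (v\<^sub>1 k)) + cnj (Ln (1 + a k (v\<^sub>2 k))))"
  have p: "p\<^sub>1 = ph w\<^sub>1" "p\<^sub>2 = ph w\<^sub>2" by (simp_all add: p\<^sub>1_def p\<^sub>2_def ph_def)
  have l_lim: "(\<lambda>k. of_real (sqrt (A k * M k)) * l k) \<longlonglongrightarrow> p\<^sub>1 + cnj p\<^sub>2"
  proof -
    have "(\<lambda>k. of_real (sqrt (A k * M k)) * Ln (1 + a k (v\<^sub>1 k)) + cnj (of_real (sqrt (A k * M k)) * Ln (1 + a k (v\<^sub>2 k)))) \<longlonglongrightarrow> p\<^sub>1 + cnj p\<^sub>2"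
      unfolding p by (intro tendsto_add tendsto_cnj L_lim v)
    then show ?thesis by (simp add: l_def distrib_left)
  qed
  have S_lim: "(\<lambda>k. of_real (sqrt (M k / A k)) * (\<Sum>j<N k. kernel_summand (M k) (A k) (l k) j)) \<longlonglongrightarrow>
      of_real (sqrt (2 * pi)) * exp ((p\<^sub>1 + cnj p\<^sub>2)\<^sup>2 / 2) * I"
    unfolding kernel_summand_def I[symmetric]
    by (rule sum_asymptotics[OF M A0 A_lim MA l_lim E(1)]) (use E(2) in \<open>simp add: A_def\<close>)
  have C_lim: "(\<lambda>k. csqrt ((weight c (M k) (z k (v\<^sub>1 k)) / of_real (weight_scale (M k) (A k) (Re (Ln (1 + a k (v\<^sub>1 k)))))) *
           (weight c (M k) (z k (v\<^sub>2 k)) / of_real (weight_scale (M k) (A k) (Re (Ln (1 + a k (v\<^sub>2 k))))))))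
      \<longlonglongrightarrow> exp (of_real (- (Re p\<^sub>1)\<^sup>2 - (Re p\<^sub>2)\<^sup>2))"
  proof -
    define q where "q = complex_of_real (exp (- (2 * (Re p\<^sub>1)\<^sup>2))) * of_real (exp (- (2 * (Re p\<^sub>2)\<^sup>2)))"
    have q: "q = (of_real (exp (- (Re p\<^sub>1)\<^sup>2 - (Re p\<^sub>2)\<^sup>2)))\<^sup>2"
      unfolding q_def of_real_power[symmetric] of_real_mult[symmetric] exp_add[symmetric] exp_double[symmetric]
      by (simp add: algebra_simps)
    then have cq: "csqrt q = of_real (exp (- (Re p\<^sub>1)\<^sup>2 - (Re p\<^sub>2)\<^sup>2))"
      by (simp add: csqrt_square)
    \<comment> \<open>The limit under the root is positive, hence off the branch cut, and
      \<open>csqrt\<close> is continuous there.\<close>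
    have "q \<notin> \<real>\<^sub>\<le>\<^sub>0" unfolding q_def by (simp add: not_le flip: of_real_mult)
    then have "isCont csqrt q" by (rule continuous_at_csqrt)
    from isCont_tendsto_compose[OF this tendsto_mult[OF W_lim[OF v(1)] W_lim[OF v(2)], folded p, folded q_def]]
    show ?thesis unfolding cq exp_of_real .
  qed
  have X_lim: "(\<lambda>k. exp (complex_of_real (M k * (Re (Ln (1 + a k (v\<^sub>1 k))) + Re (Ln (1 + a k (v\<^sub>2 k))))))) \<longlonglongrightarrow> exp (of_real (0 * (Re p\<^sub>1 + Re p\<^sub>2)))"
  proof (intro tendsto_exp tendsto_of_real)
    \<comment> \<open>\<open>M * Re L\<close> is \<open>sqrt (M / A)\<close> times the convergent
      quantity \<open>sqrt (A * M) * Re L\<close>, so this factor of the kernel tends to 1.\<close>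
    have "(\<lambda>k. sqrt (M k / A k) * (sqrt (A k * M k) * Re (Ln (1 + a k (v\<^sub>1 k))) + sqrt (A k * M k) * Re (Ln (1 + a k (v\<^sub>2 k)))))
        \<longlonglongrightarrow> 0 * (Re p\<^sub>1 + Re p\<^sub>2)"
      unfolding p using tendsto_real_sqrt[OF MA] by (intro tendsto_mult tendsto_add Re_lim v) simp
    moreover have "sqrt (M k / A k) * (sqrt (A k * M k) * x + sqrt (A k * M k) * y) = M k * (x + y)" for k and x y :: real
    proof -
      have "sqrt (M k / A k) * sqrt (A k * M k) = M k"
        using A0[of k] M'[of k] by (simp add: real_sqrt_divide real_sqrt_mult)
      then show ?thesis by (simp only: mult.assoc[symmetric] distrib_left)
    qed
    ultimately show "(\<lambda>k. M k * (Re (Ln (1 + a k (v\<^sub>1 k))) + Re (Ln (1 + a k (v\<^sub>2 k))))) \<longlonglongrightarrow> 0 * (Re p\<^sub>1 + Re p\<^sub>2)"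
      by simp
  qed
  define \<phi> where "\<phi> = (\<lambda>v. exp (\<i> * of_real (Re (ph v) * Im (ph v))))"
  have \<phi>_lim: "(\<lambda>k. cnj (\<phi> (v\<^sub>1 k)) * \<phi> (v\<^sub>2 k)) \<longlonglongrightarrow> cnj (\<phi> w\<^sub>1) * \<phi> w\<^sub>2"
    unfolding \<phi>_def ph_def by (intro tendsto_intros v)
  have "(\<lambda>k. 1 / of_real pi * (1 / of_real (sqrt (2 * pi))) *
      exp (complex_of_real (M k * (Re (Ln (1 + a k (v\<^sub>1 k))) + Re (Ln (1 + a k (v\<^sub>2 k)))))) *
      csqrt ((weight c (M k) (z k (v\<^sub>1 k)) / of_real (weight_scale (M k) (A k) (Re (Ln (1 + a k (v\<^sub>1 k)))))) *
           (weight c (M k) (z k (v\<^sub>2 k)) / of_real (weight_scale (M k) (A k) (Re (Ln (1 + a k (v\<^sub>2 k))))))) *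
      (of_real (sqrt (M k / A k)) * (\<Sum>j<N k. kernel_summand (M k) (A k) (l k) j)) *
      (cnj (\<phi> (v\<^sub>1 k)) * \<phi> (v\<^sub>2 k)))
    \<longlonglongrightarrow> 1 / of_real pi * (1 / of_real (sqrt (2 * pi))) * exp (of_real (0 * (Re p\<^sub>1 + Re p\<^sub>2))) *
      exp (of_real (- (Re p\<^sub>1)\<^sup>2 - (Re p\<^sub>2)\<^sup>2)) * (of_real (sqrt (2 * pi)) * exp ((p\<^sub>1 + cnj p\<^sub>2)\<^sup>2 / 2) * I) *
      (cnj (\<phi> w\<^sub>1) * \<phi> w\<^sub>2)"
    by (intro tendsto_mult tendsto_const X_lim C_lim S_lim \<phi>_lim)
  also have "1 / of_real pi * (1 / of_real (sqrt (2 * pi))) * exp (of_real (0 * (Re p\<^sub>1 + Re p\<^sub>2))) *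
      exp (of_real (- (Re p\<^sub>1)\<^sup>2 - (Re p\<^sub>2)\<^sup>2)) * (of_real (sqrt (2 * pi)) * exp ((p\<^sub>1 + cnj p\<^sub>2)\<^sup>2 / 2) * I) *
      (cnj (\<phi> w\<^sub>1) * \<phi> w\<^sub>2) = gin_bulk w\<^sub>1 w\<^sub>2 * I"
  proof -
    have cn: "cmod w\<^sub>1 = cmod p\<^sub>1" "cmod w\<^sub>2 = cmod p\<^sub>2"
      by (simp_all add: p\<^sub>1_def p\<^sub>2_def norm_mult)
    have pp: "w\<^sub>1 * cnj w\<^sub>2 = p\<^sub>1 * cnj p\<^sub>2"
      by (simp add: p\<^sub>1_def p\<^sub>2_def exp_cnj exp_minus field_simps)
    have phi: "cnj (\<phi> w\<^sub>1) = exp (- (\<i> * of_real (Re p\<^sub>1 * Im p\<^sub>1)))" "\<phi> w\<^sub>2 = exp (\<i> * of_real (Re p\<^sub>2 * Im p\<^sub>2))"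
      by (simp_all add: \<phi>_def p exp_cnj)
    \<comment> \<open>Uses \<open>p\<^sup>2 / 2 - (Re p)\<^sup>2 = - \<bar>p\<bar>\<^sup>2 / 2 + i *
      Re p * Im p\<close> for \<open>p\<^sub>1\<close> and its conjugate for
      \<open>p\<^sub>2\<close>; the cross term of the square is
      \<open>p\<^sub>1 * cnj p\<^sub>2\<close>.\<close>
    have "exp (of_real (- (Re p\<^sub>1)\<^sup>2 - (Re p\<^sub>2)\<^sup>2)) * exp ((p\<^sub>1 + cnj p\<^sub>2)\<^sup>2 / 2) *
        (exp (- (\<i> * of_real (Re p\<^sub>1 * Im p\<^sub>1))) * exp (\<i> * of_real (Re p\<^sub>2 * Im p\<^sub>2))) =
        exp (- (1 / 2) * (of_real ((cmod p\<^sub>1)\<^sup>2) + of_real ((cmod p\<^sub>2)\<^sup>2) - 2 * (p\<^sub>1 * cnj p\<^sub>2)))"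
      unfolding exp_add[symmetric]
      by (rule arg_cong[where f = exp])
        (simp add: complex_eq_iff cmod_power2 Re_power2 Im_power2, simp add: power2_eq_square field_simps)
    then show ?thesis
      unfolding gin_bulk_def cn mult.assoc[of 2] pp phi by (simp add: mult_ac)
  qed
  finally have lim: "(\<lambda>k. 1 / of_real pi * (1 / of_real (sqrt (2 * pi))) *
      exp (complex_of_real (M k * (Re (Ln (1 + a k (v\<^sub>1 k))) + Re (Ln (1 + a k (v\<^sub>2 k)))))) *
      csqrt ((weight c (M k) (z k (v\<^sub>1 k)) / of_real (weight_scale (M k) (A k) (Re (Ln (1 + a k (v\<^sub>1 k)))))) *
           (weight c (M k) (z k (v\<^sub>2 k)) / of_real (weight_scale (M k) (A k) (Re (Ln (1 + a k (v\<^sub>2 k))))))) *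
      (of_real (sqrt (M k / A k)) * (\<Sum>j<N k. kernel_summand (M k) (A k) (l k) j)) *
      (cnj (\<phi> (v\<^sub>1 k)) * \<phi> (v\<^sub>2 k))) \<longlonglongrightarrow> gin_bulk w\<^sub>1 w\<^sub>2 * I" .
  show ?thesis
  proof (rule Lim_transform_eventually[OF lim])
    show "eventually (\<lambda>k. 1 / of_real pi * (1 / of_real (sqrt (2 * pi))) *
      exp (complex_of_real (M k * (Re (Ln (1 + a k (v\<^sub>1 k))) + Re (Ln (1 + a k (v\<^sub>2 k)))))) *
      csqrt ((weight c (M k) (z k (v\<^sub>1 k)) / of_real (weight_scale (M k) (A k) (Re (Ln (1 + a k (v\<^sub>1 k)))))) *
           (weight c (M k) (z k (v\<^sub>2 k)) / of_real (weight_scale (M k) (A k) (Re (Ln (1 + a k (v\<^sub>2 k))))))) *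
      (of_real (sqrt (M k / A k)) * (\<Sum>j<N k. kernel_summand (M k) (A k) (l k) j)) *
      (cnj (\<phi> (v\<^sub>1 k)) * \<phi> (v\<^sub>2 k)) =
      of_real (M k / (N k * (cmod u)\<^sup>2)) * of_real (cmod (z k (v\<^sub>1 k)) * cmod (z k (v\<^sub>2 k))) *
      product_kernel c (M k) (N k) (z k (v\<^sub>1 k)) (z k (v\<^sub>2 k)) *
      (cnj (kernel_gauge (M k) (N k) u \<theta> (v\<^sub>1 k)) * kernel_gauge (M k) (N k) u \<theta> (v\<^sub>2 k))) sequentially"
      using nz[OF v(1)] nz[OF v(2)]
    proof eventually_elim
      case (elim k)
      \<comment> \<open>The phases that need not converge; they cancel against the gauge at finite
        \<open>k\<close>, so that only \<open>\<phi>\<close> is left.\<close>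
      define g\<^sub>1 g\<^sub>2 where "g\<^sub>1 = exp (\<i> * of_real (M k * A k * Im (Ln (1 + a k (v\<^sub>1 k)))))"
        and "g\<^sub>2 = exp (\<i> * of_real (M k * A k * Im (Ln (1 + a k (v\<^sub>2 k)))))"
      have K: "kernel_gauge (M k) (N k) u \<theta> (v\<^sub>1 k) = g\<^sub>1 * \<phi> (v\<^sub>1 k)" "kernel_gauge (M k) (N k) u \<theta> (v\<^sub>2 k) = g\<^sub>2 * \<phi> (v\<^sub>2 k)"
        by (simp_all add: kernel_gauge_def g\<^sub>1_def g\<^sub>2_def \<phi>_def ph_def a_def A_def)
      have gg: "g\<^sub>1 * cnj g\<^sub>1 = 1" "cnj g\<^sub>2 * g\<^sub>2 = 1" "exp (- (\<i> * of_real (M k * A k * Im (Ln (1 + a k (v\<^sub>2 k)))))) = cnj g\<^sub>2"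
        by (simp_all add: g\<^sub>1_def g\<^sub>2_def exp_cnj flip: exp_add)
      have z_eq: "z k v = (of_real (sqrt (real (N k))) * u) ^ M k * (1 + a k v) ^ M k" for v
        by (simp add: z_def a_def)
      have rk: "of_real (M k / (N k * (cmod u)\<^sup>2)) * of_real (cmod (z k (v\<^sub>1 k)) * cmod (z k (v\<^sub>2 k))) *
          product_kernel c (M k) (N k) (z k (v\<^sub>1 k)) (z k (v\<^sub>2 k)) =
          1 / of_real pi * (1 / of_real (sqrt (2 * pi))) *
          exp (complex_of_real (M k * (Re (Ln (1 + a k (v\<^sub>1 k))) + Re (Ln (1 + a k (v\<^sub>2 k)))))) *
          csqrt ((weight c (M k) (z k (v\<^sub>1 k)) / of_real (weight_scale (M k) (A k) (Re (Ln (1 + a k (v\<^sub>1 k)))))) *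
           (weight c (M k) (z k (v\<^sub>2 k)) / of_real (weight_scale (M k) (A k) (Re (Ln (1 + a k (v\<^sub>2 k))))))) *
          (of_real (sqrt (M k / A k)) * (\<Sum>j<N k. kernel_summand (M k) (A k) (l k) j)) * (g\<^sub>1 * cnj g\<^sub>2)"
        using rescaled_kernel_eq[OF A0[of k] r[of k] M[of k] elim, of c "N k", folded z_eq]
        unfolding l_def g\<^sub>1_def gg(3)[symmetric] A_def by simp
      have "(g\<^sub>1 * cnj g\<^sub>2) * (cnj (g\<^sub>1 * \<phi> (v\<^sub>1 k)) * (g\<^sub>2 * \<phi> (v\<^sub>2 k))) =
          (g\<^sub>1 * cnj g\<^sub>1) * (cnj g\<^sub>2 * g\<^sub>2) * (cnj (\<phi> (v\<^sub>1 k)) * \<phi> (v\<^sub>2 k))"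
        by (simp only: complex_cnj_mult mult_ac)
      then have "(g\<^sub>1 * cnj g\<^sub>2) * (cnj (g\<^sub>1 * \<phi> (v\<^sub>1 k)) * (g\<^sub>2 * \<phi> (v\<^sub>2 k))) = cnj (\<phi> (v\<^sub>1 k)) * \<phi> (v\<^sub>2 k)"
        by (simp only: gg mult_1_left)
      then show ?case unfolding rk K mult.assoc[of _ "g\<^sub>1 * cnj g\<^sub>2"] by (simp only:)
    qed
  qed
qed

section \<open>Uniform convergence of the correlation functions\<close>

text \<open>If uniformity failed, there would be infinitely many bad indices, each with a bad point
  in \<open>K\<close>; a convergent subsequence of these points contradicts \<open>seq\<close>. This
  is why \<open>seq\<close> allows an arbitrary subsequence \<open>r\<close> of the indices.\<close>

lemma uniform_limit_compactI:
  fixes f :: "nat \<Rightarrow> 'a::metric_space \<Rightarrow> 'b::metric_space"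
  assumes K: "compact K" and g: "continuous_on K g"
    and seq: "\<And>r x l. strict_mono r \<Longrightarrow> (\<And>n. x n \<in> K) \<Longrightarrow> x \<longlonglongrightarrow> l \<Longrightarrow> l \<in> K \<Longrightarrow>
      (\<lambda>n. f (r n) (x n)) \<longlonglongrightarrow> g l"
  shows "uniform_limit K f g sequentially"
proof (rule ccontr)
  assume "\<not> uniform_limit K f g sequentially"
  then obtain e where e: "e > 0" and fr: "\<not> eventually (\<lambda>n. \<forall>x\<in>K. dist (f n x) (g x) < e) sequentially"
    by (auto simp: uniform_limit_iff)
  define B where "B = {n. \<exists>x\<in>K. dist (f n x) (g x) \<ge> e}"
  have "infinite B"
    using fr by (auto simp: B_def eventually_sequentially infinite_nat_iff_unbounded_le not_less)
  define r where "r = enumerate B"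
  have r: "strict_mono r" "\<And>n. r n \<in> B"
    unfolding r_def using \<open>infinite B\<close> by (auto simp: strict_mono_enumerate enumerate_in_set)
  then have "\<exists>x\<in>K. dist (f (r n) x) (g x) \<ge> e" for n by (auto simp: B_def)
  then obtain x where x: "\<And>n. x n \<in> K" "\<And>n. dist (f (r n) (x n)) (g (x n)) \<ge> e" by metis
  obtain l s where s: "l \<in> K" "strict_mono s" "(x \<circ> s) \<longlonglongrightarrow> l"
    using K x(1) unfolding compact_def by blast
  have "(\<lambda>n. f ((r \<circ> s) n) ((x \<circ> s) n)) \<longlonglongrightarrow> g l"
    using r(1) s x(1) by (intro seq strict_mono_o) (auto simp: o_def)
  moreover have "(\<lambda>n. g ((x \<circ> s) n)) \<longlonglongrightarrow> g l"
    using s x(1) by (intro continuous_on_tendsto_compose[OF g]) (auto simp: o_def)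
  ultimately have "(\<lambda>n. dist (f ((r \<circ> s) n) ((x \<circ> s) n)) (g ((x \<circ> s) n))) \<longlonglongrightarrow> dist (g l) (g l)"
    by (rule tendsto_dist)
  then have "eventually (\<lambda>n. dist (f ((r \<circ> s) n) ((x \<circ> s) n)) (g ((x \<circ> s) n)) < e) sequentially"
    using e by (intro order_tendstoD) auto
  then obtain n where "dist (f ((r \<circ> s) n) ((x \<circ> s) n)) (g ((x \<circ> s) n)) < e"
    by (auto simp: eventually_sequentially)
  with x(2)[of "s n"] show False by simp
qed

lemma compact_vec_components:
  fixes S :: "'a::euclidean_space set"
  assumes "compact S"
  shows "compact {v :: 'a ^ 'n. \<forall>i. v $ i \<in> S}"
proof -
  have "closed S" "bounded S" using assms by (auto simp: compact_eq_bounded_closed)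
  from this(2) obtain B where B: "\<And>x. x \<in> S \<Longrightarrow> norm x \<le> B" by (auto simp: bounded_iff)
  have "bounded {v :: 'a ^ 'n. \<forall>i. v $ i \<in> S}"
    unfolding bounded_iff
  proof (intro exI ballI)
    fix v :: "'a ^ 'n" assume "v \<in> {v. \<forall>i. v $ i \<in> S}"
    then have "(\<Sum>i\<in>UNIV. norm (v $ i)) \<le> (\<Sum>i\<in>(UNIV :: 'n set). B)"
      by (intro sum_mono B) auto
    moreover have "norm v \<le> (\<Sum>i\<in>UNIV. norm (v $ i))"
      by (simp add: norm_vec_def L2_set_le_sum)
    ultimately show "norm v \<le> (\<Sum>i\<in>(UNIV :: 'n set). B)" by linarith
  qed
  moreover have "closed {v :: 'a ^ 'n. \<forall>i. v $ i \<in> S}"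
  proof -
    have "closed ((\<lambda>v :: 'a ^ 'n. v $ i) -` S)" for i
      using \<open>closed S\<close> by (intro continuous_closed_vimage) (auto intro!: continuous_intros)
    then have "closed (\<Inter>i. (\<lambda>v :: 'a ^ 'n. v $ i) -` S)" by auto
    moreover have "(\<Inter>i. (\<lambda>v :: 'a ^ 'n. v $ i) -` S) = {v. \<forall>i. v $ i \<in> S}" by auto
    ultimately show ?thesis by simp
  qed
  ultimately show ?thesis by (simp add: compact_eq_bounded_closed)
qed

text \<open>Each permutation picks every row and every column once, so each term of the Leibniz sum
  carries the same factor.\<close>

lemma det_scale_rows_columns:
  fixes a :: "'a::comm_ring_1" and x y :: "'n::finite \<Rightarrow> 'a"
  shows "det (\<chi> i j. a * (x i * y j) * K i j) = a ^ CARD('n) * (prod x UNIV * prod y UNIV) * det (\<chi> i j. K i j)"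
proof -
  have "(\<Prod>i\<in>UNIV. a * (x i * y (p i)) * K i (p i)) =
      a ^ CARD('n) * (prod x UNIV * prod y UNIV) * (\<Prod>i\<in>UNIV. K i (p i))" if "p permutes UNIV" for p
  proof -
    have "(\<Prod>i\<in>UNIV. y (p i)) = prod y UNIV"
      using prod.permute[OF that, of y] by (simp add: o_def)
    then show ?thesis by (simp add: prod.distrib)
  qed
  then have "of_int (sign p) * (\<Prod>i\<in>UNIV. a * (x i * y (p i)) * K i (p i)) =
      a ^ CARD('n) * (prod x UNIV * prod y UNIV) * (of_int (sign p) * (\<Prod>i\<in>UNIV. K i (p i)))"
    if "p permutes UNIV" for p
    using that by (simp add: mult_ac)
  then show ?thesis
    unfolding Determinants.det_def sum_distrib_left by (intro sum.cong) auto
qed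

lemma tendsto_det:
  fixes K :: "'b \<Rightarrow> 'n::finite \<Rightarrow> 'n \<Rightarrow> 'a::{comm_ring_1, real_normed_algebra_1}"
  assumes "\<And>i j. ((\<lambda>k. K k i j) \<longlongrightarrow> L i j) F"
  shows "((\<lambda>k. det (\<chi> i j. K k i j)) \<longlongrightarrow> det (\<chi> i j. L i j)) F"
  unfolding Determinants.det_def by (auto intro!: tendsto_intros assms)

text \<open>The moduli \<open>\<bar>z\<^sub>i\<bar>\<close>, attached to row \<open>i\<close> and
  column \<open>i\<close>, produce the squared product in front of \<open>R\<close>, while the gauge
  factors cancel between rows and columns. The determinantal formula is available only at points
  with nonzero coordinates, which the scaled points eventually have.\<close>

lemma rescaled_correlation_tendsto:
  fixes M N :: "nat \<Rightarrow> nat" and R :: "nat \<Rightarrow> complex ^ 'n \<Rightarrow> real"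
    and v :: "nat \<Rightarrow> complex ^ 'n" and w :: "complex ^ 'n" and c \<theta> :: real and u :: complex
  assumes M: "\<And>k. M k > 0" and N: "\<And>k. N k > 0" "filterlim (\<lambda>k. real (N k)) at_top sequentially"
    and MN: "(\<lambda>k. real (M k) / real (N k)) \<longlonglongrightarrow> 0"
    and c: "c > 0" and u: "u = of_real (cmod u) * exp (\<i> * of_real \<theta>)" "u \<noteq> 0"
    and R: "\<And>k z. (\<forall>i. z $ i \<noteq> 0) \<Longrightarrow> complex_of_real (R k z) =
      det (\<chi> i j. product_kernel c (M k) (N k) (z $ i) (z $ j))"
    and v: "v \<longlonglongrightarrow> w"
    and E: "E \<in> sets borel" "\<And>x. x \<noteq> 0 \<Longrightarrow> eventually (\<lambda>k. N k * (cmod u)\<^sup>2 + sqrt (N k * (cmod u)\<^sup>2 / M k) * x < N k \<longleftrightarrow> x \<in> E) sequentially"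
    and I: "\<And>b. (\<integral>x. indicator E x *\<^sub>R exp (- (of_real x)\<^sup>2 / 2 + b * of_real x) \<partial>lborel) =
      of_real (sqrt (2 * pi)) * exp (b\<^sup>2 / 2) * I b"
  shows "(\<lambda>k. complex_of_real ((real (M k) / (real (N k) * (cmod u)\<^sup>2)) ^ CARD('n) *
      (cmod (\<Prod>i\<in>UNIV. scaled_points (M k) (N k) u (v k) $ i))\<^sup>2 * R k (scaled_points (M k) (N k) u (v k))))
    \<longlonglongrightarrow> det (\<chi> i j. gin_bulk (w $ i) (w $ j) *
      I (exp (- \<i> * of_real \<theta>) * w $ i + cnj (exp (- \<i> * of_real \<theta>) * w $ j)))"
proof -
  define z where "z = (\<lambda>k y. (of_real (sqrt (real (N k))) * u) ^ M k * (1 + y / (u * of_real (sqrt (real (M k) * real (N k))))) ^ M k)"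
  define g where "g = (\<lambda>k y. kernel_gauge (M k) (N k) u \<theta> y)"
  define al where "al = (\<lambda>k. real (M k) / (real (N k) * (cmod u)\<^sup>2))"
  have vi: "(\<lambda>k. v k $ i) \<longlonglongrightarrow> w $ i" for i using v by (intro tendsto_intros)
  have lim: "(\<lambda>k. det (\<chi> i j. of_real (al k) * of_real (cmod (z k (v k $ i)) * cmod (z k (v k $ j))) *
      product_kernel c (M k) (N k) (z k (v k $ i)) (z k (v k $ j)) *
      (cnj (g k (v k $ i)) * g k (v k $ j))))
    \<longlonglongrightarrow> det (\<chi> i j. gin_bulk (w $ i) (w $ j) *
      I (exp (- \<i> * of_real \<theta>) * w $ i + cnj (exp (- \<i> * of_real \<theta>) * w $ j)))"
    unfolding z_def g_def al_def
    by (intro tendsto_det rescaled_kernel_tendsto[OF M N MN c u vi vi E I])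
  have mn: "filterlim (\<lambda>k. real (M k) * real (N k)) at_top sequentially"
  proof (rule filterlim_at_top_mono[OF N(2)])
    show "eventually (\<lambda>k. real (N k) \<le> real (M k) * real (N k)) sequentially"
    proof (intro always_eventually allI)
      fix k
      show "real (N k) \<le> real (M k) * real (N k)"
        using mult_right_mono[of 1 "real (M k)" "real (N k)"] M[of k] by simp
    qed
  qed
  have "eventually (\<lambda>k. z k (v k $ i) \<noteq> 0) sequentially" for i
  proof -
    have "(\<lambda>k. norm (v k $ i) / cmod u * inverse (sqrt (real (M k) * real (N k)))) \<longlonglongrightarrow> norm (w $ i) / cmod u * 0"
      using u(2) by (intro tendsto_intros vi tendsto_inverse_0_at_top filterlim_compose[OF sqrt_at_top mn]) auto
    then have "eventually (\<lambda>k. norm (v k $ i) / cmod u * inverse (sqrt (real (M k) * real (N k))) < 1) sequentially"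
      by (rule order_tendstoD) simp
    then show ?thesis
    proof eventually_elim
      case (elim k)
      define t where "t = v k $ i / (u * of_real (sqrt (real (M k) * real (N k))))"
      have "norm t < 1" using elim by (simp add: t_def norm_divide norm_mult field_simps)
      then have "1 + t \<noteq> 0" by (metis add_eq_0_iff norm_minus_cancel norm_one less_irrefl)
      then show ?case using u(2) N(1)[of k] by (simp add: z_def flip: t_def)
    qed
  qed
  then have "eventually (\<lambda>k. \<forall>i. z k (v k $ i) \<noteq> 0) sequentially"
    by (rule eventually_all_finite)
  then have "eventually (\<lambda>k. det (\<chi> i j. of_real (al k) * of_real (cmod (z k (v k $ i)) * cmod (z k (v k $ j))) *
      product_kernel c (M k) (N k) (z k (v k $ i)) (z k (v k $ j)) *
      (cnj (g k (v k $ i)) * g k (v k $ j))) =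
      complex_of_real ((real (M k) / (real (N k) * (cmod u)\<^sup>2)) ^ CARD('n) *
      (cmod (\<Prod>i\<in>UNIV. scaled_points (M k) (N k) u (v k) $ i))\<^sup>2 * R k (scaled_points (M k) (N k) u (v k)))) sequentially"
  proof eventually_elim
    case (elim k)
    define zz where "zz = (\<lambda>i. z k (v k $ i))"
    define gg where "gg = (\<lambda>i. g k (v k $ i))"
    have sp: "scaled_points (M k) (N k) u (v k) = (\<chi> i. zz i)"
      by (simp add: scaled_points_def zz_def z_def)
    have "det (\<chi> i j. of_real (al k) * of_real (cmod (zz i) * cmod (zz j)) *
        product_kernel c (M k) (N k) (zz i) (zz j) * (cnj (gg i) * gg j)) =
      det (\<chi> i j. of_real (al k) * ((of_real (cmod (zz i)) * cnj (gg i)) * (of_real (cmod (zz j)) * gg j)) *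
        product_kernel c (M k) (N k) (zz i) (zz j))"
      by (simp add: mult_ac)
    also have "\<dots> = of_real (al k) ^ CARD('n) * ((\<Prod>i\<in>UNIV. of_real (cmod (zz i)) * cnj (gg i)) * (\<Prod>i\<in>UNIV. of_real (cmod (zz i)) * gg i)) *
        det (\<chi> i j. product_kernel c (M k) (N k) (zz i) (zz j))"
      by (rule det_scale_rows_columns)
    also have "(\<Prod>i\<in>UNIV. complex_of_real (cmod (zz i)) * cnj (gg i)) * (\<Prod>i\<in>UNIV. of_real (cmod (zz i)) * gg i) =
        (\<Prod>i\<in>UNIV. (of_real (cmod (zz i)))\<^sup>2 * (cnj (gg i) * gg i))"
      by (simp add: power2_eq_square mult_ac flip: prod.distrib)
    also have "\<dots> = of_real ((cmod (\<Prod>i\<in>UNIV. zz i))\<^sup>2)"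
      by (simp add: gg_def g_def cnj_kernel_gauge prod_norm[symmetric] prod_power_distrib)
    also have "det (\<chi> i j. product_kernel c (M k) (N k) (zz i) (zz j)) = of_real (R k (\<chi> i. zz i))"
      using R[of "\<chi> i. zz i" k] elim by (simp add: zz_def)
    finally show ?case
      unfolding sp by (simp add: al_def zz_def gg_def)
  qed
  with lim show ?thesis by (rule Lim_transform_eventually)
qed

section \<open>Continuity of the limit kernels, and the two regimes\<close>

lemma continuous_on_gin_bulk:
  "continuous_on A (\<lambda>v :: complex ^ 'n. gin_bulk (v $ i) (v $ j))"
  unfolding gin_bulk_def by (intro continuous_intros)

lemma gin_edge_eq:
  "gin_edge \<theta> x y = gin_bulk x y *
    (erfc ((exp (- \<i> * of_real \<theta>) * x + cnj (exp (- \<i> * of_real \<theta>) * y)) / of_real (sqrt 2)) / 2)"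
  by (simp add: gin_edge_def gin_bulk_def exp_cnj)

lemma continuous_on_gin_edge:
  "continuous_on A (\<lambda>v :: complex ^ 'n. gin_edge \<theta> (v $ i) (v $ j))"
  unfolding gin_edge_def
  by (intro continuous_intros continuous_on_compose2[OF holomorphic_on_imp_continuous_on[OF erfc_holomorphic]]) auto

lemma continuous_on_det:
  fixes K :: "'b::topological_space \<Rightarrow> 'n::finite \<Rightarrow> 'n \<Rightarrow> 'a::{comm_ring_1, real_normed_algebra_1}"
  assumes "\<And>i j. continuous_on A (\<lambda>v. K v i j)"
  shows "continuous_on A (\<lambda>v. det (\<chi> i j. K v i j))"
  using assms unfolding continuous_on_def by (intro ballI tendsto_det) auto

theorem theorem1p3:
  fixes M N :: "nat \<Rightarrow> nat"
    and P :: "nat \<Rightarrow> 'a measure"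
    and X :: "nat \<Rightarrow> nat \<Rightarrow> 'a \<Rightarrow> complex mat"
    and R :: "nat \<Rightarrow> complex ^ 'n \<Rightarrow> real"
    and c \<theta> :: real and u :: complex and S :: "complex set"
  assumes pos: "\<And>k. M k > 0" "\<And>k. N k > 0"
    and lim: "filterlim (\<lambda>k. M k + N k) at_top sequentially"
      "(\<lambda>k. real (M k) / real (N k)) \<longlonglongrightarrow> 0"
    and ginibre: "\<And>k. iid_ginibre (P k) (X k) (M k) (N k)"
    and correlation: "\<And>k. correlation_function (P k)
      (\<lambda>\<omega>. eigenvalues (mat_product (N k) (\<lambda>m. X k m \<omega>) (M k))) (R k)"
    and c: "c > 0"
    and determinantal: "\<And>k z. (\<forall>i. z $ i \<noteq> 0) \<Longrightarrow> complex_of_real (R k z) =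
      det (\<chi> i j. product_kernel c (M k) (N k) (z $ i) (z $ j))"
    and u: "u = of_real (cmod u) * exp (\<i> * of_real \<theta>)" "- pi < \<theta>" "\<theta> \<le> pi"
    and S: "compact S"
  shows "(0 < cmod u \<and> cmod u < 1 \<longrightarrow>
      uniform_limit {v. \<forall>i. v $ i \<in> S}
        (\<lambda>k v. complex_of_real (
          (real (M k) / (real (N k) * (cmod u)\<^sup>2)) ^ CARD('n) *
          (cmod (\<Prod>i\<in>UNIV. scaled_points (M k) (N k) u v $ i))\<^sup>2 *
          R k (scaled_points (M k) (N k) u v)))
        (\<lambda>v. det (\<chi> i j. gin_bulk (v $ i) (v $ j))) sequentially) \<and>
    (cmod u = 1 \<longrightarrow>
      uniform_limit {v. \<forall>i. v $ i \<in> S}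
        (\<lambda>k v. complex_of_real (
          (real (M k) / (real (N k) * (cmod u)\<^sup>2)) ^ CARD('n) *
          (cmod (\<Prod>i\<in>UNIV. scaled_points (M k) (N k) u v $ i))\<^sup>2 *
          R k (scaled_points (M k) (N k) u v)))
        (\<lambda>v. det (\<chi> i j. gin_edge \<theta> (v $ i) (v $ j))) sequentially)"
proof (intro conjI impI)
  define F where "F = (\<lambda>k v. complex_of_real (
          (real (M k) / (real (N k) * (cmod u)\<^sup>2)) ^ CARD('n) *
          (cmod (\<Prod>i\<in>UNIV. scaled_points (M k) (N k) u v $ i))\<^sup>2 *
          R k (scaled_points (M k) (N k) u v)))"
  have K: "compact {v :: complex ^ 'n. \<forall>i. v $ i \<in> S}"
    by (rule compact_vec_components[OF S])
  have N_lim: "filterlim (\<lambda>k. real (N k)) at_top sequentially"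
  proof -
    \<comment> \<open>As \<open>M \<ge> 1\<close>, \<open>1 / N\<close> is at most
      \<open>M / N\<close>.\<close>
    have "(\<lambda>k. inverse (real (N k))) \<longlonglongrightarrow> 0"
    proof (rule Lim_null_comparison[OF _ lim(2)])
      show "eventually (\<lambda>k. norm (inverse (real (N k))) \<le> real (M k) / real (N k)) sequentially"
      proof (intro always_eventually allI)
        fix k
        show "norm (inverse (real (N k))) \<le> real (M k) / real (N k)"
          using divide_right_mono[of 1 "real (M k)" "real (N k)"] pos(1)[of k] by (simp add: inverse_eq_divide)
      qed
    qed
    then have "filterlim (\<lambda>k. inverse (inverse (real (N k)))) at_top sequentially"
      by (rule filterlim_inverse_at_top) (simp add: pos)
    then show ?thesis by simp
  qed
  have sub: "filterlim (\<lambda>k. real (N (r k))) at_top sequentially"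
    "(\<lambda>k. real (M (r k)) / real (N (r k))) \<longlonglongrightarrow> 0" if "strict_mono r" for r
    using filterlim_compose[OF N_lim filterlim_subseq[OF that]]
      LIMSEQ_subseq_LIMSEQ[OF lim(2) that] by (simp_all add: o_def)
  {
    assume u': "0 < cmod u \<and> cmod u < 1"
    \<comment> \<open>In the bulk the cutoff lies at distance
      \<open>N * (1 - \<bar>u\<bar>\<^sup>2)\<close> above \<open>A\<close>, far beyond the width
      \<open>sqrt (A / M) \<le> sqrt N\<close>, so no \<open>x\<close> is cut off in the
      limit.\<close>
    have E: "eventually (\<lambda>k. N' k * (cmod u)\<^sup>2 + sqrt (N' k * (cmod u)\<^sup>2 / M' k) * x < N' k \<longleftrightarrow> x \<in> UNIV) sequentially"
      if M': "\<And>k. M' k > 0" and N': "filterlim (\<lambda>k. real (N' k)) at_top sequentially" for M' N' :: "nat \<Rightarrow> nat" and x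
    proof -
      have q: "1 - (cmod u)\<^sup>2 > 0" using u' by (simp add: power_less_one_iff abs_square_less_1)
      have "eventually (\<lambda>k. sqrt (N' k) > \<bar>x\<bar> / (1 - (cmod u)\<^sup>2)) sequentially"
        using filterlim_compose[OF sqrt_at_top N'] by (simp add: filterlim_at_top_dense)
      then show ?thesis
      proof eventually_elim
        case (elim k)
        have N0: "sqrt (N' k) > 0" using elim q by (meson abs_ge_zero divide_nonneg_pos le_less_trans)
        have "N' k * (cmod u)\<^sup>2 / M' k \<le> real (N' k) * 1 / 1"
        proof (rule frac_le)
          show "N' k * (cmod u)\<^sup>2 \<le> real (N' k) * 1" using q by (intro mult_left_mono) auto
        qed (use M'[of k] in auto)
        then have "sqrt (N' k * (cmod u)\<^sup>2 / M' k) * \<bar>x\<bar> \<le> sqrt (N' k) * \<bar>x\<bar>"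
          by (intro mult_right_mono) auto
        also have "\<dots> < sqrt (N' k) * (sqrt (N' k) * (1 - (cmod u)\<^sup>2))"
          using elim q N0 by (intro mult_strict_left_mono) (auto simp: divide_less_eq)
        also have "\<dots> = N' k * (1 - (cmod u)\<^sup>2)" by simp
        finally have "sqrt (N' k * (cmod u)\<^sup>2 / M' k) * \<bar>x\<bar> < N' k * (1 - (cmod u)\<^sup>2)" .
        moreover have "sqrt (N' k * (cmod u)\<^sup>2 / M' k) * x \<le> sqrt (N' k * (cmod u)\<^sup>2 / M' k) * \<bar>x\<bar>"
          by (intro mult_left_mono) auto
        ultimately show ?case by (simp add: algebra_simps)
      qed
    qed
    have "uniform_limit {v. \<forall>i. v $ i \<in> S} F (\<lambda>v. det (\<chi> i j. gin_bulk (v $ i) (v $ j))) sequentially"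
    proof (rule uniform_limit_compactI[OF K])
      show "continuous_on {v. \<forall>i. v $ i \<in> S} (\<lambda>v. det (\<chi> i j. gin_bulk (v $ i) (v $ j)))"
        by (intro continuous_on_det continuous_on_gin_bulk)
      fix r :: "nat \<Rightarrow> nat" and x :: "nat \<Rightarrow> complex ^ 'n" and l :: "complex ^ 'n"
      assume r: "strict_mono r" and x: "x \<longlonglongrightarrow> l"
      have "(\<lambda>k. F (r k) (x k)) \<longlonglongrightarrow> det (\<chi> i j. gin_bulk (l $ i) (l $ j) * 1)"
        unfolding F_def
      proof (rule rescaled_correlation_tendsto[OF pos(1) pos(2) sub[OF r] c u(1) _ determinantal x, where E = UNIV])
        show "u \<noteq> 0" using u' by auto
        show "(\<integral>x. indicator UNIV x *\<^sub>R exp (- (of_real x)\<^sup>2 / 2 + b * of_real x) \<partial>lborel) =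
            of_real (sqrt (2 * pi)) * exp (b\<^sup>2 / 2) * 1" for b :: complex
          using integral_gaussian_linear[of b] by simp
      qed (use E[of "\<lambda>k. M (r k)" "\<lambda>k. N (r k)"] pos sub(1)[OF r] in auto)
      then show "(\<lambda>k. F (r k) (x k)) \<longlonglongrightarrow> det (\<chi> i j. gin_bulk (l $ i) (l $ j))"
        by simp
    qed
    then show "uniform_limit {v. \<forall>i. v $ i \<in> S}
        (\<lambda>k v. complex_of_real (
          (real (M k) / (real (N k) * (cmod u)\<^sup>2)) ^ CARD('n) *
          (cmod (\<Prod>i\<in>UNIV. scaled_points (M k) (N k) u v $ i))\<^sup>2 *
          R k (scaled_points (M k) (N k) u v)))
        (\<lambda>v. det (\<chi> i j. gin_bulk (v $ i) (v $ j))) sequentially"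
      unfolding F_def .
  next
    assume u': "cmod u = 1"
    have "uniform_limit {v. \<forall>i. v $ i \<in> S} F (\<lambda>v. det (\<chi> i j. gin_edge \<theta> (v $ i) (v $ j))) sequentially"
    proof (rule uniform_limit_compactI[OF K])
      show "continuous_on {v. \<forall>i. v $ i \<in> S} (\<lambda>v. det (\<chi> i j. gin_edge \<theta> (v $ i) (v $ j)))"
        by (intro continuous_on_det continuous_on_gin_edge)
      fix r :: "nat \<Rightarrow> nat" and x :: "nat \<Rightarrow> complex ^ 'n" and l :: "complex ^ 'n"
      assume r: "strict_mono r" and x: "x \<longlonglongrightarrow> l"
      show "(\<lambda>k. F (r k) (x k)) \<longlonglongrightarrow> det (\<chi> i j. gin_edge \<theta> (l $ i) (l $ j))"
        unfolding F_def gin_edge_eq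
      proof (rule rescaled_correlation_tendsto[OF pos(1) pos(2) sub[OF r] c u(1) _ determinantal x, where E = "{..<0}"])
        show "u \<noteq> 0" using u' by auto
        show "(\<integral>x. indicator {..<0} x *\<^sub>R exp (- (of_real x)\<^sup>2 / 2 + b * of_real x) \<partial>lborel) =
            of_real (sqrt (2 * pi)) * exp (b\<^sup>2 / 2) * (erfc (b / of_real (sqrt 2)) / 2)" for b :: complex
          using integral_gaussian_linear_halfline[of b] by simp
        \<comment> \<open>At the edge \<open>A = N\<close> exactly, so the cutoff is the sign
          condition \<open>x < 0\<close> for every \<open>k\<close>.\<close>
        show "eventually (\<lambda>k. N (r k) * (cmod u)\<^sup>2 + sqrt (N (r k) * (cmod u)\<^sup>2 / M (r k)) * x < N (r k) \<longleftrightarrow> x \<in> {..<0}) sequentially" for x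
          using u' pos by (simp add: mult_less_0_iff divide_less_0_iff)
      qed auto
    qed
    then show "uniform_limit {v. \<forall>i. v $ i \<in> S}
        (\<lambda>k v. complex_of_real (
          (real (M k) / (real (N k) * (cmod u)\<^sup>2)) ^ CARD('n) *
          (cmod (\<Prod>i\<in>UNIV. scaled_points (M k) (N k) u v $ i))\<^sup>2 *
          R k (scaled_points (M k) (N k) u v)))
        (\<lambda>v. det (\<chi> i j. gin_edge \<theta> (v $ i) (v $ j))) sequentially"
      unfolding F_def .
  }
qed

end
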